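(* Let $K$ be an arbitrary field of characteristic $p\ge 0$, let $S=K[t_1,\ldots,t_s]$, let $\mathcal{L}\subset\mathbb{Z}^s$ be a lattice and let $I(\mathcal{L})\subset S$ be its lattice ideal. Let $c$ be the number of associated primes of $I(\mathcal{L})$ and, for $p>0$, let $G$ be the unique largest subgroup of $T(\mathbb{Z}^s/\mathcal{L})$ whose order is relatively prime to $p$. Then: (a) All associated primes of $I(\mathcal{L})$ have height equal to ${\rm rank}(\mathcal{L})$. (b) $|T(\mathbb{Z}^s/\mathcal{L})|\geq c$ if $p=0$, and $|G|\geq c$ if $p>0$, with equality if $K$ is algebraically closed. (c) $\deg(S/I(\mathcal{L}))\geq |T(\mathbb{Z}^s/\mathcal{L})|$ if $p=0$, and $\deg(S/I(\mathcal{L}))\geq |G|$ if $p>0$.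
   Context: A lattice is a subgroup $\mathcal{L}$ of $\mathbb{Z}^s$. For $a\in\mathbb{Z}^s$ write $a=a^+-a^-$ with $a^+,a^-\in\mathbb{N}^s$ of disjoint support, where $\mathbb{N}=\{0,1,2,\ldots\}$, and $t^c=t_1^{c_1}\cdots t_s^{c_s}$. The lattice ideal of $\mathcal{L}$ over $K$ is $I(\mathcal{L})=(t^{a^+}-t^{a^-}\mid a\in\mathcal{L})\subset S$. $T(M)$ denotes the torsion subgroup of an abelian group $M$. For an ideal $I\subset S$ with $k=\dim(S/I)$ (Krull dimension), the degree is $\deg(S/I)=k!\lim_{i\to\infty}\dim_K(S_{\le i}/I_{\le i})/i^k$, where $S_{\le i}$ (resp. $I_{\le i}$) is the space of polynomials of $S$ (resp. of $I$) of (standard total) degree at most $i$. *)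

theory Defs
  imports
    "HOL-Library.Poly_Mapping"
    "HOL-Library.Extended_Nat"
    "HOL-Algebra.Algebraic_Closure_Type"
    "HOL-Algebra.Free_Abelian_Groups"
begin

section \<open>Primes, height, dimension and associated primes in a commutative ring\<close>

text \<open>\<open>Q 0 \<subset> Q 1 \<subset> \<dots> \<subset> Q n\<close> is a chain of prime ideals of length \<open>n\<close>, i.e. with \<open>n + 1\<close> members.\<close>

definition prime_chain :: "('a, 'm) ring_scheme \<Rightarrow> nat \<Rightarrow> (nat \<Rightarrow> 'a set) \<Rightarrow> bool" where
  "prime_chain R n Q \<longleftrightarrow> (\<forall>i\<le>n. primeideal (Q i) R) \<and> (\<forall>i<n. Q i \<subset> Q (Suc i))"

definition prime_height :: "('a, 'm) ring_scheme \<Rightarrow> 'a set \<Rightarrow> enat" where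
  "prime_height R P = Sup {enat n | n. \<exists>Q. prime_chain R n Q \<and> Q n = P}"

definition krull_dim :: "('a, 'm) ring_scheme \<Rightarrow> enat" where
  "krull_dim R = Sup {enat n | n. \<exists>Q. prime_chain R n Q}"

text \<open>The associated primes of an ideal \<open>I\<close> are those of the module \<open>R/I\<close>: the prime ideals that
  are the annihilator \<open>(I : f)\<close> of a single element \<open>f + I\<close> of \<open>R/I\<close>.\<close>

definition associated_primes :: "('a, 'm) ring_scheme \<Rightarrow> 'a set \<Rightarrow> 'a set set" where
  "associated_primes R I =
     {P. primeideal P R \<and> (\<exists>f\<in>carrier R. P = {g \<in> carrier R. g \<otimes>\<^bsub>R\<^esub> f \<in> I})}"


text \<open>The class \<^class>\<open>alg_closed_field\<close> as a condition on a field type, so that it can be a premise.\<close>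

definition field_alg_closed :: "'k::field itself \<Rightarrow> bool" where
  "field_alg_closed (_ :: 'k itself) \<longleftrightarrow>
     (\<forall>q :: 'k poly. Polynomial.degree q > 0 \<longrightarrow> (\<exists>x. poly q x = 0))"


section \<open>The polynomial ring in \<open>s\<close> variables\<close>

text \<open>The variables are indexed by \<open>0, \<dots>, s - 1\<close>. A polynomial maps exponent vectors to
  coefficients; the product of the type is convolution.\<close>

type_synonym 'k mpoly = "(nat \<Rightarrow>\<^sub>0 nat) \<Rightarrow>\<^sub>0 'k"

definition mpoly_ring :: "nat \<Rightarrow> 'k::field mpoly ring" where
  "mpoly_ring s =
     \<lparr>carrier = {f. \<forall>m\<in>Poly_Mapping.keys f. Poly_Mapping.keys m \<subseteq> {..<s}},
      monoid.mult = (*), one = 1, ring.zero = 0, add = (+)\<rparr>"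

lemma mpoly_ring_simps:
  "f \<in> carrier (mpoly_ring s) \<longleftrightarrow> (\<forall>m\<in>Poly_Mapping.keys f. Poly_Mapping.keys m \<subseteq> {..<s})"
  "f \<otimes>\<^bsub>mpoly_ring s\<^esub> g = f * g" "\<one>\<^bsub>mpoly_ring s\<^esub> = 1"
  "f \<oplus>\<^bsub>mpoly_ring s\<^esub> g = f + g" "\<zero>\<^bsub>mpoly_ring s\<^esub> = 0"
  by (simp_all add: mpoly_ring_def)

lemma cring_mpoly_ring: "cring (mpoly_ring s :: 'a::field mpoly ring)"
proof (rule cringI)
  show "abelian_group (mpoly_ring s :: 'a mpoly ring)"
  proof (rule abelian_groupI)
    fix x y :: "'a mpoly" assume "x \<in> carrier (mpoly_ring s)" "y \<in> carrier (mpoly_ring s)"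
    then show "x \<oplus>\<^bsub>mpoly_ring s\<^esub> y \<in> carrier (mpoly_ring s)"
      using Poly_Mapping.keys_add[of x y] by (auto simp: mpoly_ring_simps)
  next
    fix x :: "'a mpoly" assume "x \<in> carrier (mpoly_ring s)"
    then show "\<exists>y\<in>carrier (mpoly_ring s). y \<oplus>\<^bsub>mpoly_ring s\<^esub> x = \<zero>\<^bsub>mpoly_ring s\<^esub>"
      by (intro bexI[of _ "- x"]) (simp_all add: mpoly_ring_simps)
  qed (simp_all add: mpoly_ring_simps ac_simps)
  show "comm_monoid (mpoly_ring s :: 'a mpoly ring)"
  proof (rule comm_monoidI)
    fix x y :: "'a mpoly" assume xy: "x \<in> carrier (mpoly_ring s)" "y \<in> carrier (mpoly_ring s)"
    have "Poly_Mapping.keys m \<subseteq> {..<s}" if m: "m \<in> Poly_Mapping.keys (x * y)" for m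
    proof -
      obtain a b where "m = a + b" "a \<in> Poly_Mapping.keys x" "b \<in> Poly_Mapping.keys y"
        using m keys_mult[of x y] by blast
      then show ?thesis
        using xy Poly_Mapping.keys_add[of a b] unfolding mpoly_ring_simps by blast
    qed
    then show "x \<otimes>\<^bsub>mpoly_ring s\<^esub> y \<in> carrier (mpoly_ring s)"
      by (simp add: mpoly_ring_simps)
  qed (simp_all add: mpoly_ring_simps ac_simps)
qed (simp add: mpoly_ring_simps distrib_right)


section \<open>Lattices and lattice ideals\<close>

text \<open>The group \<open>free_Abelian_group {..<s}\<close> is \<open>\<int>\<^sup>s\<close>. As \<open>nat\<close> sends negative integers
  to \<open>0\<close>, these are the positive and negative part of an integer vector.\<close>

definition pos_part :: "(nat \<Rightarrow>\<^sub>0 int) \<Rightarrow> (nat \<Rightarrow>\<^sub>0 nat)" where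
  "pos_part a = Poly_Mapping.map nat a"

definition neg_part :: "(nat \<Rightarrow>\<^sub>0 int) \<Rightarrow> (nat \<Rightarrow>\<^sub>0 nat)" where
  "neg_part a = Poly_Mapping.map nat (- a)"

definition lattice_ideal :: "nat \<Rightarrow> (nat \<Rightarrow>\<^sub>0 int) set \<Rightarrow> 'k::field mpoly set" where
  "lattice_ideal s L =
     Idl\<^bsub>mpoly_ring s\<^esub> {Poly_Mapping.single (pos_part a) 1 - Poly_Mapping.single (neg_part a) 1 | a. a \<in> L}"

lemma lookup_pos_part: "Poly_Mapping.lookup (pos_part a) i = nat (Poly_Mapping.lookup a i)"
  by (simp add: pos_part_def Poly_Mapping.map.rep_eq when_def)

lemma lookup_neg_part: "Poly_Mapping.lookup (neg_part a) i = nat (- Poly_Mapping.lookup a i)"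
  by (simp add: neg_part_def Poly_Mapping.map.rep_eq when_def)

lemma module_frag_cmul: "Modules.module (frag_cmul :: int \<Rightarrow> ('a \<Rightarrow>\<^sub>0 int) \<Rightarrow> 'a \<Rightarrow>\<^sub>0 int)"
  by unfold_locales (auto simp: frag_cmul_distrib frag_cmul_distrib2)

text \<open>The rank is the supremum of the sizes of the finite \<open>\<int>\<close>-linearly independent subsets.\<close>

definition lattice_rank :: "(nat \<Rightarrow>\<^sub>0 int) set \<Rightarrow> enat" where
  "lattice_rank L = Sup {enat (card B) | B. finite B \<and> B \<subseteq> L \<and> \<not> module.dependent frag_cmul B}"

definition torsion_group :: "('a, 'm) monoid_scheme \<Rightarrow> ('a, 'm) monoid_scheme" where
  "torsion_group A = A\<lparr>carrier := {x \<in> carrier A. \<exists>n::nat. n > 0 \<and> x [^]\<^bsub>A\<^esub> n = \<one>\<^bsub>A\<^esub>}\<rparr>"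

text \<open>\<open>H\<close> is the largest subgroup of \<open>A\<close> of order prime to \<open>p\<close>. For a prime \<open>p\<close>, coprimality
  also makes the subgroups finite, because the cardinality of an infinite set is \<open>0\<close>.\<close>

definition largest_coprime_subgroup :: "nat \<Rightarrow> ('a, 'm) monoid_scheme \<Rightarrow> 'a set \<Rightarrow> bool" where
  "largest_coprime_subgroup p A G \<longleftrightarrow>
     subgroup G A \<and> coprime (card G) p \<and>
     (\<forall>H. subgroup H A \<and> coprime (card H) p \<longrightarrow> H \<subseteq> G)"


section \<open>Degree\<close>

text \<open>The classes of the members of \<open>B\<close> form a basis of the quotient space \<open>V/W\<close>, for subspaces
  \<open>W \<subseteq> V\<close>: every class in \<open>V/W\<close> is a linear combination of them in exactly one way.\<close>

definition quotient_basis ::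
    "('k::field \<Rightarrow> 'v::ab_group_add \<Rightarrow> 'v) \<Rightarrow> 'v set \<Rightarrow> 'v set \<Rightarrow> 'v set \<Rightarrow> bool" where
  "quotient_basis scale V W B \<longleftrightarrow>
     finite B \<and> B \<subseteq> V \<and>
     (\<forall>v\<in>V. \<exists>!c. (\<forall>b. b \<notin> B \<longrightarrow> c b = 0) \<and> v - (\<Sum>b\<in>B. scale (c b) b) \<in> W)"

definition quotient_dim ::
    "('k::field \<Rightarrow> 'v::ab_group_add \<Rightarrow> 'v) \<Rightarrow> 'v set \<Rightarrow> 'v set \<Rightarrow> nat" where
  "quotient_dim scale V W = (THE n. \<exists>B. quotient_basis scale V W B \<and> card B = n)"

definition mpoly_scale :: "'k::field \<Rightarrow> 'k mpoly \<Rightarrow> 'k mpoly" where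
  "mpoly_scale c f = Poly_Mapping.single 0 c * f"

definition mpoly_upto_degree :: "nat \<Rightarrow> nat \<Rightarrow> 'k::field mpoly set" where
  "mpoly_upto_degree s i =
     {f \<in> carrier (mpoly_ring s).
        \<forall>m\<in>Poly_Mapping.keys f. (\<Sum>j\<in>Poly_Mapping.keys m. Poly_Mapping.lookup m j) \<le> i}"

definition affine_hilbert_function :: "nat \<Rightarrow> 'k::field mpoly set \<Rightarrow> nat \<Rightarrow> nat" where
  "affine_hilbert_function s I i =
     quotient_dim mpoly_scale (mpoly_upto_degree s i) (I \<inter> mpoly_upto_degree s i)"

definition quotient_degree :: "nat \<Rightarrow> 'k::field mpoly set \<Rightarrow> real" where
  "quotient_degree s I =
     (let k = the_enat (krull_dim (mpoly_ring s Quot I))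
      in fact k * lim (\<lambda>i. real (affine_hilbert_function s I i) / real i ^ k))"

end

theory Submission
  imports Defs
begin

text \<open>
  Let \<open>M\<close> be the saturation of \<open>L\<close>, so that \<open>M/L\<close> is the torsion group \<open>T\<close>, let \<open>r\<close> be the rank of \<open>L\<close>, and
  let \<open>E\<close> be an algebraic closure of \<open>K\<close>. A homomorphism \<open>\<chi>\<close> from \<open>\<int>\<^sup>s\<close> to the units of \<open>E\<close> that is
  trivial on \<open>L\<close> gives a ring homomorphism \<open>t\<^sup>a \<mapsto> \<chi>(a) x\<^bsup>\<pi>(a)\<^esup>\<close> from \<open>S\<close> to the group algebra of
  \<open>\<int>\<^sup>s/M\<close> over \<open>E\<close>, which is a domain; its kernel \<open>Q(\<chi>)\<close> is a prime containing \<open>I(L)\<close>. Replacing \<open>M\<close>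
  by the members of a flag of saturated lattices gives explicit prime chains through \<open>Q(\<chi>)\<close>.

  Dimension is measured by growth: if \<open>P \<subset> Q\<close> are primes and \<open>g \<in> Q - P\<close>, then multiplication by \<open>g\<close>
  embeds \<open>S/P\<close> in \<open>Q/P\<close>, so that the Hilbert function of \<open>S/P\<close> grows by one power faster than that
  of \<open>S/Q\<close>. The Hilbert functions of \<open>S\<close>, \<open>S/I(L)\<close> and \<open>S/Q(\<chi>)\<close> are known, because their bases consist
  of classes of monomials. This bounds the lengths of prime chains, and shows that a prime between
  \<open>I(L)\<close> and \<open>Q(\<chi>)\<close> is \<open>Q(\<chi>)\<close>.

  If \<open>(I(L) : f)\<close> is prime, then some multiple of \<open>f\<close> in the Laurent ring over \<open>E\<close> modulo \<open>L\<close> is a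
  common eigenvector of the monomials with exponents in \<open>M\<close>. Its eigenvalues form a character \<open>\<chi>\<close>,
  and its annihilator is \<open>Q(\<chi>)\<close>. So every associated prime is one of the \<open>Q(\<chi>)\<close>. If \<open>K\<close> is
  algebraically closed, then \<open>\<Sum> \<chi>(\<tau>)\<^sup>-\<^sup>1 t\<^sup>\<tau>\<close>, with \<open>\<tau>\<close> ranging over \<open>T\<close>, is such an eigenvector in every
  characteristic, and all the \<open>Q(\<chi>)\<close> occur. Extending characters by one generator at a time shows
  that \<open>T\<close> has as many of them as its part of order prime to the characteristic has elements.

  For the degree, the monomials that are minimal in their class modulo \<open>L\<close> form a down-closed
  set, hence a finite disjoint union of translated coordinate orthants. This gives the limit in the
  definition of the degree, and the \<open>|T|\<close> torsion classes bound it from below.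
\<close>

section \<open>Pushing polynomials forward along maps of exponents\<close>

text \<open>The group Z^s/L has no type of its own. The quotient by M is modelled by rational
  coordinate vectors, whose type carries a linear order compatible with addition. The group algebra
  of Z^s/L is modelled by finitely supported functions on cosets, with multiplication performed in
  the Laurent ring before passing to cosets. All these maps are instances of the operation
  \<open>push\<close>, and a coarser quotient is compared with a finer one through
  \<open>push_coarsen\<close>.

  Characters take values in E because the eigenvalues of monomials need not lie in K. The Q(\<chi>)
  are kernels inside S, so distinct characters may give the same prime; this is why the count of
  associated primes is only an inequality over a general K. In characteristic p, roots of unity of
  p-power order are trivial, so characters see only the part of T of order prime to p, while the
  Hilbert function sees all of T; the degree bound is accordingly proved with |T| and weakened to
  |G|.\<close>

abbreviation (input) "lookup \<equiv> Poly_Mapping.lookup"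
abbreviation (input) "keys \<equiv> Poly_Mapping.keys"
abbreviation (input) "single \<equiv> Poly_Mapping.single"

lemma sum_keys_single: "(\<Sum>m\<in>keys f. single m (lookup f m)) = f"
proof (rule poly_mapping_eqI)
  fix k
  show "lookup (\<Sum>m\<in>keys f. single m (lookup f m)) k = lookup f k"
    by (auto simp: lookup_sum lookup_single when_def in_keys_iff)
qed

lemma single_times_expand:
  fixes g :: "'a::comm_monoid_add \<Rightarrow>\<^sub>0 'k::comm_semiring_1"
  shows "single m a * g = (\<Sum>n\<in>keys g. single (m + n) (a * lookup g n))"
proof -
  have "single m a * g = single m a * (\<Sum>n\<in>keys g. single n (lookup g n))"
    by (simp only: sum_keys_single)
  then show ?thesis by (simp add: sum_distrib_left mult_single)
qed

text \<open>Used for three coefficient maps: the identity, the embedding of K into its closure, and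
  the inclusion of constants into a group algebra.\<close>

locale coeff_hom =
  fixes h :: "'k::comm_ring_1 \<Rightarrow> 'e::comm_ring_1"
  assumes hom_add: "h (x + y) = h x + h y"
    and hom_mult: "h (x * y) = h x * h y"
    and hom_one: "h 1 = 1"
begin

lemma hom_zero: "h 0 = 0"
  using hom_add[of 0 0] by simp

end

text \<open>For additive \<open>\<pi>\<close> and multiplicative \<open>\<chi>\<close> this is the
  ring homomorphism of the overview. Arbitrary maps are allowed so that \<open>\<pi>\<close> can
  also be a choice of representatives or a map to cosets, where the index type has no
  addition.\<close>

definition push :: "('k::comm_ring_1 \<Rightarrow> 'e::comm_ring_1) \<Rightarrow> ('a \<Rightarrow> 'b) \<Rightarrow> ('a \<Rightarrow> 'e) \<Rightarrow> ('a \<Rightarrow>\<^sub>0 'k) \<Rightarrow> ('b \<Rightarrow>\<^sub>0 'e)" where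
  "push h \<pi> \<chi> f = (\<Sum>m\<in>keys f. single (\<pi> m) (h (lookup f m) * \<chi> m))"

context coeff_hom
begin

lemma push_superset:
  assumes "finite A" "keys f \<subseteq> A"
  shows "push h \<pi> \<chi> f = (\<Sum>m\<in>A. single (\<pi> m) (h (lookup f m) * \<chi> m))"
  unfolding push_def using assms
  by (intro sum.mono_neutral_left) (auto simp: in_keys_iff hom_zero)

lemma push_zero [simp]: "push h \<pi> \<chi> 0 = 0"
  by (simp add: push_def)

lemma push_single [simp]: "push h \<pi> \<chi> (single m a) = single (\<pi> m) (h a * \<chi> m)"
  by (subst push_superset[of "{m}"]) auto

lemma push_add: "push h \<pi> \<chi> (f + g) = push h \<pi> \<chi> f + push h \<pi> \<chi> g"
proof -
  let ?A = "keys f \<union> keys g"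
  have "push h \<pi> \<chi> (f + g) = (\<Sum>m\<in>?A. single (\<pi> m) (h (lookup (f + g) m) * \<chi> m))"
    by (rule push_superset) (auto dest: subsetD[OF Poly_Mapping.keys_add])
  also have "\<dots> = push h \<pi> \<chi> f + push h \<pi> \<chi> g"
    by (simp add: push_superset[of ?A f] push_superset[of ?A g] lookup_add hom_add distrib_right
        single_add sum.distrib)
  finally show ?thesis .
qed

lemma push_sum: "push h \<pi> \<chi> (\<Sum>i\<in>A. f i) = (\<Sum>i\<in>A. push h \<pi> \<chi> (f i))"
  by (induction A rule: infinite_finite_induct) (auto simp: push_add)

lemma push_uminus: "push h \<pi> \<chi> (- f) = - push h \<pi> \<chi> f"
  using push_add[of \<pi> \<chi> f "- f"] by (simp add: eq_neg_iff_add_eq_0 add.commute)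

lemma push_diff: "push h \<pi> \<chi> (f - g) = push h \<pi> \<chi> f - push h \<pi> \<chi> g"
  using push_add[of \<pi> \<chi> "f - g" g] by (simp add: algebra_simps)

lemma push_mult:
  fixes \<pi> :: "'a::comm_monoid_add \<Rightarrow> 'b::comm_monoid_add"
  assumes "\<And>x y. \<pi> (x + y) = \<pi> x + \<pi> y" "\<And>x y. \<chi> (x + y) = \<chi> x * \<chi> y"
  shows "push h \<pi> \<chi> (f * g) = push h \<pi> \<chi> f * push h \<pi> \<chi> g"
proof -
  have single: "push h \<pi> \<chi> (single m a * g) = single (\<pi> m) (h a * \<chi> m) * push h \<pi> \<chi> g" for m a
  proof -
    have "push h \<pi> \<chi> (single m a * g) =
      push h \<pi> \<chi> (\<Sum>n\<in>keys g. single (m + n) (a * lookup g n))"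
      by (simp only: single_times_expand)
    also have "\<dots> = single (\<pi> m) (h a * \<chi> m) * push h \<pi> \<chi> g"
      by (simp add: push_sum) (simp add: push_def sum_distrib_left mult_single assms hom_mult ac_simps)
    finally show ?thesis .
  qed
  have "push h \<pi> \<chi> (f * g) =
      push h \<pi> \<chi> (\<Sum>n\<in>keys f. single n (lookup f n) * g)"
    by (simp only: sum_keys_single flip: sum_distrib_right)
  also have "\<dots> = push h \<pi> \<chi> f * push h \<pi> \<chi> g"
    by (simp add: push_sum single) (simp add: push_def sum_distrib_right)
  finally show ?thesis .
qed

lemma lookup_push:
  "lookup (push h \<pi> \<chi> f) v =
     (\<Sum>m\<in>{m\<in>keys f. \<pi> m = v}. h (lookup f m) * \<chi> m)"
proof -
  have "lookup (push h \<pi> \<chi> f) v =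
     (\<Sum>m\<in>keys f. if \<pi> m = v then h (lookup f m) * \<chi> m else 0)"
    by (simp add: push_def lookup_sum lookup_single when_def)
  also have "\<dots> = (\<Sum>m\<in>{m\<in>keys f. \<pi> m = v}. h (lookup f m) * \<chi> m)"
    by (rule sum.inter_filter[symmetric]) simp
  finally show ?thesis .
qed

end

text \<open>Vanishing under \<open>push\<close> means that weighted sums over the fibres of \<open>\<pi>\<close> vanish, so it is inherited
  by coarser fibres on which the weights are proportional.\<close>

lemma push_coarsen:
  fixes h :: "'k::comm_ring_1 \<Rightarrow> 'e::field"
  assumes "coeff_hom h"
    and ker: "push h \<pi> \<chi> f = 0"
    and nz: "\<And>x. \<chi> x \<noteq> 0"
    and fib: "\<And>x y. x \<in> keys f \<Longrightarrow> y \<in> keys f \<Longrightarrow> \<pi> x = \<pi> y \<Longrightarrow> \<sigma> x = \<sigma> y \<and> \<theta> x * \<chi> y = \<theta> y * \<chi> x"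
  shows "push h \<sigma> \<theta> f = 0"
proof (rule poly_mapping_eqI)
  interpret coeff_hom h by fact
  fix w
  let ?A = "{m\<in>keys f. \<sigma> m = w}"
  have "lookup (push h \<sigma> \<theta> f) w = (\<Sum>m\<in>?A. h (lookup f m) * \<theta> m)"
    by (rule lookup_push)
  also have "\<dots> = (\<Sum>v\<in>\<pi> ` ?A. \<Sum>m\<in>{m\<in>?A. \<pi> m = v}. h (lookup f m) * \<theta> m)"
    by (rule sum.image_gen) simp
  also have "\<dots> = 0"
  proof (rule sum.neutral, rule ballI)
    fix v assume "v \<in> \<pi> ` ?A"
    then obtain n where n: "n \<in> keys f" "\<sigma> n = w" "v = \<pi> n" by auto
    have eq: "{m\<in>?A. \<pi> m = v} = {m\<in>keys f. \<pi> m = v}"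
      using fib n by blast
    \<comment> \<open>On one fibre of \<open>\<pi>\<close> the two weights differ by the constant
      \<open>\<theta> n / \<chi> n\<close>, so this block is a multiple of a coefficient that
      vanishes.\<close>
    have "(\<Sum>m\<in>{m\<in>?A. \<pi> m = v}. h (lookup f m) * \<theta> m) =
       (\<Sum>m\<in>{m\<in>keys f. \<pi> m = v}. (\<theta> n / \<chi> n) * (h (lookup f m) * \<chi> m))"
    proof (unfold eq, rule sum.cong[OF refl])
      fix m assume "m \<in> {m\<in>keys f. \<pi> m = v}"
      then have "\<theta> m * \<chi> n = \<theta> n * \<chi> m"
        using fib n by blast
      then have "\<theta> m = \<theta> n / \<chi> n * \<chi> m"
        using nz[of n] by (simp add: field_simps)
      then show "h (lookup f m) * \<theta> m = (\<theta> n / \<chi> n) * (h (lookup f m) * \<chi> m)"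
        by simp
    qed
    also have "\<dots> = (\<theta> n / \<chi> n) * lookup (push h \<pi> \<chi> f) v"
      by (simp only: lookup_push sum_distrib_left)
    finally show "(\<Sum>m\<in>{m\<in>?A. \<pi> m = v}. h (lookup f m) * \<theta> m) = 0"
      by (simp add: ker)
  qed
  finally show "lookup (push h \<sigma> \<theta> f) w = lookup 0 w" by simp
qed

text \<open>Multiplication by a term is absorbed into the maps, which also makes sense when
  \<open>\<pi>\<close> has values in a type without addition, as for cosets.\<close>

lemma (in coeff_hom) push_single_mult:
  fixes \<pi> :: "'a::comm_monoid_add \<Rightarrow> 'b"
  shows "push h \<pi> \<chi> (single a c * f) = push h (\<lambda>x. \<pi> (a + x)) (\<lambda>x. h c * \<chi> (a + x)) f"
proof -
  have "push h \<pi> \<chi> (single a c * f) =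
      push h \<pi> \<chi> (\<Sum>n\<in>keys f. single (a + n) (c * lookup f n))"
    by (simp only: single_times_expand)
  also have "\<dots> = push h (\<lambda>x. \<pi> (a + x)) (\<lambda>x. h c * \<chi> (a + x)) f"
    by (simp add: push_sum) (simp add: push_def hom_mult ac_simps)
  finally show ?thesis .
qed

lemma push_push:
  assumes "coeff_hom h" "coeff_hom h'"
  shows "push h' \<pi>' \<chi>' (push h \<pi> \<chi> f) = push (h' \<circ> h) (\<pi>' \<circ> \<pi>) (\<lambda>x. h' (\<chi> x) * \<chi>' (\<pi> x)) f"
proof -
  interpret A: coeff_hom h by fact
  interpret B: coeff_hom h' by fact
  show ?thesis
    by (simp add: push_def[of h \<pi>] B.push_sum) (simp add: push_def B.hom_mult ac_simps)
qed

lemma coeff_hom_id: "coeff_hom (\<lambda>x. x)"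
  by unfold_locales auto

lemma coeff_hom_to_ac: "coeff_hom to_ac"
  by unfold_locales auto

section \<open>Rational coordinates adapted to a lattice\<close>

lemma vector_space_single_zero_mult:
  "vector_space (\<lambda>(c::'k::field) (f::'a::comm_monoid_add \<Rightarrow>\<^sub>0 'k). single 0 c * f)"
  by unfold_locales (simp_all add: distrib_left distrib_right single_add mult_single flip: mult.assoc)

lemma lookup_single_zero_mult:
  "lookup (single 0 c * f) i = c * lookup (f :: 'a::comm_monoid_add \<Rightarrow>\<^sub>0 'k::comm_semiring_1) i"
  by (simp add: map.rep_eq when_def flip: mult_map_scale_conv_mult)

lemma common_denominator:
  assumes "finite A"
  shows "\<exists>N::nat. N > 0 \<and> (\<forall>q\<in>A. (of_nat N :: rat) * q \<in> \<int>)"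
  using assms
proof (induction A)
  case empty
  show ?case by (intro exI[of _ 1]) auto
next
  case (insert q A)
  then obtain N where N: "N > 0" "\<forall>q\<in>A. (of_nat N :: rat) * q \<in> \<int>" by blast
  obtain a b where ab: "quotient_of q = (a, b)" by force
  have b: "b > 0" and q: "q = of_int a / of_int b"
    using quotient_of_denom_pos[OF ab] quotient_of_div[OF ab] by auto
  have bq: "of_nat (nat b) * q \<in> \<int>" using b q by simp
  show ?case
  proof (intro exI[of _ "nat b * N"] conjI ballI)
    show "0 < nat b * N" using b N by simp
    fix x assume "x \<in> insert q A"
    then consider "x = q" | "x \<in> A" by blast
    then show "of_nat (nat b * N) * x \<in> \<int>"
    proof cases
      case 1
      have "of_nat (nat b * N) * x = of_nat N * (of_nat (nat b) * q)" by (simp add: 1)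
      then show ?thesis using bq by (metis Ints_mult Ints_of_nat)
    next
      case 2
      have "of_nat (nat b * N) * x = of_nat (nat b) * (of_nat N * x)" by simp
      then show ?thesis using N(2) 2 by (metis Ints_mult Ints_of_nat)
    qed
  qed
qed

text \<open>Over the rationals the bases and coordinates of vector spaces are available; integrality
  is recovered later by clearing denominators.\<close>

definition ratvec :: "nat \<Rightarrow> (nat \<Rightarrow>\<^sub>0 int) \<Rightarrow> (nat \<Rightarrow>\<^sub>0 rat)" where
  "ratvec s x = (\<Sum>j<s. single j (of_int (lookup x j)))"

lemma lookup_ratvec: "lookup (ratvec s x) i = (if i < s then of_int (lookup x i) else 0)"
  by (simp add: ratvec_def lookup_sum lookup_single when_def)

lemma ratvec_add: "ratvec s (x + y) = ratvec s x + ratvec s y"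
  by (rule poly_mapping_eqI) (simp add: lookup_ratvec lookup_add)

lemma ratvec_zero [simp]: "ratvec s 0 = 0"
  by (rule poly_mapping_eqI) (simp add: lookup_ratvec)

lemma ratvec_sum: "ratvec s (sum f A) = (\<Sum>x\<in>A. ratvec s (f x))"
  by (induction A rule: infinite_finite_induct) (auto simp: ratvec_add)

lemma ratvec_cmul: "ratvec s (frag_cmul n x) = single 0 (of_int n) * ratvec s x"
  by (rule poly_mapping_eqI) (simp add: lookup_ratvec lookup_single_zero_mult del: single_of_int)

lemma ratvec_inject:
  assumes "keys x \<subseteq> {..<s}" "keys y \<subseteq> {..<s}" "ratvec s x = ratvec s y"
  shows "x = y"
proof (rule poly_mapping_eqI)
  fix i
  show "lookup x i = lookup y i"
    using arg_cong[OF assms(3), of "\<lambda>v. lookup v i"] assms(1,2)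
    by (cases "i < s") (auto simp: lookup_ratvec in_keys_iff subset_iff, metis)
qed

text \<open>A basis \<open>b\<close> of \<open>\<rat>\<^sup>s\<close> that begins with a maximal independent subset of \<open>L\<close> and is completed by unit
  vectors; \<open>c l\<close> is the \<open>l\<close>-th coordinate, and \<open>N\<close> a common denominator of all coordinates of \<open>\<int>\<^sup>s\<close>.\<close>

locale adapted_basis =
  fixes s :: nat and L :: "(nat \<Rightarrow>\<^sub>0 int) set" and r :: nat and b :: "nat \<Rightarrow> (nat \<Rightarrow>\<^sub>0 int)"
    and c :: "nat \<Rightarrow> (nat \<Rightarrow>\<^sub>0 int) \<Rightarrow> rat" and N :: nat
  assumes subgroup_L: "subgroup L (free_Abelian_group {..<s})"
    and r_le: "r \<le> s"
    and rank: "lattice_rank L = enat r"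
    and b_carrier: "l < s \<Longrightarrow> keys (b l) \<subseteq> {..<s}"
    and b_L: "l < r \<Longrightarrow> b l \<in> L"
    and b_unit: "r \<le> l \<Longrightarrow> l < s \<Longrightarrow> \<exists>j<s. b l = single j 1"
    and c_add: "c l (x + y) = c l x + c l y"
    and c_b: "l < s \<Longrightarrow> l' < s \<Longrightarrow> c l (b l') = (if l = l' then 1 else 0)"
    and c_L: "x \<in> L \<Longrightarrow> r \<le> l \<Longrightarrow> l < s \<Longrightarrow> c l x = 0"
    and N_pos: "N > 0"
    and c_denom: "keys x \<subseteq> {..<s} \<Longrightarrow>
          \<exists>z. (\<forall>l<s. of_nat N * c l x = of_int (z l)) \<and> frag_cmul (int N) x = (\<Sum>l<s. frag_cmul (z l) (b l))"

text \<open>Clearing denominators turns rational relations among the images of lattice vectors into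
  integral ones, so a maximal rationally independent subset of the image of \<open>L\<close> has as
  many members as the rank.\<close>

lemma ex_adapted_basis:
  assumes L: "subgroup L (free_Abelian_group {..<s})"
  shows "\<exists>r b c N. adapted_basis s L r b c N"
proof -
  define scale where "scale = (\<lambda>(c::rat) (f::nat \<Rightarrow>\<^sub>0 rat). single 0 c * f)"
  interpret V: vector_space scale
    unfolding scale_def by (rule vector_space_single_zero_mult)
  interpret Z: Modules.module "frag_cmul :: int \<Rightarrow> (nat \<Rightarrow>\<^sub>0 int) \<Rightarrow> nat \<Rightarrow>\<^sub>0 int"
    by (rule module_frag_cmul)
  have L_sub: "keys x \<subseteq> {..<s}" if "x \<in> L" for x
    using subgroup.subset[OF L] that by (auto simp: free_Abelian_group_def)
  define E where "E = (\<lambda>j. single j (1::rat)) ` {..<s}"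
  have finE: "finite E" by (simp add: E_def)
  have injE: "inj_on (\<lambda>j. single j (1::rat)) {..<s}"
    by (auto simp: inj_on_def) (metis lookup_single_eq lookup_single_not_eq zero_neq_one)
  have cardE: "card E = s"
    unfolding E_def using card_image[OF injE] by simp
  have in_spanE: "v \<in> V.span E" if "keys v \<subseteq> {..<s}" for v
  proof -
    have "v = (\<Sum>j<s. scale (lookup v j) (single j 1))"
      using that
      by (intro poly_mapping_eqI)
         (auto simp: lookup_sum scale_def lookup_single_zero_mult lookup_single when_def in_keys_iff subset_iff
            if_distrib cong: if_cong)
    also have "\<dots> \<in> V.span E"
      by (intro V.span_sum V.span_scale V.span_base) (auto simp: E_def)
    finally show ?thesis .
  qed
  have keys_ratvec: "keys (ratvec s x) \<subseteq> {..<s}" for x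
    by (auto simp: in_keys_iff lookup_ratvec split: if_splits)
  have indE: "V.independent E"
  proof (rule V.independent_if_scalars_zero)
    fix f v assume sum: "(\<Sum>v\<in>E. scale (f v) v) = 0" and v: "v \<in> E"
    then obtain j where j: "j < s" "v = single j 1" by (auto simp: E_def)
    have "(\<Sum>v\<in>E. scale (f v) v) = (\<Sum>j<s. scale (f (single j 1)) (single j 1))"
      unfolding E_def by (rule sum.reindex_cong[OF injE]) auto
    then have "lookup (\<Sum>j<s. scale (f (single j 1)) (single j 1)) j = 0"
      using sum by simp
    then show "f v = 0"
      using j by (simp add: lookup_sum scale_def lookup_single_zero_mult lookup_single when_def if_distrib cong: if_cong)
  qed (rule finE)
  obtain B where B: "B \<subseteq> ratvec s ` L" "V.independent B" "ratvec s ` L \<subseteq> V.span B"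
    by (rule V.maximal_independent_subset)
  \<comment> \<open>The extension to a basis takes place inside \<open>B \<union> E\<close>, so that
    every vector added to \<open>B\<close> is a unit vector.\<close>
  have "B \<subseteq> B \<union> E" by simp
  then obtain B' where B': "B \<subseteq> B'" "B' \<subseteq> B \<union> E" "V.independent B'" "B \<union> E \<subseteq> V.span B'"
    using V.maximal_independent_subset_extend[OF _ B(2)] by metis
  have "V.span E \<subseteq> V.span B'"
    using B'(4) by (intro V.span_minimal) auto
  then have spanB': "v \<in> V.span B'" if "keys v \<subseteq> {..<s}" for v
    using in_spanE[OF that] by blast
  have B'E: "B' \<subseteq> V.span E"
  proof
    fix v assume "v \<in> B'"
    then consider "v \<in> B" | "v \<in> E" using B'(2) by blast
    then show "v \<in> V.span E"
    proof cases
      case 1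
      then obtain x where "v = ratvec s x" using B(1) by blast
      then show ?thesis using in_spanE[OF keys_ratvec] by simp
    qed (rule V.span_base)
  qed
  have finB': "finite B'" and "card B' \<le> s"
    using V.independent_span_bound[OF finE B'(3) B'E] cardE by auto
  moreover have "s \<le> card B'"
    using V.independent_span_bound[OF finB' indE] B'(4) cardE by auto
  ultimately have cardB': "card B' = s" by simp
  have finB: "finite B" using B'(1) finB' finite_subset by blast
  define r where "r = card B"
  have r_le: "r \<le> s" unfolding r_def cardB'[symmetric] by (rule card_mono[OF finB' B'(1)])
  obtain f where f: "bij_betw f {0..<r} B" using ex_bij_betw_nat_finite[OF finB] by (auto simp: r_def)
  have "card (B' - B) = s - r" using card_Diff_subset[OF finB B'(1)] by (simp add: cardB' r_def)
  then obtain g where g: "bij_betw g {0..<s - r} (B' - B)"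
    using ex_bij_betw_nat_finite[of "B' - B"] finB' by auto
  define bv where "bv l = (if l < r then f l else g (l - r))" for l
  have bvB: "bv l \<in> B" if "l < r" for l using f that by (auto simp: bv_def bij_betw_def)
  have bvE: "bv l \<in> B' - B" if "r \<le> l" "l < s" for l
    using g that unfolding bij_betw_def bv_def by auto
  have bv_inj: "inj_on bv {..<s}"
  proof (rule inj_onI)
    fix l l' assume l: "l \<in> {..<s}" "l' \<in> {..<s}" "bv l = bv l'"
    have "(l < r) = (l' < r)" using bvB bvE l by (metis DiffD2 lessThan_iff not_less)
    then show "l = l'"
    proof (cases "l < r")
      case True
      then show ?thesis using f l \<open>(l < r) = (l' < r)\<close> by (auto simp: bij_betw_def bv_def inj_on_def)
    next
      case False
      then have "g (l - r) = g (l' - r)" "l - r \<in> {0..<s-r}" "l' - r \<in> {0..<s-r}" using l \<open>(l < r) = (l' < r)\<close> by (auto simp: bv_def)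
      then have "l - r = l' - r" using g by (auto simp: bij_betw_def inj_on_def)
      then show ?thesis using False \<open>(l < r) = (l' < r)\<close> by simp
    qed
  qed
  have bv_sub: "bv ` {..<s} \<subseteq> B'"
    using bvB bvE B'(1) by (metis DiffD1 image_subsetI lessThan_iff not_less subsetD)
  have bv_img: "bv ` {..<s} = B'"
    using card_subset_eq[OF finB' bv_sub] card_image[OF bv_inj] cardB' by simp
  have "\<exists>x. keys x \<subseteq> {..<s} \<and> ratvec s x = bv l \<and> (l < r \<longrightarrow> x \<in> L) \<and> (r \<le> l \<longrightarrow> (\<exists>j<s. x = single j 1))" if "l < s" for l
  proof (cases "l < r")
    case True
    then obtain x where "x \<in> L" "ratvec s x = bv l" using bvB B(1) by (metis imageE subsetD)
    then show ?thesis using True L_sub by auto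
  next
    case False
    then have "bv l \<in> E" using bvE[of l] that B'(2) by auto
    then obtain j where "j < s" "bv l = single j 1" by (auto simp: E_def)
    moreover have "ratvec s (single j 1) = single j 1" if "j < s" for j
      using that by (intro poly_mapping_eqI) (auto simp: lookup_ratvec lookup_single when_def)
    ultimately show ?thesis using False by (intro exI[of _ "single j 1"]) auto
  qed
  then obtain b where b: "\<And>l. l < s \<Longrightarrow> keys (b l) \<subseteq> {..<s}" "\<And>l. l < s \<Longrightarrow> ratvec s (b l) = bv l"
     "\<And>l. l < s \<Longrightarrow> l < r \<Longrightarrow> b l \<in> L" "\<And>l. l < s \<Longrightarrow> r \<le> l \<Longrightarrow> \<exists>j<s. b l = single j 1"
    by metis
  define c where "c l x = V.representation B' (ratvec s x) (bv l)" for l x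
  have c_add: "c l (x + y) = c l x + c l y" for l x y
    unfolding c_def ratvec_add
    by (subst V.representation_add[OF B'(3) spanB'[OF keys_ratvec] spanB'[OF keys_ratvec]]) simp
  have expand: "ratvec s x = (\<Sum>l<s. scale (c l x) (bv l))" for x
  proof -
    have "ratvec s x = (\<Sum>w\<in>B'. scale (V.representation B' (ratvec s x) w) w)"
      using V.sum_representation_eq[OF B'(3) spanB'[OF keys_ratvec] finB', of x] by simp
    also have "\<dots> = (\<Sum>l<s. scale (c l x) (bv l))"
      unfolding c_def bv_img[symmetric] by (rule sum.reindex_cong[OF bv_inj]) auto
    finally show ?thesis .
  qed
  have c_b: "c l (b l') = (if l = l' then 1 else 0)" if "l < s" "l' < s" for l l'
  proof -
    have "bv l' \<in> B'" "bv l = bv l' \<longleftrightarrow> l = l'" using that bv_img bv_inj by (auto simp: inj_on_def)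
    then show ?thesis
      using V.representation_basis[OF B'(3), of "bv l'"] that by (auto simp: c_def b(2))
  qed
  have c_L: "c l x = 0" if "x \<in> L" "r \<le> l" "l < s" for l x
  proof -
    have "V.representation B' (ratvec s x) = V.representation B (ratvec s x)"
      using V.representation_extend[OF B'(3) _ B'(1)] B(3) that(1) by blast
    moreover have "bv l \<notin> B" using bvE that by auto
    ultimately show ?thesis using V.representation_ne_zero[of B "ratvec s x" "bv l"] by (auto simp: c_def)
  qed
  have c_lin: "c l x = (\<Sum>j<s. of_int (lookup x j) * c l (single j 1))" for l x
  proof -
    have "ratvec s x = (\<Sum>j<s. scale (of_int (lookup x j)) (ratvec s (single j 1)))"
      by (rule poly_mapping_eqI)
        (simp add: lookup_sum scale_def lookup_single_zero_mult lookup_ratvec lookup_single when_def if_distrib if_distribR del: single_of_int cong: if_cong)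
    then have "V.representation B' (ratvec s x) = (\<lambda>w. \<Sum>j<s. V.representation B' (scale (of_int (lookup x j)) (ratvec s (single j 1))) w)"
      using V.representation_sum[OF B'(3), of "{..<s}" "\<lambda>j. scale (of_int (lookup x j)) (ratvec s (single j 1))"]
        V.span_scale[OF spanB'[OF keys_ratvec]] by simp
    then show ?thesis
      using V.representation_scale[OF B'(3) spanB'[OF keys_ratvec]] by (simp add: c_def)
  qed
  \<comment> \<open>Coordinates are linear in the entries of \<open>x\<close>, so a common
    denominator for the finitely many coordinates of unit vectors serves all integer
    vectors.\<close>
  obtain N where N: "N > 0" "\<And>l j. l < s \<Longrightarrow> j < s \<Longrightarrow> of_nat N * c l (single j 1) \<in> \<int>"
    using common_denominator[of "(\<lambda>(l, j). c l (single j 1)) ` ({..<s} \<times> {..<s})"] by auto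
  have c_denom: "\<exists>z. (\<forall>l<s. of_nat N * c l x = of_int (z l)) \<and> frag_cmul (int N) x = (\<Sum>l<s. frag_cmul (z l) (b l))"
    if x: "keys x \<subseteq> {..<s}" for x
  proof -
    have "of_nat N * c l x \<in> \<int>" if "l < s" for l
    proof -
      have "of_nat N * c l x = (\<Sum>j<s. of_int (lookup x j) * (of_nat N * c l (single j 1)))"
        by (subst c_lin) (simp add: sum_distrib_left ac_simps)
      also have "\<dots> \<in> \<int>" using N(2) that by (intro Ints_sum Ints_mult[OF Ints_of_int]) auto
      finally show ?thesis .
    qed
    then have "\<forall>l. \<exists>z. l < s \<longrightarrow> of_nat N * c l x = of_int z" by (metis Ints_cases)
    then obtain z where z: "\<forall>l<s. of_nat N * c l x = of_int (z l)" by metis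
    have "frag_cmul (int N) x = (\<Sum>l<s. frag_cmul (z l) (b l))"
    proof (rule ratvec_inject[of _ s])
      show "keys (frag_cmul (int N) x) \<subseteq> {..<s}" using x keys_cmul by blast
      show "keys (\<Sum>l<s. frag_cmul (z l) (b l)) \<subseteq> {..<s}"
        using b(1) keys_cmul by (intro order.trans[OF keys_sum]) fastforce
      have "ratvec s (frag_cmul (int N) x) = scale (of_nat N) (\<Sum>l<s. scale (c l x) (bv l))"
        by (simp add: ratvec_cmul expand scale_def del: single_of_int single_of_nat)
      also have "\<dots> = (\<Sum>l<s. scale (of_int (z l)) (ratvec s (b l)))"
        using z by (simp add: V.scale_sum_right b(2))
      also have "\<dots> = ratvec s (\<Sum>l<s. frag_cmul (z l) (b l))"
        by (simp add: ratvec_sum ratvec_cmul scale_def del: single_of_int)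
      finally show "ratvec s (frag_cmul (int N) x) = ratvec s (\<Sum>l<s. frag_cmul (z l) (b l))" .
    qed
    then show ?thesis using z by blast
  qed
  have b_eq: "b l = b l' \<longleftrightarrow> l = l'" if "l < s" "l' < s" for l l'
    using c_b[of l l] c_b[OF that] that by (auto split: if_splits)
  have ge: "finite (b ` {..<r}) \<and> b ` {..<r} \<subseteq> L \<and> \<not> module.dependent frag_cmul (b ` {..<r}) \<and> card (b ` {..<r}) = r"
  proof (intro conjI)
    show "card (b ` {..<r}) = r" using b_eq r_le by (subst card_image) (auto simp: inj_on_def)
    show "b ` {..<r} \<subseteq> L" using b(3) r_le by auto
    show "\<not> module.dependent frag_cmul (b ` {..<r})"
    proof
      assume "module.dependent frag_cmul (b ` {..<r})"
      then obtain S u where Su: "finite S" "S \<subseteq> b ` {..<r}" "(\<Sum>v\<in>S. frag_cmul (u v) v) = 0" "\<exists>v\<in>S. u v \<noteq> 0"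
        unfolding Z.dependent_explicit by blast
      then obtain v where v: "v \<in> S" "u v \<noteq> 0" by blast
      then obtain l where l: "l < r" "v = b l" using Su by auto
      have S: "\<exists>l<s. x = b l" if "x \<in> S" for x using Su(2) that r_le by force
      have bvS: "ratvec s ` S \<subseteq> B'" using S b(2) bv_img by blast
      have injS: "inj_on (ratvec s) S"
        using S b(1) by (intro inj_onI ratvec_inject[of _ s]) blast+
      have "0 = ratvec s (\<Sum>v\<in>S. frag_cmul (u v) v)" by (simp add: Su)
      also have "\<dots> = (\<Sum>w\<in>ratvec s ` S. scale (of_int (u (the_inv_into S (ratvec s) w))) w)"
        by (subst sum.reindex[OF injS]) (simp add: ratvec_sum ratvec_cmul scale_def the_inv_into_f_f[OF injS] del: single_of_int)
      finally have "of_int (u (the_inv_into S (ratvec s) (ratvec s v))) = (0::rat)"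
        using V.independentD[OF B'(3), of "ratvec s ` S" "\<lambda>w. of_int (u (the_inv_into S (ratvec s) w))"] Su(1) bvS v(1)
        by auto
      then show False using v by (simp add: the_inv_into_f_f[OF injS])
    qed
  qed simp
  have le: "card D \<le> r" if D: "finite D" "D \<subseteq> L" "\<not> module.dependent frag_cmul D" for D
  proof -
    have injD: "inj_on (ratvec s) D"
      using D(2) L_sub by (intro inj_onI ratvec_inject[of _ s]) blast+
    have "V.independent (ratvec s ` D)"
    proof (rule V.independent_if_scalars_zero)
      show "finite (ratvec s ` D)" using D by simp
      fix q w assume q: "(\<Sum>w\<in>ratvec s ` D. scale (q w) w) = 0" and w: "w \<in> ratvec s ` D"
      \<comment> \<open>A rational relation among the images of \<open>D\<close> becomes an integral
        one after multiplication by a common denominator of its coefficients.\<close>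
      obtain n where n: "n > 0" "\<And>w. w \<in> ratvec s ` D \<Longrightarrow> of_nat n * q w \<in> \<int>"
        using common_denominator[of "q ` ratvec s ` D"] D by auto
      then have "\<forall>w. \<exists>z. w \<in> ratvec s ` D \<longrightarrow> of_nat n * q w = of_int z" by (metis Ints_cases)
      then obtain z where z: "\<And>w. w \<in> ratvec s ` D \<Longrightarrow> of_nat n * q w = of_int (z w)" by metis
      have "(\<Sum>x\<in>D. frag_cmul (z (ratvec s x)) x) = 0"
      proof (rule ratvec_inject[of _ s])
        show "keys (\<Sum>x\<in>D. frag_cmul (z (ratvec s x)) x) \<subseteq> {..<s}"
          using D(2) L_sub keys_cmul by (intro order.trans[OF keys_sum]) fastforce
        have "ratvec s (\<Sum>x\<in>D. frag_cmul (z (ratvec s x)) x) = (\<Sum>w\<in>ratvec s ` D. scale (of_int (z w)) w)"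
          by (subst sum.reindex[OF injD]) (simp add: ratvec_sum ratvec_cmul scale_def del: single_of_int)
        also have "\<dots> = scale (of_nat n) (\<Sum>w\<in>ratvec s ` D. scale (q w) w)"
          unfolding V.scale_sum_right by (rule sum.cong) (simp_all add: z)
        finally show "ratvec s (\<Sum>x\<in>D. frag_cmul (z (ratvec s x)) x) = ratvec s 0" by (simp add: q)
      qed simp
      then have "z w = 0"
        using Z.independentD[OF D(3) D(1) subset_refl, of "\<lambda>x. z (ratvec s x)"] w by auto
      then show "q w = 0" using z[OF w] n by simp
    qed
    then have "card (ratvec s ` D) \<le> r"
      using V.independent_span_bound[OF finB, of "ratvec s ` D"] D(2) B(3) by (auto simp: r_def)
    then show ?thesis using card_image[OF injD] by simp
  qed
  have rank: "lattice_rank L = enat r"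
    unfolding lattice_rank_def
  proof (rule antisym)
    show "Sup {enat (card B) |B. finite B \<and> B \<subseteq> L \<and> \<not> module.dependent frag_cmul B} \<le> enat r"
      using le by (intro Sup_least) auto
    show "enat r \<le> Sup {enat (card B) |B. finite B \<and> B \<subseteq> L \<and> \<not> module.dependent frag_cmul B}"
      using ge by (intro Sup_upper) (auto intro!: exI[of _ "b ` {..<r}"])
  qed
  have "adapted_basis s L r b c N"
    using L r_le rank b(1) b(3) b(4) c_add c_b c_L N(1) c_denom by (intro adapted_basis.intro) auto
  then show ?thesis by blast
qed

section \<open>Lattice ideals and the primes attached to characters\<close>

abbreviation mon :: "'a::zero \<Rightarrow> ('a \<Rightarrow>\<^sub>0 'k::zero_neq_one)" where
  "mon m \<equiv> single m 1"

definition emb :: "('a \<Rightarrow>\<^sub>0 nat) \<Rightarrow> ('a \<Rightarrow>\<^sub>0 int)" where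
  "emb m = Poly_Mapping.map int m"

lemma lookup_emb [simp]: "lookup (emb m) i = int (lookup m i)"
  by (simp add: emb_def map.rep_eq when_def)

lemma keys_emb [simp]: "keys (emb m) = keys m"
  by (auto simp: in_keys_iff)

lemma emb_add [simp]: "emb (m + n) = emb m + emb n"
  by (rule poly_mapping_eqI) (simp add: lookup_add)

lemma emb_zero [simp]: "emb 0 = 0"
  by (rule poly_mapping_eqI) simp

lemma emb_pos_neg: "emb (pos_part a) - emb (neg_part a) = a"
  by (rule poly_mapping_eqI) (simp add: lookup_minus lookup_pos_part lookup_neg_part)

lemma keys_pos_part: "keys (pos_part a) \<subseteq> keys a"
  by (auto simp: in_keys_iff lookup_pos_part)

lemma keys_neg_part: "keys (neg_part a) \<subseteq> keys a"
  by (auto simp: in_keys_iff lookup_neg_part)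

section \<open>Ideals of the polynomial ring in terms of the operations of the type\<close>

abbreviation pcarrier :: "nat \<Rightarrow> 'k::field mpoly set" where
  "pcarrier s \<equiv> carrier (mpoly_ring s)"

lemma pcarrier_iff: "f \<in> pcarrier s \<longleftrightarrow> (\<forall>m\<in>keys f. keys m \<subseteq> {..<s})"
  by (rule mpoly_ring_simps)

lemma cring_closed:
  "f \<in> pcarrier s \<Longrightarrow> g \<in> pcarrier s \<Longrightarrow> f + g \<in> pcarrier s"
  "f \<in> pcarrier s \<Longrightarrow> g \<in> pcarrier s \<Longrightarrow> f * g \<in> pcarrier s"
  "(0 :: 'k::field mpoly) \<in> pcarrier s"
  "(1 :: 'k mpoly) \<in> pcarrier s"
  for f g :: "'k::field mpoly"
proof -
  interpret cring "mpoly_ring s :: 'k mpoly ring" by (rule cring_mpoly_ring)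
  show "f \<in> pcarrier s \<Longrightarrow> g \<in> pcarrier s \<Longrightarrow> f + g \<in> pcarrier s"
    "f \<in> pcarrier s \<Longrightarrow> g \<in> pcarrier s \<Longrightarrow> f * g \<in> pcarrier s"
    "(0 :: 'k mpoly) \<in> pcarrier s" "(1 :: 'k mpoly) \<in> pcarrier s"
    using a_closed[of f g] m_closed[of f g] zero_closed one_closed
    by (simp_all only: mpoly_ring_simps(2-5))
qed

lemma pcarrier_uminus: "f \<in> pcarrier s \<Longrightarrow> - f \<in> pcarrier s"
  by (simp add: pcarrier_iff keys.rep_eq)

lemma pcarrier_diff: "f \<in> pcarrier s \<Longrightarrow> g \<in> pcarrier s \<Longrightarrow> f - g \<in> pcarrier s"
  using cring_closed(1)[of f s "- g"] pcarrier_uminus[of g s] by simp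

lemma pcarrier_sum: "(\<And>x. x \<in> A \<Longrightarrow> f x \<in> pcarrier s) \<Longrightarrow> sum f A \<in> pcarrier s"
  by (induction A rule: infinite_finite_induct) (auto intro: cring_closed)

lemma pcarrier_single: "keys m \<subseteq> {..<s} \<Longrightarrow> single m a \<in> pcarrier s"
  by (auto simp: pcarrier_iff)

lemma a_inv_mpoly_ring:
  assumes "f \<in> pcarrier s"
  shows "\<ominus>\<^bsub>mpoly_ring s\<^esub> f = - f"
proof -
  interpret cring "mpoly_ring s :: 'a mpoly ring" by (rule cring_mpoly_ring)
  show ?thesis
    using assms pcarrier_uminus[OF assms] by (intro minus_equality) (auto simp: mpoly_ring_simps(4,5))
qed

lemma ideal_mpolyI:
  fixes I :: "'k::field mpoly set"
  assumes "I \<subseteq> pcarrier s" "0 \<in> I"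
    and "\<And>f g. f \<in> I \<Longrightarrow> g \<in> I \<Longrightarrow> f + g \<in> I"
    and "\<And>f g. f \<in> I \<Longrightarrow> g \<in> pcarrier s \<Longrightarrow> g * f \<in> I"
  shows "ideal I (mpoly_ring s)"
proof -
  interpret cring "mpoly_ring s :: 'k mpoly ring" by (rule cring_mpoly_ring)
  have neg: "- f \<in> I" if "f \<in> I" for f
    using assms(4)[OF that, of "- 1"] pcarrier_uminus[OF cring_closed(4)[where ?'k = 'k], of s] by simp
  show ?thesis
  proof (rule idealI)
    show "ring (mpoly_ring s :: 'k mpoly ring)" by (rule ring_axioms)
    show "subgroup I (add_monoid (mpoly_ring s))"
    proof (rule group.subgroupI)
      show "group (add_monoid (mpoly_ring s :: 'k mpoly ring))" by (rule add.group_axioms)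
      fix f assume f: "f \<in> I"
      then have "inv\<^bsub>add_monoid (mpoly_ring s)\<^esub> f = - f"
        using a_inv_mpoly_ring[of f s] assms(1) by (auto simp: a_inv_def)
      then show "inv\<^bsub>add_monoid (mpoly_ring s)\<^esub> f \<in> I" using neg[OF f] by simp
    qed (use assms in \<open>auto simp: mpoly_ring_simps(4)\<close>)
    fix a x :: "'k mpoly" assume "a \<in> I" "x \<in> pcarrier s"
    then show "x \<otimes>\<^bsub>mpoly_ring s\<^esub> a \<in> I" "a \<otimes>\<^bsub>mpoly_ring s\<^esub> x \<in> I"
      using assms(4)[of a x] by (simp_all add: mpoly_ring_simps(2) mult.commute)
  qed
qed

lemma ideal_mpolyD:
  assumes "ideal I (mpoly_ring s :: 'k::field mpoly ring)"
  shows "I \<subseteq> pcarrier s" "0 \<in> I"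
    "f \<in> I \<Longrightarrow> g \<in> I \<Longrightarrow> f + g \<in> I"
    "f \<in> I \<Longrightarrow> g \<in> pcarrier s \<Longrightarrow> g * f \<in> I"
    "f \<in> I \<Longrightarrow> - f \<in> I"
    "f \<in> I \<Longrightarrow> g \<in> I \<Longrightarrow> f - g \<in> I"
proof -
  interpret ideal I "mpoly_ring s" by fact
  show sub: "I \<subseteq> pcarrier s" by (rule a_subset)
  show "0 \<in> I" using additive_subgroup.zero_closed[OF is_additive_subgroup] by (simp add: mpoly_ring_simps(5))
  show add: "f \<in> I \<Longrightarrow> g \<in> I \<Longrightarrow> f + g \<in> I" for f g
    using additive_subgroup.a_closed[OF is_additive_subgroup, of f g] by (simp add: mpoly_ring_simps(4))
  show mult: "f \<in> I \<Longrightarrow> g \<in> pcarrier s \<Longrightarrow> g * f \<in> I" for f g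
    using I_l_closed[of f g] by (simp add: mpoly_ring_simps(2))
  show neg: "f \<in> I \<Longrightarrow> - f \<in> I" for f
    using mult[of f "- 1"] pcarrier_uminus[OF cring_closed(4)[where ?'k = 'k], of s] by simp
  show "f \<in> I \<Longrightarrow> g \<in> I \<Longrightarrow> f - g \<in> I"
    using add[of f "- g"] neg by simp
qed

lemma ideal_mpoly_sum:
  assumes "ideal I (mpoly_ring s :: 'k::field mpoly ring)" "\<And>x. x \<in> A \<Longrightarrow> f x \<in> I"
  shows "sum f A \<in> I"
  using assms(2) by (induction A rule: infinite_finite_induct) (auto intro: ideal_mpolyD[OF assms(1)])

lemma primeideal_mpolyD:
  assumes "primeideal P (mpoly_ring s :: 'k::field mpoly ring)"
  shows "ideal P (mpoly_ring s)" "1 \<notin> P"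
    "f \<in> pcarrier s \<Longrightarrow> g \<in> pcarrier s \<Longrightarrow> f * g \<in> P \<Longrightarrow> f \<in> P \<or> g \<in> P"
proof -
  interpret primeideal P "mpoly_ring s" by fact
  show "ideal P (mpoly_ring s)" by (rule is_ideal)
  show "1 \<notin> P" using one_imp_carrier I_notcarr by (auto simp: mpoly_ring_simps(3))
  show "f \<in> pcarrier s \<Longrightarrow> g \<in> pcarrier s \<Longrightarrow> f * g \<in> P \<Longrightarrow> f \<in> P \<or> g \<in> P"
    using I_prime[of f g] by (simp add: mpoly_ring_simps(2))
qed

section \<open>Characters and kernels of monomial maps\<close>

definition character :: "('a::monoid_add \<Rightarrow> 'e::field) \<Rightarrow> bool" where
  "character \<chi> \<longleftrightarrow> (\<forall>x y. \<chi> (x + y) = \<chi> x * \<chi> y) \<and> (\<forall>x. \<chi> x \<noteq> 0)"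

lemma characterD:
  assumes "character \<chi>"
  shows "\<chi> (x + y) = \<chi> x * \<chi> y" "\<chi> x \<noteq> 0" "\<chi> 0 = 1"
proof -
  show *: "\<chi> (x + y) = \<chi> x * \<chi> y" "\<chi> x \<noteq> 0" for x y using assms by (auto simp: character_def)
  show "\<chi> 0 = 1" using *(1)[of 0 0] *(2)[of 0] by simp
qed

lemma character_uminus: "character \<chi> \<Longrightarrow> \<chi> (- x) = inverse (\<chi> (x :: 'a::group_add))"
  using characterD(1)[of \<chi> x "- x"] characterD(3)[of \<chi>]
  by (metis add.right_inverse inverse_unique)

lemma character_diff: "character \<chi> \<Longrightarrow> \<chi> (x - y) = \<chi> x / \<chi> (y :: 'a::group_add)"
  using characterD(1)[of \<chi> x "- y"] character_uminus[of \<chi> y] by (simp add: field_simps)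

lemma character_one: "character (\<lambda>_. 1)"
  by (simp add: character_def)

definition mpoly_push :: "((nat \<Rightarrow>\<^sub>0 int) \<Rightarrow> 'b) \<Rightarrow> ((nat \<Rightarrow>\<^sub>0 int) \<Rightarrow> 'k alg_closure) \<Rightarrow> 'k::field mpoly \<Rightarrow> ('b \<Rightarrow>\<^sub>0 'k alg_closure)" where
  "mpoly_push \<pi> \<chi> = push to_ac (\<lambda>m. \<pi> (emb m)) (\<lambda>m. \<chi> (emb m))"

lemma mpoly_push_zero [simp]: "mpoly_push \<pi> \<chi> 0 = 0"
  by (simp add: mpoly_push_def coeff_hom.push_zero[OF coeff_hom_to_ac])

lemma mpoly_push_add: "mpoly_push \<pi> \<chi> (f + g) = mpoly_push \<pi> \<chi> f + mpoly_push \<pi> \<chi> g"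
  by (simp add: mpoly_push_def coeff_hom.push_add[OF coeff_hom_to_ac])

lemma mpoly_push_diff: "mpoly_push \<pi> \<chi> (f - g) = mpoly_push \<pi> \<chi> f - mpoly_push \<pi> \<chi> g"
  by (simp add: mpoly_push_def coeff_hom.push_diff[OF coeff_hom_to_ac])

lemma mpoly_push_sum: "mpoly_push \<pi> \<chi> (sum f A) = (\<Sum>x\<in>A. mpoly_push \<pi> \<chi> (f x))"
  by (simp add: mpoly_push_def coeff_hom.push_sum[OF coeff_hom_to_ac])

lemma mpoly_push_single:
  "mpoly_push \<pi> \<chi> (single m a) = single (\<pi> (emb m)) (to_ac a * \<chi> (emb m))"
  by (simp add: mpoly_push_def coeff_hom.push_single[OF coeff_hom_to_ac])

lemma mpoly_push_mult:
  fixes \<pi> :: "(nat \<Rightarrow>\<^sub>0 int) \<Rightarrow> 'b::comm_monoid_add"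
  assumes "\<And>x y. \<pi> (x + y) = \<pi> x + \<pi> y" "character \<chi>"
  shows "mpoly_push \<pi> \<chi> (f * g) = mpoly_push \<pi> \<chi> f * mpoly_push \<pi> \<chi> g"
  unfolding mpoly_push_def
  by (rule coeff_hom.push_mult[OF coeff_hom_to_ac]) (simp_all add: assms characterD(1))

definition push_kernel :: "nat \<Rightarrow> ((nat \<Rightarrow>\<^sub>0 int) \<Rightarrow> 'b) \<Rightarrow> ((nat \<Rightarrow>\<^sub>0 int) \<Rightarrow> 'k alg_closure) \<Rightarrow> 'k::field mpoly set" where
  "push_kernel s \<pi> \<chi> = {f \<in> pcarrier s. mpoly_push \<pi> \<chi> f = 0}"

text \<open>A linear order compatible with addition lets leading terms multiply without cancelling,
  so the target ring has no zero divisors.\<close>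

lemma primeideal_push_kernel:
  fixes \<pi> :: "(nat \<Rightarrow>\<^sub>0 int) \<Rightarrow> 'b::{ordered_cancel_comm_monoid_add, linorder}"
  assumes \<pi>: "\<And>x y. \<pi> (x + y) = \<pi> x + \<pi> y" and \<chi>: "character \<chi>"
  shows "primeideal (push_kernel s \<pi> \<chi>) (mpoly_ring s :: 'k::field mpoly ring)"
proof (rule primeidealI)
  note mult = mpoly_push_mult[OF \<pi> \<chi>]
  show "ideal (push_kernel s \<pi> \<chi>) (mpoly_ring s)"
    by (rule ideal_mpolyI)
      (auto simp: push_kernel_def mult mpoly_push_add intro: cring_closed)
  show "cring (mpoly_ring s :: 'k mpoly ring)" by (rule cring_mpoly_ring)
  have "mpoly_push \<pi> \<chi> 1 \<noteq> 0"
    using mpoly_push_single[of \<pi> \<chi> 0 1] characterD(2)[OF \<chi>, of 0]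
    by auto (metis lookup_single_eq lookup_zero)
  then show "pcarrier s \<noteq> push_kernel s \<pi> \<chi>"
    using cring_closed(4)[of s] by (auto simp: push_kernel_def)
  fix f g :: "'k mpoly"
  assume "f \<in> pcarrier s" "g \<in> pcarrier s" "f \<otimes>\<^bsub>mpoly_ring s\<^esub> g \<in> push_kernel s \<pi> \<chi>"
  then show "f \<in> push_kernel s \<pi> \<chi> \<or> g \<in> push_kernel s \<pi> \<chi>"
    by (auto simp: push_kernel_def mult mpoly_ring_simps(2))
qed

lemma push_kernel_coarsen:
  assumes "character \<chi>" "\<And>x y. \<pi> x = \<pi> y \<Longrightarrow> \<sigma> x = \<sigma> y"
  shows "push_kernel s \<pi> \<chi> \<subseteq> push_kernel s \<sigma> \<chi>"
proof
  fix f assume f: "f \<in> push_kernel s \<pi> \<chi>"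
  have ker: "push to_ac (\<lambda>m. \<pi> (emb m)) (\<lambda>m. \<chi> (emb m)) f = 0"
    using f by (simp add: push_kernel_def mpoly_push_def)
  have "push to_ac (\<lambda>m. \<sigma> (emb m)) (\<lambda>m. \<chi> (emb m)) f = 0"
  proof (rule push_coarsen[OF coeff_hom_to_ac ker])
    show "\<chi> (emb x) \<noteq> 0" for x by (rule characterD(2)[OF assms(1)])
    show "\<sigma> (emb x) = \<sigma> (emb y) \<and> \<chi> (emb x) * \<chi> (emb y) = \<chi> (emb y) * \<chi> (emb x)"
      if "\<pi> (emb x) = \<pi> (emb y)" for x y
      using assms(2)[OF that] by (simp add: mult.commute)
  qed
  then show "f \<in> push_kernel s \<sigma> \<chi>" using f by (simp add: push_kernel_def mpoly_push_def)
qed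

definition binomial_of :: "(nat \<Rightarrow>\<^sub>0 int) \<Rightarrow> 'k::field mpoly" where
  "binomial_of a = mon (pos_part a) - mon (neg_part a)"

lemma binomial_of_carrier: "keys a \<subseteq> {..<s} \<Longrightarrow> binomial_of a \<in> pcarrier s"
  unfolding binomial_of_def using keys_pos_part[of a] keys_neg_part[of a]
  by (intro pcarrier_diff pcarrier_single) auto

lemma mpoly_push_binomial:
  "mpoly_push \<pi> \<chi> (binomial_of a) =
     single (\<pi> (emb (pos_part a))) (\<chi> (emb (pos_part a))) - single (\<pi> (emb (neg_part a))) (\<chi> (emb (neg_part a)))"
  by (simp add: binomial_of_def mpoly_push_diff mpoly_push_single)

lemma binomial_of_in_push_kernel:
  assumes "character \<chi>" and "\<And>x y. \<pi> (x + y) = \<pi> x + (\<pi> y :: 'b::monoid_add)"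
    and "\<pi> a = 0" "\<chi> a = 1" "keys a \<subseteq> {..<s}"
  shows "binomial_of a \<in> push_kernel s \<pi> \<chi>"
proof -
  have "emb (pos_part a) = a + emb (neg_part a)" using emb_pos_neg[of a] by (simp add: algebra_simps)
  then show ?thesis
    using assms characterD(1)[OF assms(1)]
    by (auto simp: push_kernel_def binomial_of_carrier mpoly_push_binomial)
qed

text \<open>The two terms land on different exponents, so they cannot cancel.\<close>

lemma binomial_of_notin_push_kernel:
  assumes "character \<chi>" and "\<And>x y. \<pi> (x + y) = \<pi> x + (\<pi> y :: 'b::ab_group_add)" and "\<pi> a \<noteq> 0"
  shows "binomial_of a \<notin> push_kernel s \<pi> \<chi>"
proof
  assume "binomial_of a \<in> push_kernel s \<pi> \<chi>"
  then have eq: "single (\<pi> (emb (pos_part a))) (\<chi> (emb (pos_part a))) = single (\<pi> (emb (neg_part a))) (\<chi> (emb (neg_part a)))"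
    by (auto simp: push_kernel_def mpoly_push_binomial)
  have "emb (pos_part a) = a + emb (neg_part a)" using emb_pos_neg[of a] by (simp add: algebra_simps)
  then have "\<pi> (emb (pos_part a)) \<noteq> \<pi> (emb (neg_part a))" using assms(2)[of a "emb (neg_part a)"] assms(3) by simp
  then show False
    using arg_cong[OF eq, of "\<lambda>v. lookup v (\<pi> (emb (neg_part a)))"] characterD(2)[OF assms(1)]
    by (simp add: lookup_single when_def)
qed

section \<open>The saturated lattice, the flag of primes and membership in the lattice ideal\<close>

context adapted_basis
begin

text \<open>The saturation of \<open>L\<close>.\<close>

definition M :: "(nat \<Rightarrow>\<^sub>0 int) set" where
  "M = {x. keys x \<subseteq> {..<s} \<and> (\<forall>l. r \<le> l \<longrightarrow> l < s \<longrightarrow> c l x = 0)}"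

text \<open>The quotient of \<open>\<int>\<^sup>s\<close> by the saturated lattice \<open>\<int>\<^sup>s \<inter> \<langle>b 0, \<dots>, b (i - 1)\<rangle>\<close>, which is \<open>M\<close> for \<open>i = r\<close>.\<close>

definition proj :: "nat \<Rightarrow> (nat \<Rightarrow>\<^sub>0 int) \<Rightarrow> (nat \<Rightarrow>\<^sub>0 rat)" where
  "proj i x = (\<Sum>l\<in>{i..<s}. single l (c l x))"

lemma lookup_proj: "lookup (proj i x) l = (if i \<le> l \<and> l < s then c l x else 0)"
  by (simp add: proj_def lookup_sum lookup_single when_def)

lemma c_zero [simp]: "c l 0 = 0"
  using c_add[of l 0 0] by simp

lemma c_uminus: "c l (- x) = - c l x"
  using c_add[of l x "- x"] by simp

lemma c_diff: "c l (x - y) = c l x - c l y"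
  using c_add[of l x "- y"] c_uminus[of l y] by simp

lemma c_sum: "c l (sum f A) = (\<Sum>x\<in>A. c l (f x))"
  by (induction A rule: infinite_finite_induct) (auto simp: c_add)

lemma c_cmul_nat: "c l (frag_cmul (int n) x) = of_nat n * c l x"
  by (induction n) (auto simp: c_add frag_cmul_distrib algebra_simps)

lemma c_cmul: "c l (frag_cmul n x) = of_int n * c l x"
proof (cases n)
  case (nonneg n)
  then show ?thesis by (simp add: c_cmul_nat)
next
  case (neg n)
  have "c l (frag_cmul (- int (Suc n)) x) = - c l (frag_cmul (int (Suc n)) x)"
    unfolding c_uminus[symmetric] by simp
  then show ?thesis using neg by (simp only: c_cmul_nat of_int_minus of_int_of_nat_eq mult_minus_left)
qed

lemma proj_add: "proj i (x + y) = proj i x + proj i y"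
  by (rule poly_mapping_eqI) (simp add: lookup_proj lookup_add c_add)

lemma proj_eq_iff: "proj i x = proj i y \<longleftrightarrow> (\<forall>l. i \<le> l \<longrightarrow> l < s \<longrightarrow> c l x = c l y)"
  by (auto simp: poly_mapping_eq_iff fun_eq_iff lookup_proj)

lemma proj_eq_0_iff: "proj i x = 0 \<longleftrightarrow> (\<forall>l. i \<le> l \<longrightarrow> l < s \<longrightarrow> c l x = 0)"
  by (auto simp: poly_mapping_eq_iff fun_eq_iff lookup_proj)

lemma L_carrier: "x \<in> L \<Longrightarrow> keys x \<subseteq> {..<s}"
  using subgroup.subset[OF subgroup_L] by (auto simp: free_Abelian_group_def)

lemma L_add: "x \<in> L \<Longrightarrow> y \<in> L \<Longrightarrow> x + y \<in> L"
  using subgroup.m_closed[OF subgroup_L] by simp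

lemma L_zero [simp]: "0 \<in> L"
  using subgroup.one_closed[OF subgroup_L] by simp

lemma L_uminus: "x \<in> L \<Longrightarrow> - x \<in> L"
  using subgroup.m_inv_closed[OF subgroup_L, of x] L_carrier[of x] by simp

lemma L_diff: "x \<in> L \<Longrightarrow> y \<in> L \<Longrightarrow> x - y \<in> L"
  using L_add[of x "- y"] L_uminus[of y] by simp

lemma L_cmul: "x \<in> L \<Longrightarrow> frag_cmul n x \<in> L"
proof (cases n)
  have nn: "frag_cmul (int n) x \<in> L" if "x \<in> L" for n x
    using that by (induction n) (auto simp: frag_cmul_distrib L_add)
  {
    case (nonneg n)
    then show "x \<in> L \<Longrightarrow> ?thesis" using nn by simp
  next
    case (neg n)
    then show "x \<in> L \<Longrightarrow> ?thesis" using L_uminus[OF nn[of x "Suc n"]] by simp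
  }
qed

lemma L_sum: "(\<And>x. x \<in> A \<Longrightarrow> f x \<in> L) \<Longrightarrow> sum f A \<in> L"
  by (induction A rule: infinite_finite_induct) (auto intro: L_add)

lemma L_subset_M: "L \<subseteq> M"
  using L_carrier c_L by (auto simp: M_def)

lemma M_carrier: "x \<in> M \<Longrightarrow> keys x \<subseteq> {..<s}"
  by (simp add: M_def)

lemma M_iff_proj: "x \<in> M \<longleftrightarrow> keys x \<subseteq> {..<s} \<and> proj r x = 0"
  by (auto simp: M_def proj_eq_0_iff)

lemma keys_add_sub: "keys x \<subseteq> A \<Longrightarrow> keys y \<subseteq> A \<Longrightarrow> keys (x + y) \<subseteq> A"
  for x y :: "nat \<Rightarrow>\<^sub>0 int"
  using Poly_Mapping.keys_add[of x y] by blast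

lemma keys_diff_sub: "keys x \<subseteq> A \<Longrightarrow> keys y \<subseteq> A \<Longrightarrow> keys (x - y) \<subseteq> A"
  for x y :: "nat \<Rightarrow>\<^sub>0 int"
  using keys_diff[of x y] by blast

lemma M_zero [simp]: "0 \<in> M" using L_zero L_subset_M by blast

lemma M_add: "x \<in> M \<Longrightarrow> y \<in> M \<Longrightarrow> x + y \<in> M"
  using keys_add_sub by (auto simp: M_def c_add)

lemma M_uminus: "x \<in> M \<Longrightarrow> - x \<in> M"
  by (simp add: M_def c_uminus)

lemma M_diff: "x \<in> M \<Longrightarrow> y \<in> M \<Longrightarrow> x - y \<in> M"
  using M_add[of x "- y"] M_uminus[of y] by simp

text \<open>The integer coordinates of N x from \<open>r\<close> on vanish, and the basis vectors
  before \<open>r\<close> lie in \<open>L\<close>. Hence \<open>N\<close> annihilates M/L.\<close>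

lemma M_torsion: "x \<in> M \<Longrightarrow> frag_cmul (int N) x \<in> L"
proof -
  assume x: "x \<in> M"
  obtain z where z: "\<forall>l<s. of_nat N * c l x = of_int (z l)" "frag_cmul (int N) x = (\<Sum>l<s. frag_cmul (z l) (b l))"
    using c_denom[OF M_carrier[OF x]] by blast
  have "frag_cmul (z l) (b l) \<in> L" if "l < s" for l
  proof (cases "l < r")
    case True
    then show ?thesis using b_L L_cmul by blast
  next
    case False
    then have "c l x = 0" using that x by (auto simp: M_def)
    then have "rat_of_int (z l) = 0" using z(1) that by (metis mult_zero_right)
    then show ?thesis by simp
  qed
  then show ?thesis unfolding z(2) by (intro L_sum) auto
qed

lemma torsion_imp_M:
  assumes "keys x \<subseteq> {..<s}" "n \<noteq> 0" "frag_cmul n x \<in> L"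
  shows "x \<in> M"
  using assms(1,2) c_L[OF assms(3)] by (auto simp: M_def c_cmul)

text \<open>If x - y = N w, then \<open>w\<close> has vanishing coordinates from \<open>r\<close>
  on, so it lies in \<open>M\<close> and N w lies in \<open>L\<close>. Both the finiteness of M/L
  and the count of classes rest on this criterion.\<close>

lemma M_eqI_mod_N:
  assumes "keys x \<subseteq> {..<s}" "keys y \<subseteq> {..<s}"
    and "\<And>l. r \<le> l \<Longrightarrow> l < s \<Longrightarrow> c l x = c l y"
    and "\<And>j. j < s \<Longrightarrow> lookup x j mod int N = lookup y j mod int N"
  shows "x - y \<in> L"
proof -
  define w where "w = Poly_Mapping.map (\<lambda>t. t div int N) (x - y)"
  have lookup_w: "lookup w j = (lookup x j - lookup y j) div int N" for j
    by (simp add: w_def map.rep_eq when_def lookup_minus)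
  have keys: "keys (x - y) \<subseteq> {..<s}" using keys_diff_sub assms by blast
  have w_carrier: "keys w \<subseteq> {..<s}"
  proof
    fix j assume "j \<in> keys w"
    then have "lookup (x - y) j \<noteq> 0" by (auto simp: in_keys_iff lookup_w lookup_minus)
    then show "j \<in> {..<s}" using keys by (auto simp: in_keys_iff)
  qed
  have eq: "frag_cmul (int N) w = x - y"
  proof (rule poly_mapping_eqI)
    fix j
    have "int N dvd lookup x j - lookup y j"
    proof (cases "j < s")
      case True
      then show ?thesis using assms(4) by (simp add: mod_eq_dvd_iff)
    next
      case False
      then have "lookup x j = 0" "lookup y j = 0" using assms by (auto simp: in_keys_iff)
      then show ?thesis by simp
    qed
    then show "lookup (frag_cmul (int N) w) j = lookup (x - y) j"
      by (simp add: lookup_w lookup_minus)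
  qed
  have "c l w = 0" if "r \<le> l" "l < s" for l
  proof -
    have "of_int (int N) * c l w = 0" unfolding c_cmul[symmetric] eq using assms(3)[OF that] by (simp add: c_diff)
    then show ?thesis using N_pos by simp
  qed
  then have "w \<in> M" using w_carrier by (auto simp: M_def)
  then show ?thesis using M_torsion eq by metis
qed

text \<open>For \<open>i = r\<close> this is the Q(\<chi>) of the overview; smaller and larger
  \<open>i\<close> supply the chains below and above it.\<close>

definition Qp :: "nat \<Rightarrow> ((nat \<Rightarrow>\<^sub>0 int) \<Rightarrow> 'k alg_closure) \<Rightarrow> 'k::field mpoly set" where
  "Qp i \<chi> = push_kernel s (proj i) \<chi>"

lemma primeideal_Qp: "character \<chi> \<Longrightarrow> primeideal (Qp i \<chi>) (mpoly_ring s)"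
  unfolding Qp_def by (rule primeideal_push_kernel) (rule proj_add)

text \<open>Only the coordinate \<open>i\<close> is forgotten in passing to \<open>Suc i\<close>,
  and the binomial of \<open>b i\<close> detects exactly that; the condition on \<chi> makes its two
  terms cancel in the coarser quotient.\<close>

lemma Qp_strict:
  assumes "character \<chi>" "i < s" "\<chi> (b i) = 1"
  shows "Qp i \<chi> \<subset> Qp (Suc i) \<chi>"
proof -
  have "Qp i \<chi> \<subseteq> Qp (Suc i) \<chi>"
    unfolding Qp_def using assms(1) by (rule push_kernel_coarsen) (auto simp: proj_eq_iff)
  moreover have "binomial_of (b i) \<in> Qp (Suc i) \<chi>"
    unfolding Qp_def using assms c_b
    by (intro binomial_of_in_push_kernel proj_add b_carrier) (auto simp: proj_eq_0_iff)
  moreover have "binomial_of (b i) \<notin> Qp i \<chi>"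
    unfolding Qp_def
  proof (rule binomial_of_notin_push_kernel[OF assms(1) proj_add])
    show "proj i (b i) \<noteq> 0" using assms(2) c_b[of i i] by (auto simp: proj_eq_0_iff)
  qed
  ultimately show ?thesis by blast
qed

definition lat_class :: "(nat \<Rightarrow>\<^sub>0 int) \<Rightarrow> (nat \<Rightarrow>\<^sub>0 int) set" where
  "lat_class x = {y. y - x \<in> L}"

lemma lat_class_eq_iff: "lat_class x = lat_class y \<longleftrightarrow> x - y \<in> L"
proof
  assume "lat_class x = lat_class y"
  moreover have "x \<in> lat_class x" by (simp add: lat_class_def)
  ultimately show "x - y \<in> L" by (auto simp: lat_class_def)
next
  assume xy: "x - y \<in> L"
  have "z - x \<in> L \<longleftrightarrow> z - y \<in> L" for z
    using L_add[OF _ xy, of "z - x"] L_diff[OF _ xy, of "z - y"] by auto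
  then show "lat_class x = lat_class y" by (auto simp: lat_class_def)
qed

lemma lat_class_add: "lat_class x = lat_class y \<Longrightarrow> lat_class (z + x) = lat_class (z + y)"
  by (simp add: lat_class_eq_iff)

abbreviation lat_push :: "'k::field mpoly \<Rightarrow> ((nat \<Rightarrow>\<^sub>0 int) set \<Rightarrow>\<^sub>0 'k alg_closure)" where
  "lat_push \<equiv> mpoly_push lat_class (\<lambda>_. 1)"

lemma lattice_ideal_alt: "lattice_ideal s L = Idl\<^bsub>mpoly_ring s\<^esub> {binomial_of a | a. a \<in> L}"
  by (simp add: lattice_ideal_def binomial_of_def)

lemma ideal_lattice_ideal: "ideal (lattice_ideal s L :: 'k::field mpoly set) (mpoly_ring s)"
proof -
  interpret cring "mpoly_ring s :: 'k mpoly ring" by (rule cring_mpoly_ring)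
  show ?thesis unfolding lattice_ideal_alt using L_carrier
    by (intro genideal_ideal) (auto intro: binomial_of_carrier)
qed

lemma binomial_in_lattice_ideal: "a \<in> L \<Longrightarrow> (binomial_of a :: 'k::field mpoly) \<in> lattice_ideal s L"
proof -
  interpret cring "mpoly_ring s :: 'k mpoly ring" by (rule cring_mpoly_ring)
  assume "a \<in> L"
  then show ?thesis unfolding lattice_ideal_alt using L_carrier
    by (intro subsetD[OF genideal_self]) (auto intro: binomial_of_carrier)
qed

lemma lattice_ideal_subset:
  assumes "ideal J (mpoly_ring s :: 'k::field mpoly ring)" "\<And>a. a \<in> L \<Longrightarrow> binomial_of a \<in> J"
  shows "lattice_ideal s L \<subseteq> J"
proof -
  interpret cring "mpoly_ring s :: 'k mpoly ring" by (rule cring_mpoly_ring)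
  show ?thesis unfolding lattice_ideal_alt using assms by (intro genideal_minimal) auto
qed

lemma mon_diff_in_lattice_ideal:
  assumes "keys m \<subseteq> {..<s}" "emb m - emb n \<in> L"
  shows "(mon m - mon n :: 'k::field mpoly) \<in> lattice_ideal s L"
proof -
  let ?a = "emb m - emb n"
  \<comment> \<open>The exponent of the greatest common divisor of the two monomials.\<close>
  define d where "d = m - pos_part ?a"
  have m: "m = d + pos_part ?a" and n: "n = d + neg_part ?a"
    by (rule poly_mapping_eqI; simp add: d_def lookup_add lookup_minus lookup_pos_part lookup_neg_part)+
  have "mon m - mon n = mon d * (binomial_of ?a :: 'k mpoly)"
    by (subst m, subst n) (simp add: binomial_of_def right_diff_distrib mult_single)
  moreover have "keys d \<subseteq> {..<s}"
  proof
    fix j assume "j \<in> keys d"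
    then have "lookup m j \<noteq> 0" by (auto simp: d_def in_keys_iff lookup_minus)
    then have "j \<in> keys m" by (simp only: in_keys_iff not_False_eq_True)
    then show "j \<in> {..<s}" using assms(1) by blast
  qed
  ultimately show ?thesis
    using ideal_mpolyD(4)[OF ideal_lattice_ideal binomial_in_lattice_ideal[OF assms(2)] pcarrier_single[of d s 1]]
    by simp
qed

text \<open>Cosets form a type without addition, so \<open>lat_push\<close> is not a ring
  homomorphism between types. That its kernel absorbs multiplication follows instead because
  shifting exponents respects the classes.\<close>

lemma lat_push_mult_zero:
  assumes "lat_push f = 0"
  shows "lat_push (g * f) = 0"
proof -
  have single: "lat_push (single m a * f) = 0" for m a
  proof -
    have "lat_push (single m a * f) =
       push to_ac (\<lambda>x. lat_class (emb (m + x))) (\<lambda>x. to_ac a * 1) f"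
      unfolding mpoly_push_def by (rule coeff_hom.push_single_mult[OF coeff_hom_to_ac])
    also have "\<dots> = 0"
      by (rule push_coarsen[OF coeff_hom_to_ac, of "\<lambda>m. lat_class (emb m)" "\<lambda>_. 1"])
        (use assms in \<open>simp_all add: mpoly_push_def lat_class_eq_iff\<close>)
    finally show ?thesis .
  qed
  have "lat_push (g * f) = lat_push (\<Sum>m\<in>keys g. single m (lookup g m) * f)"
    by (simp only: sum_keys_single flip: sum_distrib_right)
  then show ?thesis by (simp add: mpoly_push_sum single)
qed

lemma push_to_ac_eq_0_iff: "push to_ac \<rho> (\<lambda>_. 1) f = 0 \<longleftrightarrow> push (\<lambda>x. x) \<rho> (\<lambda>_. 1) (f :: 'a \<Rightarrow>\<^sub>0 'k::field) = 0"
  by (simp add: poly_mapping_eq_iff fun_eq_iff coeff_hom.lookup_push[OF coeff_hom_to_ac]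
     coeff_hom.lookup_push[OF coeff_hom_id] flip: to_ac_sum)

text \<open>Moving every monomial of \<open>f\<close> to a fixed representative of its class changes
  \<open>f\<close> by multiples of binomials; if the coefficients sum to 0 over each class, nothing
  is left afterwards.\<close>

lemma lattice_ideal_iff:
  "f \<in> lattice_ideal s L \<longleftrightarrow> f \<in> pcarrier s \<and> lat_push (f :: 'k::field mpoly) = 0"
proof
  assume f: "f \<in> lattice_ideal s L"
  have "ideal {f \<in> pcarrier s. lat_push (f :: 'k mpoly) = 0} (mpoly_ring s)"
    by (rule ideal_mpolyI)
      (auto simp: lat_push_mult_zero mpoly_push_add intro: cring_closed)
  then have "lattice_ideal s L \<subseteq> {f \<in> pcarrier s. lat_push (f :: 'k mpoly) = 0}"
  proof (rule lattice_ideal_subset)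
    fix a assume a: "a \<in> L"
    have "lat_class (emb (pos_part a)) = lat_class (emb (neg_part a))"
      unfolding lat_class_eq_iff emb_pos_neg by (rule a)
    then show "binomial_of a \<in> {f \<in> pcarrier s. lat_push (f :: 'k mpoly) = 0}"
      using L_carrier[OF a] by (simp add: binomial_of_carrier mpoly_push_binomial)
  qed
  then show "f \<in> pcarrier s \<and> lat_push f = 0" using f by blast
next
  assume f: "f \<in> pcarrier s \<and> lat_push f = 0"
  \<comment> \<open>The choice depends on the class of \<open>m\<close> only, and stays among the
    monomials of \<open>f\<close>.\<close>
  define \<rho> where "\<rho> m = (SOME n. n \<in> keys f \<and> lat_class (emb n) = lat_class (emb m))" for m
  have \<rho>: "\<rho> m \<in> keys f \<and> lat_class (emb (\<rho> m)) = lat_class (emb m)" if "m \<in> keys f" for m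
    unfolding \<rho>_def by (rule someI[of _ m]) (use that in simp)
  have "push to_ac \<rho> (\<lambda>_. 1) f = 0"
    by (rule push_coarsen[OF coeff_hom_to_ac, of "\<lambda>m. lat_class (emb m)" "\<lambda>_. 1"])
      (use f in \<open>auto simp: mpoly_push_def \<rho>_def\<close>)
  then have z: "(\<Sum>m\<in>keys f. single (\<rho> m) (lookup f m)) = 0"
    unfolding push_to_ac_eq_0_iff by (simp add: push_def)
  have "f = (\<Sum>m\<in>keys f. single m (lookup f m)) -
     (\<Sum>m\<in>keys f. single (\<rho> m) (lookup f m))"
    unfolding z sum_keys_single by simp
  also have "\<dots> = (\<Sum>m\<in>keys f. single 0 (lookup f m) * (mon m - mon (\<rho> m)))"
    by (simp add: right_diff_distrib mult_single sum_subtractf)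
  also have "\<dots> \<in> lattice_ideal s L"
  proof (rule ideal_mpoly_sum[OF ideal_lattice_ideal])
    fix m assume m: "m \<in> keys f"
    have "mon m - mon (\<rho> m) \<in> lattice_ideal s L"
      using \<rho>[OF m] f m by (intro mon_diff_in_lattice_ideal) (auto simp: pcarrier_iff lat_class_eq_iff dest: L_uminus)
    then show "single 0 (lookup f m) * (mon m - mon (\<rho> m)) \<in> lattice_ideal s L"
      by (intro ideal_mpolyD(4)[OF ideal_lattice_ideal]) (auto intro: pcarrier_single)
  qed
  finally show "f \<in> lattice_ideal s L" .
qed

lemma lattice_ideal_subset_Qp:
  assumes "character \<chi>" "\<And>x. x \<in> L \<Longrightarrow> \<chi> x = 1" "r \<le> i"
  shows "lattice_ideal s L \<subseteq> Qp i \<chi>"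
proof (rule lattice_ideal_subset)
  show "ideal (Qp i \<chi>) (mpoly_ring s)" using primeideal_mpolyD(1)[OF primeideal_Qp[OF assms(1)]] .
  fix a assume "a \<in> L"
  then show "binomial_of a \<in> Qp i \<chi>" unfolding Qp_def
    using assms L_carrier c_L by (intro binomial_of_in_push_kernel proj_add) (auto simp: proj_eq_0_iff)
qed

end

section \<open>Growth of Hilbert functions and heights\<close>

definition pm_scale :: "'k::field \<Rightarrow> ('a \<Rightarrow>\<^sub>0 'k) \<Rightarrow> ('a \<Rightarrow>\<^sub>0 'k)" where
  "pm_scale a f = Poly_Mapping.map ((*) a) f"

lemma lookup_pm_scale [simp]: "lookup (pm_scale a f) x = a * lookup f x"
  by (simp add: pm_scale_def map.rep_eq when_def)

lemma mpoly_scale_eq_pm_scale: "mpoly_scale = pm_scale"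
  by (rule ext)+ (simp add: mpoly_scale_def pm_scale_def mult_map_scale_conv_mult)

lemma vector_space_pm_scale: "vector_space (pm_scale :: 'k::field \<Rightarrow> ('a \<Rightarrow>\<^sub>0 'k) \<Rightarrow> 'a \<Rightarrow>\<^sub>0 'k)"
  by unfold_locales (auto intro!: poly_mapping_eqI simp: lookup_add algebra_simps)

lemma pm_scale_single: "pm_scale a (single m c) = single m (a * c)"
  by (rule poly_mapping_eqI) (simp add: lookup_single when_def)

definition mdeg :: "('a \<Rightarrow>\<^sub>0 nat) \<Rightarrow> nat" where
  "mdeg m = (\<Sum>j\<in>keys m. lookup m j)"

lemma mdeg_superset: "finite A \<Longrightarrow> keys m \<subseteq> A \<Longrightarrow> mdeg m = (\<Sum>j\<in>A. lookup m j)"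
  unfolding mdeg_def by (rule sum.mono_neutral_left) (auto simp: in_keys_iff)

lemma mdeg_zero [simp]: "mdeg 0 = 0"
  by (simp add: mdeg_def)

lemma mdeg_single [simp]: "mdeg (single j n) = n"
  by (simp add: mdeg_superset[of "{j}"])

lemma mdeg_add: "mdeg (m + n) = mdeg m + mdeg n"
proof -
  let ?A = "keys m \<union> keys n"
  have "keys (m + n) \<subseteq> ?A" by (rule Poly_Mapping.keys_add)
  then show ?thesis
    by (simp add: mdeg_superset[of ?A] lookup_add sum.distrib)
qed

definition monomials :: "'a set \<Rightarrow> nat \<Rightarrow> ('a \<Rightarrow>\<^sub>0 nat) set" where
  "monomials J i = {m. keys m \<subseteq> J \<and> mdeg m \<le> i}"

lemma monomials_mono: "J \<subseteq> J' \<Longrightarrow> i \<le> i' \<Longrightarrow> monomials J i \<subseteq> monomials J' i'"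
  by (auto simp: monomials_def)

lemma monomials_insert:
  assumes "j \<notin> J"
  shows "monomials (insert j J) i = (\<Union>t\<le>i. (+) (single j t) ` monomials J (i - t))"
proof (intro equalityI subsetI)
  fix m assume m: "m \<in> monomials (insert j J) i"
  define t where "t = lookup m j"
  define n where "n = m - single j t"
  have eq: "m = single j t + n"
    by (rule poly_mapping_eqI) (auto simp: n_def t_def lookup_add lookup_minus lookup_single when_def)
  have "keys n \<subseteq> J"
  proof
    fix x assume "x \<in> keys n"
    then have "lookup n x \<noteq> 0" by (simp only: in_keys_iff not_False_eq_True)
    then have "x \<noteq> j" "lookup m x \<noteq> 0"
      by (auto simp: n_def t_def lookup_minus lookup_single when_def split: if_splits)
    then have "x \<in> keys m" "x \<noteq> j" by (simp_all only: in_keys_iff not_False_eq_True)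
    then show "x \<in> J" using m by (auto simp: monomials_def)
  qed
  moreover have "t + mdeg n \<le> i"
    using m arg_cong[OF eq, of mdeg] by (simp add: mdeg_add monomials_def)
  ultimately show "m \<in> (\<Union>t\<le>i. (+) (single j t) ` monomials J (i - t))"
    using eq by (intro UN_I[of t]) (auto simp: monomials_def)
next
  fix m assume "m \<in> (\<Union>t\<le>i. (+) (single j t) ` monomials J (i - t))"
  then obtain t n where t: "t \<le> i" "m = single j t + n" "n \<in> monomials J (i - t)" by blast
  then show "m \<in> monomials (insert j J) i"
    using Poly_Mapping.keys_add[of "single j t" n]
    by (auto simp: monomials_def mdeg_add split: if_splits)
qed

lemma finite_card_monomials:
  assumes "finite J"
  shows "finite (monomials J i) \<and> card (monomials J i) = (i + card J) choose (card J)"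
  using assms
proof (induction J arbitrary: i)
  case empty
  have "monomials {} i = {0 :: 'a \<Rightarrow>\<^sub>0 nat}" by (auto simp: monomials_def)
  then show ?case by simp
next
  case (insert j J)
  have lookup0: "lookup m j = 0" if "m \<in> monomials J i" for m i
    using that insert(2) by (auto simp: monomials_def in_keys_iff)
  have inj: "inj_on ((+) (single j t)) (monomials J (i - t))" for t by (auto simp: inj_on_def)
  have "card (monomials (insert j J) i) = (\<Sum>t\<le>i. card ((+) (single j t) ` monomials J (i - t)))"
    unfolding monomials_insert[OF insert(2)]
  proof (rule card_UN_disjoint)
    show "\<forall>t\<in>{..i}. \<forall>u\<in>{..i}. t \<noteq> u \<longrightarrow>
       (+) (single j t) ` monomials J (i - t) \<inter> (+) (single j u) ` monomials J (i - u) = {}"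
    proof (intro ballI impI, rule ccontr)
      fix t u assume "t \<noteq> u" and "(+) (single j t) ` monomials J (i - t) \<inter> (+) (single j u) ` monomials J (i - u) \<noteq> {}"
      then obtain m n where mn: "m \<in> monomials J (i - t)" "n \<in> monomials J (i - u)" "single j t + m = single j u + n"
        by blast
      show False using arg_cong[OF mn(3), of "\<lambda>v. lookup v j"] \<open>t \<noteq> u\<close>
        by (simp add: lookup_add lookup0[OF mn(1)] lookup0[OF mn(2)])
    qed
  qed (use insert.IH in auto)
  also have "\<dots> = (\<Sum>t\<le>i. (i - t + card J) choose card J)"
    by (simp add: card_image[OF inj] insert.IH)
  also have "\<dots> = (\<Sum>t\<le>i. (t + card J) choose card J)"
    using sum.nat_diff_reindex[of "\<lambda>t. (t + card J) choose card J" "Suc i"] by (simp add: lessThan_Suc_atMost)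
  \<comment> \<open>Symmetry brings the sum into the form of the hockey-stick identity.\<close>
  also have "\<dots> = (\<Sum>t\<le>i. (card J + t) choose t)"
    by (rule sum.cong[OF refl]) (subst binomial_symmetric, auto simp: add.commute)
  also have "\<dots> = Suc (card J + i) choose i" by (rule sum_choose_lower)
  also have "\<dots> = (i + card (insert j J)) choose card (insert j J)"
    using insert(1,2) by (subst binomial_symmetric) (auto simp: add.commute)
  finally show ?case using insert.IH monomials_insert[OF insert(2)] by auto
qed

lemmas finite_monomials = finite_card_monomials[THEN conjunct1]
lemmas card_monomials = finite_card_monomials[THEN conjunct2]

lemma binomial_Suc_add: "Suc n * ((i + Suc n) choose Suc n) = (i + Suc n) * ((i + n) choose n)"
  by (metis Suc_times_binomial_eq add_Suc_right mult.commute)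

lemma binomial_le_power: "(i + n) choose n \<le> (i + 1) ^ n"
proof (induction n)
  case (Suc n)
  have "Suc n * ((i + Suc n) choose Suc n) \<le> (Suc n * (i + 1)) * (i + 1) ^ n"
    unfolding binomial_Suc_add using Suc by (intro mult_mono) auto
  then have "Suc n * ((i + Suc n) choose Suc n) \<le> Suc n * (i + 1) ^ Suc n"
    by (simp only: power_Suc mult.assoc)
  then show ?case by (simp only: nat_mult_le_cancel1[OF zero_less_Suc])
qed simp

lemma power_le_fact_binomial: "i ^ n \<le> fact n * ((i + n) choose n)"
proof (induction n)
  case (Suc n)
  have "i ^ Suc n \<le> (i + Suc n) * (fact n * ((i + n) choose n))"
    unfolding power_Suc using Suc by (intro mult_mono) auto
  also have "\<dots> = fact n * (Suc n * ((i + Suc n) choose Suc n))"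
    unfolding binomial_Suc_add by (simp only: ac_simps)
  also have "\<dots> = fact (Suc n) * ((i + Suc n) choose Suc n)"
    by (simp only: fact_Suc of_nat_id ac_simps)
  finally show ?case .
qed simp

text \<open>The left side is at least m^e / e!, while the right side grows like m^k. The scale
  \<open>d\<close> occurs because degrees are later counted in multiples of the degrees of auxiliary
  polynomials.\<close>

lemma binomial_growth_exponent:
  assumes "\<And>m. (m + e) choose e \<le> A * (d * m + 1) ^ k"
  shows "e \<le> k"
proof (rule ccontr)
  assume "\<not> e \<le> k"
  then obtain q where e: "e = k + Suc q" using less_iff_Suc_add[of k e] by auto
  \<comment> \<open>With this constant the inequality at positive \<open>m\<close> becomes m^(e-k)
    \<le> B, which fails at \<open>m = B + 1\<close>.\<close>
  define B where "B = fact e * A * (d + 1) ^ k"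
  define m where "m = B + 1"
  have "m ^ e \<le> fact e * ((m + e) choose e)" by (rule power_le_fact_binomial)
  also have "\<dots> \<le> fact e * (A * (d * m + 1) ^ k)" using assms by simp
  also have "\<dots> \<le> fact e * (A * ((d + 1) * m) ^ k)"
    by (intro mult_left_mono power_mono) (auto simp: m_def)
  also have "\<dots> = B * m ^ k" by (simp only: B_def power_mult_distrib ac_simps)
  finally have "m ^ Suc q * m ^ k \<le> B * m ^ k" by (simp add: e power_add ac_simps)
  then have "m ^ Suc q \<le> B" by (simp add: m_def)
  moreover have "m \<le> m ^ Suc q" by (rule self_le_power) (auto simp: m_def)
  ultimately show False by (simp add: m_def)
qed

section \<open>Dimension counts modulo ideals and lengths of prime chains\<close>

lemma mpoly_upto_degree_iff:
  "f \<in> mpoly_upto_degree s i \<longleftrightarrow> keys f \<subseteq> monomials {..<s} i"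
  by (auto simp: mpoly_upto_degree_def pcarrier_iff monomials_def mdeg_def subset_iff)

lemma mpoly_upto_degree_carrier: "f \<in> mpoly_upto_degree s i \<Longrightarrow> f \<in> pcarrier s"
  by (simp add: mpoly_upto_degree_def)

lemma mpoly_upto_degree_mono: "i \<le> j \<Longrightarrow> mpoly_upto_degree s i \<subseteq> mpoly_upto_degree s j"
  using monomials_mono[of "{..<s}" "{..<s}" i j] by (auto simp: mpoly_upto_degree_iff)

lemma mpoly_upto_degree_mult:
  assumes "f \<in> mpoly_upto_degree s i" "g \<in> mpoly_upto_degree s j"
  shows "f * g \<in> mpoly_upto_degree s (i + j)"
  unfolding mpoly_upto_degree_iff
proof
  fix m assume "m \<in> keys (f * g)"
  then obtain a b where ab: "m = a + b" "a \<in> keys f" "b \<in> keys g"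
    using keys_mult[of f g] by blast
  then have "a \<in> monomials {..<s} i" "b \<in> monomials {..<s} j"
    using assms by (auto simp: mpoly_upto_degree_iff)
  then show "m \<in> monomials {..<s} (i + j)"
    using Poly_Mapping.keys_add[of a b] by (auto simp: ab(1) monomials_def mdeg_add)
qed

lemma ex_mpoly_upto_degree:
  assumes "f \<in> pcarrier s"
  shows "\<exists>d. f \<in> mpoly_upto_degree s d"
proof -
  have "keys f \<subseteq> monomials {..<s} (Max (insert 0 (mdeg ` keys f)))"
    using assms by (auto simp: monomials_def pcarrier_iff intro!: Max_ge)
  then show ?thesis unfolding mpoly_upto_degree_iff by blast
qed

text \<open>A family indexed by numbers, not a set, so that two families can be concatenated by
  shifting indices.\<close>

definition indep_mod :: "'k::field mpoly set \<Rightarrow> nat \<Rightarrow> (nat \<Rightarrow> 'k mpoly) \<Rightarrow> bool" where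
  "indep_mod P n f \<longleftrightarrow> (\<forall>a. (\<Sum>l<n. mpoly_scale (a l) (f l)) \<in> P \<longrightarrow> (\<forall>l<n. a l = 0))"

text \<open>The dimension of the image of \<open>S\<^bsub>\<le>i\<^esub>\<close> in \<open>S/P\<close> is at least \<open>n\<close>.\<close>

definition dim_ge :: "nat \<Rightarrow> 'k::field mpoly set \<Rightarrow> nat \<Rightarrow> nat \<Rightarrow> bool" where
  "dim_ge s P i n \<longleftrightarrow> (\<exists>f. (\<forall>l<n. f l \<in> mpoly_upto_degree s i) \<and> indep_mod P n f)"

lemma dim_ge_antimono: "dim_ge s Q i n \<Longrightarrow> P \<subseteq> Q \<Longrightarrow> i \<le> j \<Longrightarrow> dim_ge s P j n"
  unfolding dim_ge_def indep_mod_def using mpoly_upto_degree_mono[of i j s] by blast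

lemma indep_modD: "indep_mod P n f \<Longrightarrow> (\<Sum>l<n. mpoly_scale (a l) (f l)) \<in> P \<Longrightarrow> l < n \<Longrightarrow> a l = 0"
  unfolding indep_mod_def by blast

lemma dim_geI: "(\<And>l. l < n \<Longrightarrow> f l \<in> mpoly_upto_degree s i) \<Longrightarrow> indep_mod P n f \<Longrightarrow> dim_ge s P i n"
  unfolding dim_ge_def by blast

text \<open>Since \<open>P\<close> contains the kernel of the push-forward along
  \<open>\<rho>\<close>, independence modulo \<open>P\<close> survives the push-forward, and the
  images lie in the span of the images of monomials.\<close>

lemma dim_ge_bound:
  fixes P :: "'k::field mpoly set" and \<rho> :: "(nat \<Rightarrow>\<^sub>0 nat) \<Rightarrow> 'b"
  assumes "dim_ge s P i n"
    and P: "\<And>f. f \<in> pcarrier s \<Longrightarrow> push (\<lambda>x. x) \<rho> (\<lambda>_. 1) f = 0 \<Longrightarrow> f \<in> P"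
  shows "n \<le> card (\<rho> ` monomials {..<s} i)"
proof -
  interpret V: vector_space "pm_scale :: 'k \<Rightarrow> ('b \<Rightarrow>\<^sub>0 'k) \<Rightarrow> 'b \<Rightarrow>\<^sub>0 'k"
    by (rule vector_space_pm_scale)
  interpret H: coeff_hom "\<lambda>x::'k. x" by (rule coeff_hom_id)
  obtain f where f: "\<forall>l<n. f l \<in> mpoly_upto_degree s i" "indep_mod P n f"
    using assms(1) by (auto simp: dim_ge_def)
  let ?p = "push (\<lambda>x. x) \<rho> (\<lambda>_. 1) :: 'k mpoly \<Rightarrow> _"
  have push_scale: "?p (mpoly_scale a g) = pm_scale a (?p g)" for a g
    unfolding mpoly_scale_def H.push_single_mult
    by (rule poly_mapping_eqI) (simp add: H.lookup_push sum_distrib_left ac_simps)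
  have ind: "\<forall>l<n. a l = 0" if "(\<Sum>l<n. pm_scale (a l) (?p (f l))) = 0" for a
  proof -
    have "?p (\<Sum>l<n. mpoly_scale (a l) (f l)) = 0"
      using that by (simp add: H.push_sum push_scale)
    moreover have "(\<Sum>l<n. mpoly_scale (a l) (f l)) \<in> pcarrier s"
      using f(1) unfolding mpoly_scale_def
      by (intro pcarrier_sum cring_closed(2) pcarrier_single) (auto dest: mpoly_upto_degree_carrier)
    ultimately show ?thesis using P indep_modD[OF f(2), of a] by blast
  qed
  \<comment> \<open>A repetition would be a relation with coefficients 1 and -1. Distinctness lets
    the family be treated as a set of the same size.\<close>
  have inj: "inj_on (\<lambda>l. ?p (f l)) {..<n}"
  proof (rule inj_onI, rule ccontr)
    fix l l' assume l: "l \<in> {..<n}" "l' \<in> {..<n}" "?p (f l) = ?p (f l')" "l \<noteq> l'"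
    let ?a = "\<lambda>j. if j = l then 1 else if j = l' then -1 else (0::'k)"
    define w where "w j = ?p (f j)" for j
    have "(\<Sum>j<n. pm_scale (?a j) (w j)) = (\<Sum>j\<in>{l, l'}. pm_scale (?a j) (w j))"
      using l(1,2) by (intro sum.mono_neutral_right) auto
    also have "\<dots> = w l - w l'" using l(4) by simp
    also have "\<dots> = 0" using l(3) by (simp add: w_def)
    finally have "\<forall>j<n. ?a j = 0" unfolding w_def by (rule ind)
    then show False using l(1) by auto
  qed
  have indep: "V.independent ((\<lambda>l. ?p (f l)) ` {..<n})"
  proof (rule V.independent_if_scalars_zero)
    fix u w assume u: "(\<Sum>w\<in>(\<lambda>l. ?p (f l)) ` {..<n}. pm_scale (u w) w) = 0" and w: "w \<in> (\<lambda>l. ?p (f l)) ` {..<n}"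
    have "(\<Sum>l<n. pm_scale (u (?p (f l))) (?p (f l))) = 0"
      using u by (subst (asm) sum.reindex[OF inj]) simp
    then show "u w = 0" using ind[of "\<lambda>l. u (?p (f l))"] w by auto
  qed simp
  have span: "(\<lambda>l. ?p (f l)) ` {..<n} \<subseteq> V.span ((\<lambda>v. single v 1) ` \<rho> ` monomials {..<s} i)"
  proof
    fix w assume "w \<in> (\<lambda>l. ?p (f l)) ` {..<n}"
    then obtain l where l: "l < n" "w = ?p (f l)" by auto
    have "w = (\<Sum>m\<in>keys (f l). pm_scale (lookup (f l) m) (single (\<rho> m) 1))"
      by (simp add: l(2) push_def pm_scale_single)
    also have "\<dots> \<in> V.span ((\<lambda>v. single v 1) ` \<rho> ` monomials {..<s} i)"
      using f(1) l(1) by (intro V.span_sum V.span_scale V.span_base) (auto simp: mpoly_upto_degree_iff)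
    finally show "w \<in> V.span ((\<lambda>v. single v 1) ` \<rho> ` monomials {..<s} i)" .
  qed
  have "finite ((\<lambda>v. single v (1::'k)) ` \<rho> ` monomials {..<s} i)"
    using finite_monomials[of "{..<s}" i] by auto
  then have "card ((\<lambda>l. ?p (f l)) ` {..<n}) \<le> card ((\<lambda>v. single v (1::'k)) ` \<rho> ` monomials {..<s} i)"
    using V.independent_span_bound[OF _ indep span] by blast
  also have "\<dots> \<le> card (\<rho> ` monomials {..<s} i)"
    using finite_monomials[of "{..<s}" i] by (intro card_image_le) auto
  finally show ?thesis by (simp add: card_image[OF inj])
qed

text \<open>The monomials of \<open>A\<close> go to distinct exponents, so every coefficient of a
  combination can be read off from its image.\<close>

lemma dim_ge_push_kernel:
  fixes \<chi> :: "(nat \<Rightarrow>\<^sub>0 int) \<Rightarrow> 'k::field alg_closure"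
  assumes "A \<subseteq> monomials {..<s} i" "inj_on (\<lambda>m. \<pi> (emb m)) A" "\<And>x. \<chi> x \<noteq> 0"
  shows "dim_ge s (push_kernel s \<pi> \<chi>) i (card A)"
proof -
  have fin: "finite A" using assms(1) finite_monomials[of "{..<s}" i] finite_subset by blast
  obtain g where "bij_betw g {0..<card A} A" using ex_bij_betw_nat_finite[OF fin] by blast
  then have g: "bij_betw g {..<card A} A" by (simp add: atLeast0LessThan)
  have gA: "g l \<in> A" if "l < card A" for l using g that by (auto simp: bij_betw_def)
  have "indep_mod (push_kernel s \<pi> \<chi>) (card A) (\<lambda>l. mon (g l))"
    unfolding indep_mod_def
  proof (intro allI impI)
    fix a :: "nat \<Rightarrow> 'k" and l
    assume "(\<Sum>l<card A. mpoly_scale (a l) (mon (g l))) \<in> push_kernel s \<pi> \<chi>" and l: "l < card A"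
    then have "mpoly_push \<pi> \<chi> (\<Sum>l<card A. single (g l) (a l)) = 0"
      by (simp add: push_kernel_def mpoly_scale_def mult_single)
    then have "lookup (\<Sum>l'<card A. single (\<pi> (emb (g l'))) (to_ac (a l') * \<chi> (emb (g l')))) (\<pi> (emb (g l))) = 0"
      by (simp add: mpoly_push_sum mpoly_push_single)
    also have "lookup (\<Sum>l'<card A. single (\<pi> (emb (g l'))) (to_ac (a l') * \<chi> (emb (g l')))) (\<pi> (emb (g l)))
       = (\<Sum>l'<card A. if l' = l then to_ac (a l') * \<chi> (emb (g l')) else 0)"
    proof (unfold lookup_sum, rule sum.cong[OF refl])
      fix l' assume l': "l' \<in> {..<card A}"
      have "\<pi> (emb (g l')) = \<pi> (emb (g l)) \<longleftrightarrow> g l' = g l"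
        using assms(2) gA l l' by (auto simp: inj_on_def)
      also have "\<dots> \<longleftrightarrow> l' = l" using g l l' by (auto simp: bij_betw_def inj_on_def)
      finally show "lookup (single (\<pi> (emb (g l'))) (to_ac (a l') * \<chi> (emb (g l')))) (\<pi> (emb (g l))) =
        (if l' = l then to_ac (a l') * \<chi> (emb (g l')) else 0)"
        by (auto simp: lookup_single when_def)
    qed
    finally show "a l = 0" using l assms(3) by simp
  qed
  moreover have "mon (g l) \<in> mpoly_upto_degree s i" if "l < card A" for l
    using gA[OF that] assms(1) by (auto simp: mpoly_upto_degree_iff)
  ultimately show ?thesis by (intro dim_geI)
qed

text \<open>Multiplication by \<open>g \<in> Q - P\<close> is injective modulo the prime \<open>P\<close> and lands in \<open>Q\<close>.\<close>

lemma dim_ge_add: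
  fixes P Q :: "'k::field mpoly set"
  assumes P: "primeideal P (mpoly_ring s)" and Q: "ideal Q (mpoly_ring s)" and "P \<subseteq> Q"
    and g: "g \<in> Q" "g \<notin> P" "g \<in> mpoly_upto_degree s d"
    and "dim_ge s Q i n" "dim_ge s P j n'" "j + d \<le> i"
  shows "dim_ge s P i (n + n')"
proof -
  obtain f where f: "\<forall>l<n. f l \<in> mpoly_upto_degree s i" "indep_mod Q n f"
    using assms by (auto simp: dim_ge_def)
  obtain f' where f': "\<forall>l<n'. f' l \<in> mpoly_upto_degree s j" "indep_mod P n' f'"
    using assms by (auto simp: dim_ge_def)
  define F where "F l = (if l < n then f l else g * f' (l - n))" for l
  have "indep_mod P (n + n') F"
    unfolding indep_mod_def
  proof (intro allI impI)
    fix a l assume a: "(\<Sum>l<n + n'. mpoly_scale (a l) (F l)) \<in> P" and l: "l < n + n'"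
    define u where "u = (\<Sum>l<n. mpoly_scale (a l) (f l))"
    define v where "v = (\<Sum>l<n'. mpoly_scale (a (l + n)) (f' l))"
    have "(\<Sum>l<n + n'. mpoly_scale (a l) (F l)) = (\<Sum>l<n. mpoly_scale (a l) (F l)) + (\<Sum>l\<in>{n..<n + n'}. mpoly_scale (a l) (F l))"
      using sum.atLeastLessThan_concat[of 0 n "n + n'" "\<lambda>l. mpoly_scale (a l) (F l)"] by (simp add: atLeast0LessThan)
    also have "(\<Sum>l\<in>{n..<n + n'}. mpoly_scale (a l) (F l)) = (\<Sum>l\<in>{0..<n'}. mpoly_scale (a (l + n)) (F (l + n)))"
      using sum.shift_bounds_nat_ivl[of "\<lambda>l. mpoly_scale (a l) (F l)" 0 n n'] by (simp add: add.commute)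
    also have "\<dots> = g * v"
      unfolding v_def sum_distrib_left atLeast0LessThan by (rule sum.cong[OF refl]) (simp add: F_def mpoly_scale_def ac_simps)
    also have "(\<Sum>l<n. mpoly_scale (a l) (F l)) = u"
      unfolding u_def by (rule sum.cong[OF refl]) (simp add: F_def)
    finally have uv: "u + g * v \<in> P" using a by simp
    have v_carr: "v \<in> pcarrier s" unfolding v_def mpoly_scale_def
      using f'(1) by (intro pcarrier_sum cring_closed(2) pcarrier_single) (auto dest: mpoly_upto_degree_carrier)
    have g_carr: "g \<in> pcarrier s" using g(3) by (rule mpoly_upto_degree_carrier)
    \<comment> \<open>Modulo \<open>Q\<close> only the first block survives, so its coefficients
      vanish. What remains is \<open>g * v\<close> in \<open>P\<close>, and primality with
      \<open>g\<close> outside \<open>P\<close> puts \<open>v\<close> into \<open>P\<close>.\<close>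
    have "g * v \<in> Q" using ideal_mpolyD(4)[OF Q g(1) v_carr] by (simp add: mult.commute)
    then have "u \<in> Q" using ideal_mpolyD(6)[OF Q, of "u + g * v" "g * v"] uv \<open>P \<subseteq> Q\<close> by auto
    then have a1: "\<forall>l<n. a l = 0" using indep_modD[OF f(2)] unfolding u_def by blast
    then have "u = 0" by (simp add: u_def mpoly_scale_def)
    then have "v \<in> P" using primeideal_mpolyD(3)[OF P g_carr v_carr] uv g(2) by simp
    then have a2: "\<forall>l<n'. a (l + n) = 0" using indep_modD[OF f'(2), of "\<lambda>l. a (l + n)"] unfolding v_def by blast
    show "a l = 0"
    proof (cases "l < n")
      case False
      then show ?thesis using a2[rule_format, of "l - n"] l by simp
    qed (use a1 in simp)
  qed
  moreover have "F l \<in> mpoly_upto_degree s i" if "l < n + n'" for l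
  proof (cases "l < n")
    case True
    then show ?thesis using f(1) by (simp add: F_def)
  next
    case False
    then have "g * f' (l - n) \<in> mpoly_upto_degree s (d + j)"
      using that f'(1) g(3) by (intro mpoly_upto_degree_mult) auto
    then show ?thesis using False mpoly_upto_degree_mono[of "d + j" i s] assms(9) by (auto simp: F_def add.commute)
  qed
  ultimately show ?thesis by (intro dim_geI)
qed

text \<open>The induction is Pascal's rule: degree \<open>d * Suc m\<close> contributes the elements
  independent modulo \<open>Q\<close> together with \<open>g\<close> times those already found in
  degree \<open>d * m\<close>.\<close>

lemma growth_step:
  fixes P Q :: "'k::field mpoly set"
  assumes P: "primeideal P (mpoly_ring s)" and Q: "ideal Q (mpoly_ring s)" and "P \<subseteq> Q"
    and g: "g \<in> Q" "g \<notin> P" "g \<in> mpoly_upto_degree s d"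
    and growth: "\<And>m. dim_ge s Q (d * m) ((m + e) choose e)"
  shows "dim_ge s P (d * m) ((m + Suc e) choose Suc e)"
proof (induction m)
  case 0
  show ?case using dim_ge_antimono[OF growth[of 0] \<open>P \<subseteq> Q\<close>, of 0] by simp
next
  case (Suc m)
  have "dim_ge s P (d * Suc m) (((Suc m + e) choose e) + ((m + Suc e) choose Suc e))"
    by (rule dim_ge_add[OF P Q \<open>P \<subseteq> Q\<close> g growth Suc]) simp
  then show ?case by simp
qed

text \<open>Each inclusion has its own separating polynomial; the scales add up to one
  \<open>d\<close> that works along the whole chain.\<close>

lemma chain_growth:
  fixes Q :: "nat \<Rightarrow> 'k::field mpoly set"
  assumes "prime_chain (mpoly_ring s) n Q" "\<And>m. dim_ge s (Q n) m ((m + e) choose e)"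
  shows "\<exists>d. \<forall>m. dim_ge s (Q 0) (d * m) ((m + (e + n)) choose (e + n))"
  using assms
proof (induction n arbitrary: Q)
  case 0
  show ?case by (rule exI[of _ 1]) (use 0(2) in simp)
next
  case (Suc n)
  have "prime_chain (mpoly_ring s) n (\<lambda>i. Q (Suc i))"
    using Suc.prems(1) by (auto simp: prime_chain_def)
  from Suc.IH[OF this] Suc.prems(2) obtain d where d: "\<And>m. dim_ge s (Q 1) (d * m) ((m + (e + n)) choose (e + n))"
    by auto
  have P: "primeideal (Q 0) (mpoly_ring s)" "primeideal (Q 1) (mpoly_ring s)" "Q 0 \<subset> Q 1"
    using Suc.prems(1) by (auto simp: prime_chain_def)
  obtain g where g: "g \<in> Q 1" "g \<notin> Q 0" using P(3) by blast
  note Q1 = primeideal_mpolyD(1)[OF P(2)]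
  obtain d' where d': "g \<in> mpoly_upto_degree s d'"
    using ex_mpoly_upto_degree g(1) ideal_mpolyD(1)[OF Q1] by blast
  let ?d = "d + d'"
  have "dim_ge s (Q 1) (?d * m) ((m + (e + n)) choose (e + n))" for m
    using dim_ge_antimono[OF d[of m] subset_refl, of "?d * m"] by (simp add: add_mult_distrib)
  moreover have "g \<in> mpoly_upto_degree s ?d" using d' mpoly_upto_degree_mono[of d' ?d s] by auto
  ultimately have "dim_ge s (Q 0) (?d * m) ((m + Suc (e + n)) choose Suc (e + n))" for m
    using growth_step[OF P(1) Q1 _ g] P(3) by blast
  then show ?case by auto
qed

text \<open>Each step down the chain raises the growth exponent by one, and the count of images of
  monomials bounds the exponent at the bottom. It is applied with \<open>\<rho>\<close> the identity
  for heights, and with cosets for primes over the lattice ideal.\<close>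

lemma prime_chain_growth_bound:
  fixes Q :: "nat \<Rightarrow> 'k::field mpoly set" and \<rho> :: "(nat \<Rightarrow>\<^sub>0 nat) \<Rightarrow> 'b"
  assumes "prime_chain (mpoly_ring s) n Q" "\<And>m. dim_ge s (Q n) m ((m + e) choose e)"
    and "\<And>f. f \<in> pcarrier s \<Longrightarrow> push (\<lambda>x. x) \<rho> (\<lambda>_. 1) f = 0 \<Longrightarrow> f \<in> Q 0"
    and "\<And>i. card (\<rho> ` monomials {..<s} i) \<le> A * (i + 1) ^ k"
  shows "e + n \<le> k"
proof -
  obtain d where d: "\<And>m. dim_ge s (Q 0) (d * m) ((m + (e + n)) choose (e + n))"
    using chain_growth[OF assms(1,2)] by auto
  have "(m + (e + n)) choose (e + n) \<le> A * (d * m + 1) ^ k" for m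
    using dim_ge_bound[OF d assms(3)] assms(4)[of "d * m"] by (meson order.trans)
  then show ?thesis by (rule binomial_growth_exponent)
qed

text \<open>Growth exponent 0, available for every prime; it serves chains whose largest member is
  arbitrary.\<close>

lemma dim_ge_prime:
  assumes "primeideal P (mpoly_ring s :: 'k::field mpoly ring)"
  shows "dim_ge s P m 1"
proof -
  have "indep_mod P 1 (\<lambda>_. 1)"
    unfolding indep_mod_def
  proof (intro allI impI)
    fix a :: "nat \<Rightarrow> 'k" and l :: nat
    assume a: "(\<Sum>l<1. mpoly_scale (a l) 1) \<in> P" and "l < 1"
    show "a l = 0"
    proof (rule ccontr)
      assume "a l \<noteq> 0"
      then have "single 0 (inverse (a 0)) * single 0 (a 0) = (1 :: 'k mpoly)"
        using \<open>l < 1\<close> by (simp add: mult_single)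
      moreover have "single 0 (a 0) \<in> P" using a by (simp add: mpoly_scale_def)
      ultimately have "1 \<in> P"
        using ideal_mpolyD(4)[OF primeideal_mpolyD(1)[OF assms], of "single 0 (a 0)" "single 0 (inverse (a 0))"]
        by (simp add: pcarrier_single)
      then show False using primeideal_mpolyD(2)[OF assms] by simp
    qed
  qed
  moreover have "1 \<in> mpoly_upto_degree s m" by (simp add: mpoly_upto_degree_iff monomials_def)
  ultimately show ?thesis by (intro dim_geI)
qed

lemma card_image_le_of_factor:
  assumes "finite A" "\<And>x y. x \<in> A \<Longrightarrow> y \<in> A \<Longrightarrow> G x = G y \<Longrightarrow> F x = F y"
  shows "card (F ` A) \<le> card (G ` A)"
proof -
  have "F x = F (inv_into A G (G x))" if "x \<in> A" for x
    using assms(2)[of x "inv_into A G (G x)"] that by (simp add: inv_into_into f_inv_into_f)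
  then have "F ` A = (\<lambda>u. F (inv_into A G u)) ` G ` A" by (auto simp: image_iff)
  then show ?thesis using assms(1) by (metis card_image_le finite_imageI)
qed

section \<open>Free variables, the number of classes in bounded degree, and heights\<close>

context adapted_basis
begin

definition unit_var :: "nat \<Rightarrow> nat" where
  "unit_var l = (SOME j. j < s \<and> b l = single j 1)"

lemma unit_var: "r \<le> l \<Longrightarrow> l < s \<Longrightarrow> unit_var l < s \<and> b l = single (unit_var l) 1"
  unfolding unit_var_def by (rule someI_ex) (use b_unit in blast)

text \<open>The variables whose exponents are the coordinates of the torsion-free part of \<open>\<int>\<^sup>s/L\<close>.\<close>

definition free_vars :: "nat set" where
  "free_vars = unit_var ` {r..<s}"

lemma unit_var_inj: "inj_on unit_var {r..<s}"
proof (rule inj_onI)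
  fix l l' assume "l \<in> {r..<s}" "l' \<in> {r..<s}" "unit_var l = unit_var l'"
  then have "b l = b l'" "l < s" "l' < s" using unit_var by auto
  then show "l = l'" using c_b[of l l] c_b[of l l'] by (auto split: if_splits)
qed

lemma card_free_vars: "card free_vars = s - r"
  unfolding free_vars_def by (simp add: card_image[OF unit_var_inj])

lemma free_vars_sub: "free_vars \<subseteq> {..<s}"
  using unit_var by (auto simp: free_vars_def)

lemma c_emb:
  assumes "keys m \<subseteq> {..<s}"
  shows "c l (emb m) = (\<Sum>j<s. of_nat (lookup m j) * c l (single j 1))"
proof -
  have "emb m = (\<Sum>j<s. frag_cmul (int (lookup m j)) (single j 1))"
  proof (rule poly_mapping_eqI)
    fix k
    have "lookup m k = 0" if "\<not> k < s" using assms that by (auto simp: in_keys_iff)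
    then show "lookup (emb m) k = lookup (\<Sum>j<s. frag_cmul (int (lookup m j)) (single j 1)) k"
      by (auto simp: lookup_sum lookup_single when_def if_distrib cong: if_cong)
  qed
  then show ?thesis by (simp add: c_sum c_cmul)
qed

text \<open>\<open>b l\<close> is the unit vector of the variable \<open>unit_var l\<close>, so on
  the free variables these coordinates are dual to the exponents.\<close>

lemma c_emb_free_vars:
  assumes "keys m \<subseteq> free_vars" "r \<le> l" "l < s"
  shows "c l (emb m) = of_nat (lookup m (unit_var l))"
proof -
  have "c l (emb m) = (\<Sum>j<s. of_nat (lookup m j) * c l (single j 1))"
    using assms free_vars_sub by (intro c_emb) blast
  also have "\<dots> = (\<Sum>j<s. if j = unit_var l then of_nat (lookup m j) else 0)"
  proof (rule sum.cong[OF refl])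
    fix j assume "j \<in> {..<s}"
    show "of_nat (lookup m j) * c l (single j 1) = (if j = unit_var l then of_nat (lookup m j) else 0)"
    proof (cases "j \<in> free_vars")
      case True
      then obtain l' where l': "r \<le> l'" "l' < s" "j = unit_var l'" by (auto simp: free_vars_def)
      then have "c l (single j 1) = (if l = l' then 1 else 0)"
        using c_b[OF assms(3) l'(2)] unit_var by simp
      moreover have "j = unit_var l \<longleftrightarrow> l = l'" using l' assms unit_var_inj by (auto simp: inj_on_def)
      ultimately show ?thesis by simp
    next
      case False
      then have "lookup m j = 0" using assms(1) by (auto simp: in_keys_iff)
      then show ?thesis by (simp only: of_nat_0 mult_zero_left if_cancel)
    qed
  qed
  also have "\<dots> = of_nat (lookup m (unit_var l))"
    using unit_var[OF assms(2,3)] by simp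
  finally show ?thesis .
qed

lemma free_vars_eqI:
  assumes "keys m \<subseteq> free_vars" "keys n \<subseteq> free_vars"
    "\<And>l. r \<le> l \<Longrightarrow> l < s \<Longrightarrow> c l (emb m) = c l (emb n)"
  shows "m = n"
proof (rule poly_mapping_eqI)
  fix j
  show "lookup m j = lookup n j"
  proof (cases "j \<in> free_vars")
    case True
    then obtain l where "r \<le> l" "l < s" "j = unit_var l" by (auto simp: free_vars_def)
    then show ?thesis using assms(3)[of l] assms(1,2) by (simp add: c_emb_free_vars)
  next
    case False
    then show ?thesis using assms(1,2) by (metis in_keys_iff subsetD)
  qed
qed

lemma inj_proj_free_vars: "inj_on (\<lambda>m. proj r (emb m)) (monomials free_vars i)"
  by (rule inj_onI, rule free_vars_eqI) (auto simp: monomials_def proj_eq_iff)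

text \<open>Monomials in the \<open>s - r\<close> free variables have distinct images modulo
  \<open>M\<close>, which gives as many independent elements as a polynomial ring in
  \<open>s - r\<close> variables has monomials.\<close>

lemma dim_ge_Qp:
  assumes "character \<chi>"
  shows "dim_ge s (Qp r \<chi>) m ((m + (s - r)) choose (s - r))"
proof -
  have "finite free_vars" by (simp add: free_vars_def)
  then have "card (monomials free_vars m) = (m + (s - r)) choose (s - r)" by (simp add: card_monomials card_free_vars)
  moreover have "monomials free_vars m \<subseteq> monomials {..<s} m" using free_vars_sub by (rule monomials_mono) simp
  ultimately show ?thesis
    using dim_ge_push_kernel[OF _ inj_proj_free_vars[of m], of s m \<chi>] characterD(2)[OF assms] by (simp add: Qp_def)
qed

text \<open>This turns out to be the affine Hilbert function of the lattice ideal, over every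
  field.\<close>

definition class_count :: "nat \<Rightarrow> nat" where
  "class_count i = card ((\<lambda>m. lat_class (emb m)) ` monomials {..<s} i)"

text \<open>A class is determined by the exponents modulo \<open>N\<close> and the
  \<open>s - r\<close> integers \<open>N * c l\<close>. There are finitely many residues, and the
  integers are linear in the exponents, so each takes O(i) values.\<close>

lemma class_count_le: "\<exists>A. \<forall>i. class_count i \<le> A * (i + 1) ^ (s - r)"
proof -
  define z where "z l m = (THE z. of_nat N * c l (emb m) = of_int z)" for l m
  have z: "of_nat N * c l (emb m) = of_int (z l m)" if "keys m \<subseteq> {..<s}" "l < s" for l m
  proof -
    have "\<exists>z. of_nat N * c l (emb m) = of_int z" using c_denom[of "emb m"] that by auto
    then have "\<exists>!z. of_nat N * c l (emb m) = of_int z" by auto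
    then show ?thesis unfolding z_def by (rule theI')
  qed
  \<comment> \<open>A crude bound: the sum of all absolute values dominates each scaled coordinate
    of a unit vector.\<close>
  define W where "W = (\<Sum>l<s. \<Sum>j<s. \<bar>of_nat N * c l (single j 1)\<bar>)"
  define Z where "Z = nat (ceiling W)"
  have W: "\<bar>of_nat N * c l (single j 1)\<bar> \<le> of_nat Z" if "l < s" "j < s" for l j
  proof -
    have "\<bar>of_nat N * c l (single j 1)\<bar> \<le> (\<Sum>j<s. \<bar>of_nat N * c l (single j 1)\<bar>)"
      using that by (intro member_le_sum) auto
    also have "\<dots> \<le> W"
      unfolding W_def using that by (intro member_le_sum[where f = "\<lambda>l. \<Sum>j<s. \<bar>of_nat N * c l (single j 1)\<bar>"] sum_nonneg) auto
    also have "\<dots> \<le> of_nat Z" unfolding Z_def by (rule of_nat_ceiling)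
    finally show ?thesis .
  qed
  have zb: "\<bar>z l m\<bar> \<le> int (Z * i)" if m: "m \<in> monomials {..<s} i" and l: "l < s" for l m i
  proof -
    have k: "keys m \<subseteq> {..<s}" and d: "mdeg m \<le> i" using m by (auto simp: monomials_def)
    have "\<bar>rat_of_int (z l m)\<bar> = \<bar>\<Sum>j<s. of_nat (lookup m j) * (of_nat N * c l (single j 1))\<bar>"
      unfolding z[OF k l, symmetric] c_emb[OF k] by (simp add: sum_distrib_left ac_simps)
    also have "\<dots> \<le> (\<Sum>j<s. \<bar>of_nat (lookup m j) * (of_nat N * c l (single j 1))\<bar>)"
      by (rule sum_abs)
    also have "\<dots> \<le> (\<Sum>j<s. of_nat (lookup m j) * of_nat Z)"
      unfolding abs_mult[of "of_nat (lookup m _)"] using W[OF l] by (intro sum_mono mult_mono) auto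
    also have "\<dots> = of_nat (mdeg m * Z)"
      using k by (simp add: mdeg_superset[of "{..<s}"] sum_distrib_right)
    also have "\<dots> \<le> of_nat (Z * i)" using d by (simp only: of_nat_le_iff) (simp add: mult.commute)
    finally have "rat_of_int \<bar>z l m\<bar> \<le> rat_of_int (int (Z * i))" by simp
    then show ?thesis by (simp only: of_int_le_iff)
  qed
  have "class_count i \<le> (N ^ s * (2 * Z + 1) ^ (s - r)) * (i + 1) ^ (s - r)" for i
  proof -
    define G where "G m = (restrict (\<lambda>j. lookup m j mod N) {..<s}, restrict (\<lambda>l. z l m) {r..<s})" for m
    let ?T = "PiE {..<s} (\<lambda>_. {..<N}) \<times> PiE {r..<s} (\<lambda>_. {- int (Z * i)..int (Z * i)})"
    have "class_count i \<le> card (G ` monomials {..<s} i)"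
      unfolding class_count_def
    proof (rule card_image_le_of_factor)
      show "finite (monomials {..<s} i)" by (simp add: finite_monomials)
      fix m n assume mn: "m \<in> monomials {..<s} i" "n \<in> monomials {..<s} i" "G m = G n"
      have k: "keys m \<subseteq> {..<s}" "keys n \<subseteq> {..<s}" using mn by (auto simp: monomials_def)
      have "emb m - emb n \<in> L"
      proof (rule M_eqI_mod_N)
        fix l assume l: "r \<le> l" "l < s"
        have "z l m = z l n" using fun_cong[OF arg_cong[OF mn(3), of snd], of l] l by (simp add: G_def)
        then have "of_nat N * c l (emb m) = of_nat N * c l (emb n)" using z[OF k(1) l(2)] z[OF k(2) l(2)] by simp
        then show "c l (emb m) = c l (emb n)" using N_pos by simp
      next
        fix j assume j: "j < s"
        have "lookup m j mod N = lookup n j mod N"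
          using fun_cong[OF arg_cong[OF mn(3), of fst], of j] j by (simp add: G_def)
        then show "lookup (emb m) j mod int N = lookup (emb n) j mod int N"
          by (simp flip: zmod_int)
      qed (use k in auto)
      then show "lat_class (emb m) = lat_class (emb n)" by (simp add: lat_class_eq_iff)
    qed
    also have "\<dots> \<le> card ?T"
    proof (rule card_mono)
      show "finite ?T" by (intro finite_cartesian_product finite_PiE) auto
      show "G ` monomials {..<s} i \<subseteq> ?T"
      proof
        fix x assume "x \<in> G ` monomials {..<s} i"
        then obtain m where m: "m \<in> monomials {..<s} i" "x = G m" by blast
        have "z l m \<in> {- int (Z * i)..int (Z * i)}" if "l < s" for l
          using zb[OF m(1) that] by (auto simp only: atLeastAtMost_iff abs_le_iff)
        then show "x \<in> ?T" unfolding m(2) G_def using N_pos by auto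
      qed
    qed
    also have "\<dots> = N ^ s * (2 * (Z * i) + 1) ^ (s - r)"
    proof -
      have "nat (1 + int (Z * i) + int (Z * i)) = 2 * (Z * i) + 1" by linarith
      then show ?thesis by (simp add: card_cartesian_product card_PiE del: of_nat_mult)
    qed
    also have "\<dots> \<le> N ^ s * ((2 * Z + 1) * (i + 1)) ^ (s - r)"
      by (intro mult_left_mono power_mono) (auto simp: algebra_simps)
    finally show ?thesis by (simp only: power_mult_distrib mult.assoc)
  qed
  then show ?thesis by blast
qed

lemma push_class_imp_lattice_ideal:
  assumes "f \<in> pcarrier s" "push (\<lambda>x. x) (\<lambda>m. lat_class (emb m)) (\<lambda>_. 1) f = 0"
  shows "f \<in> lattice_ideal s L"
  using assms by (simp add: lattice_ideal_iff mpoly_push_def push_to_ac_eq_0_iff)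

lemma prime_chain_bound_lattice_ideal:
  fixes Q :: "nat \<Rightarrow> 'k::field mpoly set"
  assumes "prime_chain (mpoly_ring s) n Q" "lattice_ideal s L \<subseteq> Q 0"
    and "\<And>m. dim_ge s (Q n) m ((m + e) choose e)"
  shows "e + n \<le> s - r"
proof -
  obtain A where "\<And>i. class_count i \<le> A * (i + 1) ^ (s - r)" using class_count_le by blast
  then show ?thesis
    using prime_chain_growth_bound[OF assms(1,3), of "\<lambda>m. lat_class (emb m)" A "s - r"]
      push_class_imp_lattice_ideal assms(2) by (auto simp: class_count_def)
qed

text \<open>A proper inclusion would raise the growth exponent from \<open>s - r\<close> to
  \<open>s - r + 1\<close>, above the bound for primes that contain the lattice ideal.\<close>

lemma Qp_incomparable:
  assumes "character \<chi>" "primeideal P (mpoly_ring s :: 'k::field mpoly ring)" "lattice_ideal s L \<subseteq> P" "P \<subseteq> Qp r \<chi>"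
  shows "P = Qp r \<chi>"
proof (rule ccontr)
  assume ne: "P \<noteq> Qp r \<chi>"
  define Q where "Q i = (if i = 0 then P else Qp r \<chi>)" for i :: nat
  have "prime_chain (mpoly_ring s) 1 Q"
    using assms ne primeideal_Qp[OF assms(1)] by (auto simp: prime_chain_def Q_def)
  from prime_chain_bound_lattice_ideal[OF this _ ] dim_ge_Qp[OF assms(1)] assms(3)
  have "s - r + 1 \<le> s - r" by (auto simp: Q_def)
  then show False by simp
qed

lemma prime_chain_Qp:
  assumes "character \<chi>" "j + n \<le> s" "\<And>l. j \<le> l \<Longrightarrow> l < j + n \<Longrightarrow> \<chi> (b l) = 1"
  shows "prime_chain (mpoly_ring s) n (\<lambda>i. Qp (j + i) \<chi>)"
  using assms Qp_strict[OF assms(1)] primeideal_Qp[OF assms(1)] by (auto simp: prime_chain_def)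

text \<open>The primes \<open>Qp i \<chi>\<close> with i \<le> r form a chain of length
  \<open>r\<close>. No chain is longer, because its top already has growth exponent
  \<open>s - r\<close> and the whole polynomial ring has exponent \<open>s\<close>.\<close>

lemma prime_height_Qp:
  assumes \<chi>: "character \<chi>" "\<And>x. x \<in> L \<Longrightarrow> \<chi> x = 1"
  shows "prime_height (mpoly_ring s) (Qp r \<chi>) = enat r"
  unfolding prime_height_def
proof (rule antisym)
  have "prime_chain (mpoly_ring s) r (\<lambda>i. Qp (0 + i) \<chi>)"
    using \<chi> b_L r_le by (intro prime_chain_Qp) auto
  then show "enat r \<le> Sup {enat n |n. \<exists>Q. prime_chain (mpoly_ring s) n Q \<and> Q n = Qp r \<chi>}"
    by (intro Sup_upper) (auto intro!: exI[of _ "\<lambda>i. Qp i \<chi>"])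
  show "Sup {enat n |n. \<exists>Q. prime_chain (mpoly_ring s) n Q \<and> Q n = Qp r \<chi>} \<le> enat r"
  proof (rule Sup_least)
    fix x assume "x \<in> {enat n |n. \<exists>Q. prime_chain (mpoly_ring s) n Q \<and> Q n = Qp r \<chi>}"
    then obtain n Q where x: "x = enat n" and Q: "prime_chain (mpoly_ring s) n Q" "Q n = Qp r \<chi>" by blast
    have 0: "0 \<in> Q 0"
      using Q(1) ideal_mpolyD(2)[OF primeideal_mpolyD(1)[of "Q 0" s]] by (auto simp: prime_chain_def)
    have "(s - r) + n \<le> s"
    \<comment> \<open>With \<open>\<rho>\<close> the identity only 0 is pushed to 0, so the
      comparison is with all of S.\<close>
    proof (rule prime_chain_growth_bound[OF Q(1), where \<rho> = "\<lambda>m. m" and A = 1])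
      show "dim_ge s (Q n) m ((m + (s - r)) choose (s - r))" for m
        unfolding Q(2) by (rule dim_ge_Qp[OF \<chi>(1)])
      show "f \<in> Q 0" if "push (\<lambda>x. x) (\<lambda>m. m) (\<lambda>_. 1) f = 0" for f
        using that 0 by (simp add: push_def sum_keys_single)
      show "card ((\<lambda>m. m) ` monomials {..<s} i) \<le> 1 * (i + 1) ^ s" for i
        using binomial_le_power[of i s] by (simp add: card_monomials)
    qed
    then show "x \<le> enat r" using x r_le by simp
  qed
qed

end

section \<open>Characters\<close>

definition add_subgroup :: "(nat \<Rightarrow>\<^sub>0 int) set \<Rightarrow> bool" where
  "add_subgroup A \<longleftrightarrow> 0 \<in> A \<and> (\<forall>x\<in>A. \<forall>y\<in>A. x - y \<in> A)"

lemma add_subgroupD: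
  assumes "add_subgroup A"
  shows "0 \<in> A" "x \<in> A \<Longrightarrow> y \<in> A \<Longrightarrow> x - y \<in> A" "x \<in> A \<Longrightarrow> - x \<in> A"
    "x \<in> A \<Longrightarrow> y \<in> A \<Longrightarrow> x + y \<in> A"
proof -
  show 0: "0 \<in> A" and d: "\<And>x y. x \<in> A \<Longrightarrow> y \<in> A \<Longrightarrow> x - y \<in> A" using assms by (auto simp: add_subgroup_def)
  show n: "- x \<in> A" if "x \<in> A" for x using d[OF 0 that] by simp
  show "x \<in> A \<Longrightarrow> y \<in> A \<Longrightarrow> x + y \<in> A" using d[of x "- y"] n[of y] by simp
qed

lemma add_subgroup_cmul: "add_subgroup A \<Longrightarrow> x \<in> A \<Longrightarrow> frag_cmul n x \<in> A"
proof (cases n)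
  assume A: "add_subgroup A" "x \<in> A"
  have nn: "frag_cmul (int n) x \<in> A" for n
    using A by (induction n) (auto simp: frag_cmul_distrib add_subgroupD)
  {
    case (nonneg n)
    then show ?thesis using nn by simp
  next
    case (neg n)
    then show ?thesis using add_subgroupD(3)[OF A(1) nn[of "Suc n"]] by simp
  }
qed

lemma add_subgroup_sum: "add_subgroup A \<Longrightarrow> (\<And>x. x \<in> B \<Longrightarrow> f x \<in> A) \<Longrightarrow> sum f B \<in> A"
  by (induction B rule: infinite_finite_induct) (auto intro: add_subgroupD)

text \<open>A function on the whole type of which only the values on \<open>A\<close> are
  constrained, so that a character can be extended generator by generator.\<close>

definition char_on :: "(nat \<Rightarrow>\<^sub>0 int) set \<Rightarrow> ((nat \<Rightarrow>\<^sub>0 int) \<Rightarrow> 'e::field) \<Rightarrow> bool" where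
  "char_on A \<chi> \<longleftrightarrow> (\<forall>x\<in>A. \<forall>y\<in>A. \<chi> (x + y) = \<chi> x * \<chi> y) \<and> (\<forall>x\<in>A. \<chi> x \<noteq> 0)"

lemma char_onD:
  assumes "char_on A \<chi>"
  shows "x \<in> A \<Longrightarrow> y \<in> A \<Longrightarrow> \<chi> (x + y) = \<chi> x * \<chi> y" "x \<in> A \<Longrightarrow> \<chi> x \<noteq> 0"
  using assms by (auto simp: char_on_def)

lemma char_on_zero: "add_subgroup A \<Longrightarrow> char_on A \<chi> \<Longrightarrow> \<chi> 0 = 1"
  using char_onD(1)[of A \<chi> 0 0] char_onD(2)[of A \<chi> 0] add_subgroupD(1)[of A] by simp

lemma char_on_uminus:
  assumes "add_subgroup A" "char_on A \<chi>" "x \<in> A"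
  shows "\<chi> (- x) = inverse (\<chi> x)"
  using char_onD(1)[OF assms(2,3) add_subgroupD(3)[OF assms(1,3)]] char_on_zero[OF assms(1,2)]
  by (metis add.right_inverse inverse_unique)

lemma char_on_diff:
  assumes "add_subgroup A" "char_on A \<chi>" "x \<in> A" "y \<in> A"
  shows "\<chi> (x - y) = \<chi> x / \<chi> y"
  using char_onD(1)[OF assms(2,3) add_subgroupD(3)[OF assms(1,4)]] char_on_uminus[OF assms(1,2,4)]
  by (simp add: field_simps)

lemma char_on_cmul_nat:
  assumes "add_subgroup A" "char_on A \<chi>" "x \<in> A"
  shows "\<chi> (frag_cmul (int n) x) = \<chi> x ^ n"
proof (induction n)
  case 0
  then show ?case using char_on_zero assms by simp
next
  case (Suc n)
  have "frag_cmul (int (Suc n)) x = x + frag_cmul (int n) x" by (simp add: frag_cmul_distrib)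
  then show ?case using char_onD(1)[OF assms(2,3) add_subgroup_cmul[OF assms(1,3)]] Suc by simp
qed

lemma char_on_cmul:
  assumes "add_subgroup A" "char_on A \<chi>" "x \<in> A"
  shows "\<chi> (frag_cmul n x) = \<chi> x powi n"
proof (cases n)
  case (nonneg n)
  then show ?thesis using char_on_cmul_nat[OF assms] by simp
next
  case (neg n)
  have "\<chi> (frag_cmul (- int (Suc n)) x) = inverse (\<chi> (frag_cmul (int (Suc n)) x))"
    using char_on_uminus[OF assms(1,2) add_subgroup_cmul[OF assms(1,3)], of "int (Suc n)"] by simp
  also have "\<dots> = \<chi> x powi (- int (Suc n))"
    unfolding char_on_cmul_nat[OF assms] power_int_minus power_int_of_nat ..
  finally show ?thesis unfolding neg .
qed

lemma char_on_subset: "char_on B \<chi> \<Longrightarrow> A \<subseteq> B \<Longrightarrow> char_on A \<chi>"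
  by (auto simp: char_on_def)

lemma char_on_cong: "add_subgroup A \<Longrightarrow> (\<And>x. x \<in> A \<Longrightarrow> \<chi> x = \<chi>' x) \<Longrightarrow> char_on A \<chi> \<longleftrightarrow> char_on A \<chi>'"
  unfolding char_on_def using add_subgroupD(4)[of A] by simp

section \<open>Extending characters by one generator\<close>

definition adjoin :: "(nat \<Rightarrow>\<^sub>0 int) set \<Rightarrow> (nat \<Rightarrow>\<^sub>0 int) \<Rightarrow> (nat \<Rightarrow>\<^sub>0 int) set" where
  "adjoin A x = {a + frag_cmul n x | a n. a \<in> A}"

lemma add_subgroup_adjoin:
  assumes "add_subgroup A"
  shows "add_subgroup (adjoin A x)" "A \<subseteq> adjoin A x" "x \<in> adjoin A x"
proof -
  have "a \<in> adjoin A x" if "a \<in> A" for a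
    using that unfolding adjoin_def by (intro CollectI exI[of _ a] exI[of _ 0]) simp
  then show sub: "A \<subseteq> adjoin A x" by blast
  show "x \<in> adjoin A x"
    using add_subgroupD(1)[OF assms] unfolding adjoin_def by (intro CollectI exI[of _ 0] exI[of _ 1]) simp
  have "(a + frag_cmul n x) - (a' + frag_cmul n' x) \<in> adjoin A x" if "a \<in> A" "a' \<in> A" for a a' n n'
    using add_subgroupD(2)[OF assms that] unfolding adjoin_def
    by (intro CollectI exI[of _ "a - a'"] exI[of _ "n - n'"]) (simp add: frag_cmul_diff_distrib)
  then show "add_subgroup (adjoin A x)"
    using sub add_subgroupD(1)[OF assms] unfolding add_subgroup_def by (force simp: adjoin_def)
qed

lemma adjoin_least: "add_subgroup B \<Longrightarrow> A \<subseteq> B \<Longrightarrow> x \<in> B \<Longrightarrow> adjoin A x \<subseteq> B"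
  by (auto simp: adjoin_def intro: add_subgroupD add_subgroup_cmul)

lemma char_on_adjoin_eval:
  assumes "add_subgroup A" "char_on (adjoin A x) \<chi>" "a \<in> A"
  shows "\<chi> (a + frag_cmul n x) = \<chi> a * \<chi> x powi n"
  using char_onD(1)[OF assms(2)] char_on_cmul[OF add_subgroup_adjoin(1)[OF assms(1)] assms(2)]
    add_subgroup_adjoin[OF assms(1), of x] add_subgroup_cmul[OF add_subgroup_adjoin(1)[OF assms(1)]] assms(3)
  by (metis subsetD)

lemma char_on_adjoin_extension:
  assumes A: "add_subgroup A" "char_on A \<chi>" and y: "(y :: 'e::field) \<noteq> 0"
    and comp: "\<And>n. frag_cmul n x \<in> A \<Longrightarrow> \<chi> (frag_cmul n x) = y powi n"
  shows "\<exists>\<chi>'. char_on (adjoin A x) \<chi>' \<and> (\<forall>a\<in>A. \<chi>' a = \<chi> a) \<and> \<chi>' x = y"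
proof -
  \<comment> \<open>Any decomposition of \<open>z\<close> may be chosen: two of them differ by a
    multiple of \<open>x\<close> in \<open>A\<close>, where \<open>comp\<close> makes the values
    agree.\<close>
  define \<chi>' where "\<chi>' z = (SOME w. \<exists>a\<in>A. \<exists>n. z = a + frag_cmul n x \<and> w = \<chi> a * y powi n)" for z
  have val: "\<chi>' (a + frag_cmul n x) = \<chi> a * y powi n" if a: "a \<in> A" for a n
  proof -
    let ?P = "\<lambda>w. \<exists>a'\<in>A. \<exists>n'. a + frag_cmul n x = a' + frag_cmul n' x \<and> w = \<chi> a' * y powi n'"
    have "?P (\<chi>' (a + frag_cmul n x))"
      unfolding \<chi>'_def by (rule someI_ex) (use a in blast)
    then obtain a' n' where a': "a' \<in> A" "a + frag_cmul n x = a' + frag_cmul n' x" "\<chi>' (a + frag_cmul n x) = \<chi> a' * y powi n'"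
      by blast
    have eq: "frag_cmul (n' - n) x = a - a'"
      using a'(2) by (simp add: frag_cmul_diff_distrib algebra_simps)
    have in_A: "a - a' \<in> A" by (rule add_subgroupD(2)[OF A(1) a a'(1)])
    have "\<chi> a = \<chi> (a' + (a - a'))" by simp
    also have "\<dots> = \<chi> a' * \<chi> (a - a')" by (rule char_onD(1)[OF A(2) a'(1) in_A])
    also have "\<chi> (a - a') = y powi (n' - n)" using comp[of "n' - n"] in_A eq by simp
    finally have "\<chi> a * y powi n = \<chi> a' * (y powi (n' - n) * y powi n)" by simp
    also have "y powi (n' - n) * y powi n = y powi n'"
      using y by (simp flip: power_int_add)
    finally show ?thesis using a'(3) by simp
  qed
  have "char_on (adjoin A x) \<chi>'"
    unfolding char_on_def
  proof (intro conjI ballI)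
    fix z z' assume "z \<in> adjoin A x" "z' \<in> adjoin A x"
    then obtain a n a' n' where z: "a \<in> A" "z = a + frag_cmul n x" "a' \<in> A" "z' = a' + frag_cmul n' x"
      by (auto simp: adjoin_def)
    have "z + z' = (a + a') + frag_cmul (n + n') x" by (simp add: z frag_cmul_distrib)
    then have "\<chi>' (z + z') = \<chi> (a + a') * y powi (n + n')"
      using val[OF add_subgroupD(4)[OF A(1) z(1,3)]] by simp
    also have "\<dots> = \<chi>' z * \<chi>' z'"
      using z y char_onD(1)[OF A(2) z(1,3)] val by (simp add: power_int_add)
    finally show "\<chi>' (z + z') = \<chi>' z * \<chi>' z'" .
  next
    fix z assume "z \<in> adjoin A x"
    then obtain a n where "a \<in> A" "z = a + frag_cmul n x" by (auto simp: adjoin_def)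
    then show "\<chi>' z \<noteq> 0" using val char_onD(2)[OF A(2)] y by simp
  qed
  moreover have "\<chi>' a = \<chi> a" if "a \<in> A" for a using val[OF that, of 0] by simp
  moreover have "\<chi>' x = y" using val[OF add_subgroupD(1)[OF A(1)], of 1] char_on_zero[OF A] by simp
  ultimately show ?thesis by blast
qed

text \<open>The n with n x in \<open>A\<close> form an ideal of the integers, nonzero by assumption,
  and \<open>m\<close> is its positive generator.\<close>

lemma order_modulo:
  assumes A: "add_subgroup A" and "n0 \<noteq> 0" "frag_cmul n0 x \<in> A"
  shows "\<exists>m::nat. m > 0 \<and> (\<forall>n. frag_cmul n x \<in> A \<longleftrightarrow> int m dvd n)"
proof -
  define m where "m = (LEAST m::nat. m > 0 \<and> frag_cmul (int m) x \<in> A)"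
  have "nat \<bar>n0\<bar> > 0 \<and> frag_cmul (int (nat \<bar>n0\<bar>)) x \<in> A"
    using assms add_subgroupD(3)[OF A assms(3)] by (cases "n0 \<ge> 0") auto
  then have m: "m > 0 \<and> frag_cmul (int m) x \<in> A"
    unfolding m_def by (rule LeastI)
  have "frag_cmul n x \<in> A \<longleftrightarrow> int m dvd n" for n
  proof
    assume "int m dvd n"
    then obtain k where "n = int m * k" by (auto simp: dvd_def)
    then have "frag_cmul n x = frag_cmul k (frag_cmul (int m) x)" by (simp add: mult.commute)
    then show "frag_cmul n x \<in> A" using add_subgroup_cmul[OF A, of "frag_cmul (int m) x" k] m by simp
  next
    assume n: "frag_cmul n x \<in> A"
    have "frag_cmul (n mod int m) x = frag_cmul n x - frag_cmul (n div int m) (frag_cmul (int m) x)"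
      by (simp add: minus_div_mult_eq_mod frag_cmul_diff_distrib[symmetric])
    also have "\<dots> \<in> A" using n add_subgroup_cmul[OF A, of "frag_cmul (int m) x"] m by (intro add_subgroupD(2)[OF A]) blast+
    finally have mod: "frag_cmul (int (nat (n mod int m))) x \<in> A" using m by simp
    have "nat (n mod int m) < m" using m by (simp add: nat_less_iff)
    then have "\<not> nat (n mod int m) > 0"
      using not_less_Least[of "nat (n mod int m)" "\<lambda>m. m > 0 \<and> frag_cmul (int m) x \<in> A"] mod by (auto simp: m_def)
    moreover have "n mod int m \<ge> 0" using m by simp
    ultimately show "int m dvd n" by (simp add: dvd_eq_mod_eq_0)
  qed
  then show ?thesis using m by blast
qed

text \<open>One equation at the generator \<open>m\<close> settles all multiples of \<open>x\<close>
  in \<open>A\<close>.\<close>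

lemma powi_compatible:
  assumes A: "add_subgroup A" "char_on A \<chi>" and m: "\<And>n. frag_cmul n x \<in> A \<longleftrightarrow> int m dvd n"
    and y: "y ^ m = \<chi> (frag_cmul (int m) x)" and "frag_cmul n x \<in> A"
  shows "\<chi> (frag_cmul n x) = y powi n"
proof -
  have mA: "frag_cmul (int m) x \<in> A" using m by simp
  obtain k where k: "n = int m * k" using assms(5) m by (auto simp: dvd_def)
  then have "\<chi> (frag_cmul n x) = \<chi> (frag_cmul k (frag_cmul (int m) x))" by (simp add: mult.commute)
  also have "\<dots> = (y ^ m) powi k" using char_on_cmul[OF A mA] y by simp
  also have "\<dots> = y powi n" by (simp add: k power_int_mult)
  finally show ?thesis .
qed

text \<open>Algebraic closedness provides the root that the value at \<open>x\<close> has to be; if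
  no nonzero multiple of \<open>x\<close> lies in \<open>A\<close>, the value 1 is
  consistent.\<close>

lemma char_on_extend_one:
  assumes A: "add_subgroup A" "char_on A (\<chi> :: _ \<Rightarrow> 'e::alg_closed_field)"
  shows "\<exists>\<chi>'. char_on (adjoin A x) \<chi>' \<and> (\<forall>a\<in>A. \<chi>' a = \<chi> a)"
proof (cases "\<exists>n0. n0 \<noteq> 0 \<and> frag_cmul n0 x \<in> A")
  case True
  then obtain m where m: "m > 0" "\<And>n. frag_cmul n x \<in> A \<longleftrightarrow> int m dvd n"
    using order_modulo[OF A(1)] by metis
  obtain y where y: "y ^ m = \<chi> (frag_cmul (int m) x)" using nth_root_exists[OF m(1)] by blast
  have "y \<noteq> 0" using y m char_onD(2)[OF A(2), of "frag_cmul (int m) x"] by (auto simp: zero_power)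
  then show ?thesis using char_on_adjoin_extension[OF A _ powi_compatible[OF A m(2) y]] by blast
next
  case False
  then have "\<chi> (frag_cmul n x) = 1 powi n" if "frag_cmul n x \<in> A" for n
    using that char_on_zero[OF A] by (cases "n = 0") auto
  then show ?thesis using char_on_adjoin_extension[OF A, of 1 x] by auto
qed

lemma character_extension:
  assumes A: "add_subgroup A" "char_on A (\<chi> :: _ \<Rightarrow> 'e::alg_closed_field)" and sub: "\<And>x. x \<in> A \<Longrightarrow> keys x \<subseteq> {..<s}"
  shows "\<exists>\<chi>'. character \<chi>' \<and> (\<forall>a\<in>A. \<chi>' a = \<chi> a)"
proof -
  have "\<exists>B \<chi>'. add_subgroup B \<and> A \<subseteq> B \<and> (\<forall>j<n. single j 1 \<in> B) \<and> char_on B \<chi>' \<and> (\<forall>a\<in>A. \<chi>' a = \<chi> a)" for n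
  proof (induction n)
    case 0
    show ?case using A by (intro exI[of _ A] exI[of _ \<chi>]) auto
  next
    case (Suc n)
    then obtain B \<chi>' where B: "add_subgroup B" "A \<subseteq> B" "\<forall>j<n. single j 1 \<in> B" "char_on B \<chi>'" "\<forall>a\<in>A. \<chi>' a = \<chi> a"
      by blast
    obtain \<chi>'' where \<chi>'': "char_on (adjoin B (single n 1)) \<chi>''" "\<forall>b\<in>B. \<chi>'' b = \<chi>' b"
      using char_on_extend_one[OF B(1,4)] by blast
    show ?case
      using B \<chi>'' add_subgroup_adjoin[OF B(1), of "single n 1"]
      by (intro exI[of _ "adjoin B (single n 1)"] exI[of _ \<chi>'']) (auto simp: less_Suc_eq subset_iff)
  qed
  from this[of s] obtain B \<chi>' where B: "add_subgroup B" "A \<subseteq> B" "\<And>j. j < s \<Longrightarrow> single j 1 \<in> B" "char_on B \<chi>'" "\<forall>a\<in>A. \<chi>' a = \<chi> a"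
    by blast
  \<comment> \<open>Truncation to the first \<open>s\<close> coordinates; composing with it makes
    the character total on the type without changing it on \<open>A\<close>.\<close>
  define t where "t x = (\<Sum>j<s. frag_cmul (lookup x j) (single j 1))" for x
  have tB: "t x \<in> B" for x unfolding t_def using B(3) by (intro add_subgroup_sum[OF B(1)] add_subgroup_cmul[OF B(1)]) auto
  have t_add: "t (x + y) = t x + t y" for x y
    by (simp add: t_def lookup_add frag_cmul_distrib sum.distrib)
  have t_id: "t x = x" if "x \<in> A" for x
  proof (rule poly_mapping_eqI)
    fix k
    have "lookup x k = 0" if "\<not> k < s" using sub[OF \<open>x \<in> A\<close>] that by (auto simp: in_keys_iff)
    then show "lookup (t x) k = lookup x k"
      by (auto simp: t_def lookup_sum lookup_single when_def if_distrib cong: if_cong)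
  qed
  have "character (\<lambda>x. \<chi>' (t x))"
    using char_onD[OF B(4)] tB by (auto simp: character_def t_add)
  moreover have "\<chi>' (t a) = \<chi> a" if "a \<in> A" for a using B(5) that t_id by simp
  ultimately show ?thesis by blast
qed

text \<open>The derivative m X^(m-1) vanishes at most at 0, while the roots of X^m - k are nonzero,
  so all of them are simple.\<close>

lemma card_roots_of_nonzero:
  fixes k :: "'e::alg_closed_field"
  assumes "k \<noteq> 0" "of_nat m \<noteq> (0::'e)"
  shows "finite {y. y ^ m = k} \<and> card {y. y ^ m = k} = m"
proof -
  have m: "m > 0" using assms(2) by (cases m) auto
  define p where "p = Polynomial.monom 1 m + [:- k:]"
  have deg: "Polynomial.degree p = m"
    unfolding p_def using m by (subst degree_add_eq_left) (auto simp: degree_monom_eq)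
  have p0: "p \<noteq> 0" using deg m by auto
  have eval: "poly p y = y ^ m - k" for y by (simp add: p_def poly_monom)
  have lead: "Polynomial.lead_coeff p = 1"
    unfolding deg using m by (simp add: p_def coeff_pCons split: nat.splits)
  obtain A where A: "size A = m" "p = (\<Prod>x\<in>#A. [:-x, 1:])"
    using alg_closed_imp_factorization[OF p0] lead deg by auto
  have roots: "set_mset A = {y. y ^ m = k}"
  proof -
    have "poly p y = 0 \<longleftrightarrow> y \<in># A" for y
      by (simp add: A(2) poly_prod_mset prod_mset_zero_iff image_iff)
    then show ?thesis by (auto simp: eval)
  qed
  have "count A x = 1" if x: "x \<in># A" for x
  proof -
    \<comment> \<open>If \<open>x\<close> occurred a second time, the cofactor and hence the
      derivative would vanish at \<open>x\<close>.\<close>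
    obtain B where B: "A = add_mset x B" using multi_member_split[OF x] by blast
    define q where "q = (\<Prod>x\<in>#B. [:-x, 1:])"
    have "p = [:-x, 1:] * q" by (simp add: A(2) B q_def)
    then have "poly (pderiv p) x = poly q x" by (simp only: pderiv_mult) (simp add: pderiv_pCons)
    moreover have "poly (pderiv p) x = of_nat m * x ^ (m - 1)"
      by (simp add: p_def pderiv_add pderiv_monom poly_monom pderiv_pCons)
    moreover have "x \<noteq> 0" using x roots assms(1) m by (auto simp: zero_power)
    ultimately have "poly q x \<noteq> 0" using assms(2) by (metis mult_eq_0_iff power_not_zero)
    then have "x \<notin># B" by (auto simp: q_def poly_prod_mset prod_mset_zero_iff)
    then show ?thesis by (simp add: B not_in_iff)
  qed
  then have "size A = card (set_mset A)" by (simp add: size_multiset_overloaded_eq)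
  then show ?thesis using A(1) roots by (metis finite_set_mset)
qed

text \<open>For the quotient u of the two elements, (u - 1)^(p^n) = u^(p^n) - 1 = 0 in
  characteristic p.\<close>

lemma char_power_inj:
  assumes "a ^ (CHAR('e) ^ n) = b ^ (CHAR('e) ^ n)" "(b :: 'e::field) \<noteq> 0" "prime CHAR('e)"
  shows "a = b"
proof -
  define u where "u = a / b"
  have "u ^ (CHAR('e) ^ n) = 1" using assms by (simp add: u_def power_divide)
  moreover have "((u - 1) + 1) ^ (CHAR('e) ^ n) = (u - 1) ^ (CHAR('e) ^ n) + 1 ^ (CHAR('e) ^ n)"
    by (rule freshmans_dream'[OF assms(3) refl])
  ultimately have "u = 1" by simp
  then show ?thesis using assms(2) by (simp add: u_def)
qed

section \<open>Counting the characters of the torsion group\<close>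

context adapted_basis
begin

lemma add_subgroup_L: "add_subgroup L" using L_diff by (simp add: add_subgroup_def)

lemma add_subgroup_M: "add_subgroup M" using M_diff by (simp add: add_subgroup_def)

lemma finite_class_M: "finite (lat_class ` M)"
proof -
  define G where "G m = restrict (\<lambda>j. lookup m j mod int N) {..<s}" for m :: "nat \<Rightarrow>\<^sub>0 int"
  have "G ` M \<subseteq> PiE {..<s} (\<lambda>_. {0..<int N})" using N_pos by (auto simp: G_def PiE_iff extensional_def split: if_splits)
  then have fin: "finite (G ` M)" by (rule finite_subset) (intro finite_PiE, auto)
  have "lat_class x = lat_class (inv_into M G (G x))" if x: "x \<in> M" for x
  proof -
    let ?y = "inv_into M G (G x)"
    have y: "?y \<in> M" "G ?y = G x" using x by (simp_all add: inv_into_into f_inv_into_f)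
    have "x - ?y \<in> L"
    proof (rule M_eqI_mod_N)
      show "lookup x j mod int N = lookup ?y j mod int N" if "j < s" for j
        using fun_cong[OF y(2), of j] that by (simp add: G_def)
    qed (use x y(1) in \<open>auto simp: M_def\<close>)
    then show ?thesis by (simp add: lat_class_eq_iff)
  qed
  then have "lat_class ` M \<subseteq> (\<lambda>u. lat_class (inv_into M G u)) ` G ` M" by (auto simp: image_iff)
  then show ?thesis using fin finite_subset by blast
qed

lemma ex_class_reps:
  assumes "A \<subseteq> M"
  shows "\<exists>R. finite R \<and> R \<subseteq> A \<and> inj_on lat_class R \<and> lat_class ` R = lat_class ` A"
proof -
  obtain R where R: "R \<subseteq> A" "inj_on lat_class R" "lat_class ` A = lat_class ` R"
    using subset_image_inj[of "lat_class ` A" lat_class A] by auto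
  have "finite (lat_class ` R)" using finite_class_M assms R by (metis finite_subset image_mono)
  then have "finite R" using R(2) finite_imageD by blast
  then show ?thesis using R by blast
qed

text \<open>The value 0 off \<open>A\<close> makes these functions correspond one to one to the
  characters of A/L, so that they can be counted.\<close>

definition chars :: "(nat \<Rightarrow>\<^sub>0 int) set \<Rightarrow> ((nat \<Rightarrow>\<^sub>0 int) \<Rightarrow> 'e::field) set" where
  "chars A = {\<chi>. char_on A \<chi> \<and> (\<forall>x\<in>L. \<chi> x = 1) \<and> (\<forall>x. x \<notin> A \<longrightarrow> \<chi> x = 0)}"

definition zero_extend :: "(nat \<Rightarrow>\<^sub>0 int) set \<Rightarrow> ((nat \<Rightarrow>\<^sub>0 int) \<Rightarrow> 'e::field) \<Rightarrow> (nat \<Rightarrow>\<^sub>0 int) \<Rightarrow> 'e" where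
  "zero_extend A \<chi> x = (if x \<in> A then \<chi> x else 0)"

lemma zero_extend_chars:
  assumes "add_subgroup A" "L \<subseteq> A" "char_on A \<chi>" "\<And>x. x \<in> L \<Longrightarrow> \<chi> x = 1"
  shows "zero_extend A \<chi> \<in> chars A"
  using assms char_on_cong[OF assms(1), of "zero_extend A \<chi>" \<chi>] by (auto simp: chars_def zero_extend_def)

lemma chars_eqI: "\<chi> \<in> chars A \<Longrightarrow> \<chi>' \<in> chars A \<Longrightarrow> (\<And>x. x \<in> A \<Longrightarrow> \<chi> x = \<chi>' x) \<Longrightarrow> \<chi> = \<chi>'"
  by (rule ext) (metis (mono_tags, lifting) chars_def mem_Collect_eq)

text \<open>Restriction to \<open>A\<close> and the value at \<open>x\<close> identify a character
  of the enlarged group with a character of \<open>A\<close> and an m-th root of its value at m x.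
  There are \<open>m\<close> such roots because \<open>m\<close> is nonzero in the field.\<close>

lemma card_chars_adjoin:
  assumes A: "add_subgroup A" "L \<subseteq> A" and x: "x \<notin> A"
    and m: "m > 0" "\<And>n. frag_cmul n x \<in> A \<longleftrightarrow> int m dvd n" "of_nat m \<noteq> (0 :: 'e::alg_closed_field)"
    and fin: "finite (chars A :: (_ \<Rightarrow> 'e) set)"
  shows "finite (chars (adjoin A x) :: (_ \<Rightarrow> 'e) set) \<and> card (chars (adjoin A x) :: (_ \<Rightarrow> 'e) set) = card (chars A :: (_ \<Rightarrow> 'e) set) * m"
proof -
  let ?S = "SIGMA \<chi>:(chars A :: (_ \<Rightarrow> 'e) set). {y. y ^ m = \<chi> (frag_cmul (int m) x)}"
  let ?F = "\<lambda>\<chi> :: _ \<Rightarrow> 'e. (zero_extend A \<chi>, \<chi> x)"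
  note adjoin = add_subgroup_adjoin[OF A(1), of x]
  have mA: "frag_cmul (int m) x \<in> A" using m by simp
  have roots: "finite {y. y ^ m = \<chi> (frag_cmul (int m) x)} \<and> card {y. y ^ m = \<chi> (frag_cmul (int m) x)} = m"
    if "\<chi> \<in> chars A" for \<chi> :: "_ \<Rightarrow> 'e"
    using that char_onD(2)[of A \<chi> "frag_cmul (int m) x"] mA m(3) by (intro card_roots_of_nonzero) (auto simp: chars_def)
  have bij: "bij_betw ?F (chars (adjoin A x)) ?S"
    unfolding bij_betw_def
  proof (intro conjI)
    show "inj_on ?F (chars (adjoin A x))"
    proof (rule inj_onI)
      fix \<chi> \<chi>' :: "_ \<Rightarrow> 'e" assume c: "\<chi> \<in> chars (adjoin A x)" "\<chi>' \<in> chars (adjoin A x)" "?F \<chi> = ?F \<chi>'"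
      show "\<chi> = \<chi>'"
      proof (rule chars_eqI[OF c(1,2)])
        fix z assume "z \<in> adjoin A x"
        then obtain a n where z: "a \<in> A" "z = a + frag_cmul n x" by (auto simp: adjoin_def)
        have "\<chi> a = \<chi>' a" using fun_cong[OF arg_cong[OF c(3), of fst], of a] z(1) by (simp add: zero_extend_def)
        moreover have "char_on (adjoin A x) \<chi>" "char_on (adjoin A x) \<chi>'" using c by (auto simp: chars_def)
        moreover have "\<chi> x = \<chi>' x" using c(3) by simp
        ultimately show "\<chi> z = \<chi>' z" unfolding z(2)
          using char_on_adjoin_eval[OF A(1) _ z(1), of x \<chi> n] char_on_adjoin_eval[OF A(1) _ z(1), of x \<chi>' n] by simp
      qed
    qed
    show "?F ` chars (adjoin A x) = ?S"
    proof (intro equalityI subsetI)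
      fix z assume "z \<in> ?F ` chars (adjoin A x)"
      then obtain \<chi> where c: "\<chi> \<in> chars (adjoin A x)" "z = ?F \<chi>" by blast
      have ch: "char_on (adjoin A x) \<chi>" and one: "\<And>x. x \<in> L \<Longrightarrow> \<chi> x = 1" using c(1) by (auto simp: chars_def)
      have "zero_extend A \<chi> \<in> chars A" by (rule zero_extend_chars[OF A char_on_subset[OF ch adjoin(2)] one])
      moreover have "\<chi> x ^ m = \<chi> (frag_cmul (int m) x)" using char_on_cmul_nat[OF adjoin(1) ch adjoin(3)] by simp
      ultimately show "z \<in> ?S" using mA by (simp add: c(2) zero_extend_def)
    next
      fix z assume "z \<in> ?S"
      then obtain \<chi> y where z: "z = (\<chi>, y)" "\<chi> \<in> chars A" "y ^ m = \<chi> (frag_cmul (int m) x)" by blast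
      have ch: "char_on A \<chi>" using z(2) by (simp add: chars_def)
      have "y \<noteq> 0" using z(3) m(1) char_onD(2)[OF ch mA] by (auto simp: zero_power)
      then obtain \<chi>' where \<chi>': "char_on (adjoin A x) \<chi>'" "\<forall>a\<in>A. \<chi>' a = \<chi> a" "\<chi>' x = y"
        using char_on_adjoin_extension[OF A(1) ch _ powi_compatible[OF A(1) ch m(2) z(3)]] by blast
      have "zero_extend (adjoin A x) \<chi>' \<in> chars (adjoin A x)"
        using \<chi>' A(2) adjoin(2) z(2) by (intro zero_extend_chars adjoin(1)) (auto simp: chars_def)
      moreover have "zero_extend A (zero_extend (adjoin A x) \<chi>') = \<chi>"
      proof
        fix w show "zero_extend A (zero_extend (adjoin A x) \<chi>') w = \<chi> w" using \<chi>'(2) z(2) adjoin(2) by (auto simp: zero_extend_def chars_def)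
      qed
      moreover have "zero_extend (adjoin A x) \<chi>' x = y" using adjoin(3) \<chi>'(3) by (simp add: zero_extend_def)
      ultimately show "z \<in> ?F ` chars (adjoin A x)" using z(1) by (intro image_eqI[of _ _ "zero_extend (adjoin A x) \<chi>'"]) auto
    qed
  qed
  have "finite ?S" using fin roots by (intro finite_SigmaI) auto
  moreover have "card ?S = card (chars A :: (_ \<Rightarrow> 'e) set) * m"
    using fin roots by (subst card_SigmaI) auto
  ultimately show ?thesis using bij_betw_finite[OF bij] bij_betw_same_card[OF bij] by simp
qed

text \<open>Representatives of the enlarged group are a + k x with 0 \<le> k < m and a running
  through representatives of \<open>A\<close>.\<close>

lemma card_class_adjoin:
  assumes A: "add_subgroup A" "L \<subseteq> A" "A \<subseteq> M"
    and m: "m > 0" "\<And>n. frag_cmul n x \<in> A \<longleftrightarrow> int m dvd n"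
  shows "card (lat_class ` adjoin A x) = card (lat_class ` A) * m"
proof -
  obtain R where R: "finite R" "R \<subseteq> A" "inj_on lat_class R" "lat_class ` R = lat_class ` A"
    using ex_class_reps[OF A(3)] by blast
  let ?F = "\<lambda>(a, k). lat_class (a + frag_cmul (int k) x)"
  have "bij_betw ?F (R \<times> {..<m}) (lat_class ` adjoin A x)"
    unfolding bij_betw_def
  proof (intro conjI)
    show "inj_on ?F (R \<times> {..<m})"
    proof (rule inj_onI, clarsimp)
      fix a k a' k' assume h: "a \<in> R" "k < m" "a' \<in> R" "k' < m" "lat_class (a + frag_cmul (int k) x) = lat_class (a' + frag_cmul (int k') x)"
      have L: "(a - a') + frag_cmul (int k - int k') x \<in> L"
        using h(5) by (simp add: lat_class_eq_iff frag_cmul_diff_distrib algebra_simps)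
      have "frag_cmul (int k - int k') x = ((a - a') + frag_cmul (int k - int k') x) - (a - a')" by simp
      also have "\<dots> \<in> A" using L A(2) h R(2) by (intro add_subgroupD(2)[OF A(1)]) auto
      finally have "int m dvd int k - int k'" using m by simp
      then have k: "k = k'" using h by (auto dest: zdvd_imp_le simp: mod_eq_dvd_iff[symmetric])
      then have "lat_class a = lat_class a'" using L by (simp add: lat_class_eq_iff)
      then show "a = a' \<and> k = k'" using k R(3) h by (auto simp: inj_on_def)
    qed
    show "?F ` (R \<times> {..<m}) = lat_class ` adjoin A x"
    proof (intro equalityI subsetI)
      fix z assume "z \<in> ?F ` (R \<times> {..<m})"
      then show "z \<in> lat_class ` adjoin A x" using R(2) by (fastforce simp: adjoin_def)
    next
      fix z assume "z \<in> lat_class ` adjoin A x"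
      then obtain a n where z: "a \<in> A" "z = lat_class (a + frag_cmul n x)" by (auto simp: adjoin_def)
      \<comment> \<open>Division of \<open>n\<close> by \<open>m\<close> with remainder: the
        multiple of m x is moved into \<open>A\<close>.\<close>
      let ?a = "a + frag_cmul (n div int m) (frag_cmul (int m) x)"
      have "frag_cmul (int m) x \<in> A" using m(2) by simp
      then have "?a \<in> A" using z(1) add_subgroup_cmul[OF A(1), of "frag_cmul (int m) x"]
        by (intro add_subgroupD(4)[OF A(1)]) blast+
      then obtain a' where a': "a' \<in> R" "lat_class ?a = lat_class a'" using R(4) by (metis image_iff)
      have eq: "a + frag_cmul n x = frag_cmul (int (nat (n mod int m))) x + ?a"
      proof -
        have "n = n mod int m + (n div int m) * int m" by simp
        then have "frag_cmul n x = frag_cmul (n mod int m) x + frag_cmul ((n div int m) * int m) x"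
          by (metis frag_cmul_distrib)
        then show ?thesis using m(1) by (simp add: add_ac)
      qed
      have "z = lat_class (frag_cmul (int (nat (n mod int m))) x + a')"
        unfolding z(2) eq by (rule lat_class_add[OF a'(2)])
      moreover have "nat (n mod int m) < m" using m(1) by (simp add: nat_less_iff)
      ultimately show "z \<in> ?F ` (R \<times> {..<m})"
        using a'(1) by (intro image_eqI[of _ _ "(a', nat (n mod int m))"]) (auto simp: add.commute)
    qed
  qed
  then have "card (lat_class ` adjoin A x) = card R * m"
    by (metis bij_betw_same_card card_cartesian_product card_lessThan)
  then show ?thesis using R(3,4) by (metis card_image)
qed

text \<open>For a prime \<open>p\<close> this is the preimage of the subgroup G of the torsion
  group. For \<open>p = 0\<close> the condition reads n \<noteq> 0 and gives all of
  \<open>M\<close>, so one count covers both cases of the theorem.\<close>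

definition coprime_part :: "nat \<Rightarrow> (nat \<Rightarrow>\<^sub>0 int) set" where
  "coprime_part p = {x \<in> M. \<exists>n. \<not> p dvd n \<and> frag_cmul (int n) x \<in> L}"

lemma add_subgroup_coprime_part:
  assumes "p = 0 \<or> prime p"
  shows "add_subgroup (coprime_part p)"
  unfolding add_subgroup_def
proof (intro conjI ballI)
  have "\<not> p dvd 1" using assms by auto
  then show "0 \<in> coprime_part p" unfolding coprime_part_def by (auto intro!: exI[of _ 1])
  fix x y assume "x \<in> coprime_part p" "y \<in> coprime_part p"
  then obtain n n' where n: "x \<in> M" "\<not> p dvd n" "frag_cmul (int n) x \<in> L" "y \<in> M" "\<not> p dvd n'" "frag_cmul (int n') y \<in> L"
    by (auto simp: coprime_part_def)
  have "frag_cmul (int (n * n')) (x - y) = frag_cmul (int n') (frag_cmul (int n) x) - frag_cmul (int n) (frag_cmul (int n') y)"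
    by (rule poly_mapping_eqI) (simp add: lookup_minus algebra_simps)
  also have "\<dots> \<in> L" using L_diff[OF L_cmul[OF n(3)] L_cmul[OF n(6)]] .
  finally have "frag_cmul (int (n * n')) (x - y) \<in> L" .
  moreover have "\<not> p dvd n * n'" using n assms by (auto simp: prime_dvd_mult_iff)
  ultimately show "x - y \<in> coprime_part p" using n M_diff unfolding coprime_part_def by blast
qed

lemma L_coprime_part: "p = 0 \<or> prime p \<Longrightarrow> L \<subseteq> coprime_part p"
proof
  fix x assume "p = 0 \<or> prime p" "x \<in> L"
  moreover have "\<not> p dvd 1" using calculation by auto
  ultimately show "x \<in> coprime_part p" using L_subset_M by (auto simp: coprime_part_def intro!: exI[of _ 1])
qed

lemma CHAR_cases: "CHAR('e::field) = 0 \<or> prime CHAR('e)"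
  using prime_CHAR_semidom[where ?'a = 'e] by auto

text \<open>Going from \<open>L\<close> to \<open>G\<close> by adjoining one element at a time,
  every step multiplies the number of characters and the number of classes by the same
  \<open>m\<close>, which is nonzero in the field. The last conclusion later shows that the order of
  the subgroup is prime to the characteristic.\<close>

lemma card_chars_coprime_part:
  defines "G \<equiv> coprime_part CHAR('e::alg_closed_field)"
  shows "finite (chars G :: (_ \<Rightarrow> 'e) set) \<and> card (chars G :: (_ \<Rightarrow> 'e) set) = card (lat_class ` G) \<and>
    of_nat (card (lat_class ` G)) \<noteq> (0 :: 'e)"
proof -
  have subG: "add_subgroup G" and LG: "L \<subseteq> G" and GM: "G \<subseteq> M"
    using add_subgroup_coprime_part[OF CHAR_cases] L_coprime_part[OF CHAR_cases] by (auto simp: G_def coprime_part_def)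
  define good where "good A \<longleftrightarrow> add_subgroup A \<and> L \<subseteq> A \<and> A \<subseteq> G \<and> finite (chars A :: (_ \<Rightarrow> 'e) set) \<and>
       card (chars A :: (_ \<Rightarrow> 'e) set) = card (lat_class ` A) \<and> of_nat (card (lat_class ` A)) \<noteq> (0 :: 'e)" for A
  have fin: "finite (lat_class ` A)" if "A \<subseteq> G" for A
    using finite_class_M that GM by (meson finite_subset image_mono order.trans)
  have "good A \<Longrightarrow> good G" for A
  \<comment> \<open>Adjoining an element outside \<open>A\<close> at least doubles the number of
    classes, which is bounded by that of \<open>G\<close>.\<close>
  proof (induction "card (lat_class ` G) - card (lat_class ` A)" arbitrary: A rule: less_induct)
    case (less A)
    have A: "add_subgroup A" "L \<subseteq> A" "A \<subseteq> G" "finite (chars A :: (_ \<Rightarrow> 'e) set)" "card (chars A :: (_ \<Rightarrow> 'e) set) = card (lat_class ` A)"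
      "of_nat (card (lat_class ` A)) \<noteq> (0 :: 'e)"
      using less.prems by (auto simp: good_def)
    show ?case
    proof (cases "A = G")
      case True
      then show ?thesis using less.prems by simp
    next
      case False
      then obtain x where x: "x \<in> G" "x \<notin> A" using A(3) by blast
      then obtain n0 where n0: "\<not> CHAR('e) dvd n0" "frag_cmul (int n0) x \<in> A" using A(2) by (auto simp: G_def coprime_part_def)
      then have "int n0 \<noteq> 0" by (auto intro: ccontr)
      then obtain m where m: "m > 0" "\<And>n. frag_cmul n x \<in> A \<longleftrightarrow> int m dvd n"
        using order_modulo[OF A(1) _ n0(2)] by blast
      \<comment> \<open>\<open>m\<close> divides a number that is not a multiple of the
        characteristic; this is where the restriction to the coprime part enters.\<close>
      have "m dvd n0" using m(2) n0(2) by simp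
      then have m0: "of_nat m \<noteq> (0 :: 'e)" using n0(1) by (auto simp: of_nat_eq_0_iff_char_dvd)
      have "m \<noteq> 1" using m(2)[of 1] x(2) by auto
      then have m2: "m > 1" using m(1) by simp
      have AM: "A \<subseteq> M" using A(3) GM by blast
      note idx = card_class_adjoin[OF A(1,2) AM m]
      have sub: "adjoin A x \<subseteq> G" by (rule adjoin_least[OF subG A(3) x(1)])
      have good: "good (adjoin A x)"
        unfolding good_def using card_chars_adjoin[OF A(1,2) x(2) m m0 A(4)] add_subgroup_adjoin[OF A(1), of x] A(2,5,6) m0 sub idx by auto
      have "card (lat_class ` A) > 0" using fin[OF A(3)] add_subgroupD(1)[OF A(1)] by (auto simp: card_gt_0_iff)
      then have "card (lat_class ` A) < card (lat_class ` adjoin A x)" using m2 idx by simp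
      moreover have "card (lat_class ` adjoin A x) \<le> card (lat_class ` G)"
        using fin[OF subset_refl] sub by (intro card_mono) auto
      ultimately show ?thesis using less.hyps[OF _ good] by linarith
    qed
  qed
  moreover have "good L"
  proof -
    have one: "char_on L (\<lambda>_. 1 :: 'e)" by (simp add: char_on_def)
    have "chars L = {zero_extend L (\<lambda>_. 1 :: 'e)}"
      using zero_extend_chars[OF add_subgroup_L subset_refl one] by (auto intro!: chars_eqI simp: chars_def zero_extend_def)
    moreover have "lat_class ` L = {lat_class 0}"
      using lat_class_eq_iff[of _ 0] by (auto intro: image_eqI[of _ _ 0])
    ultimately show ?thesis using LG add_subgroup_L by (simp add: good_def)
  qed
  ultimately show ?thesis unfolding good_def by blast
qed

text \<open>Restriction from \<open>M\<close> to the coprime part is bijective on characters. In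
  positive characteristic a power of p carries \<open>M\<close> into the coprime part, and raising
  to that power is injective on the field; every character extends because the field is
  algebraically closed.\<close>

lemma card_chars_M:
  "finite (chars M :: (_ \<Rightarrow> 'e::alg_closed_field) set) \<and>
     card (chars M :: (_ \<Rightarrow> 'e) set) = card (lat_class ` coprime_part CHAR('e))"
proof -
  define G where "G = coprime_part CHAR('e)"
  have subG: "add_subgroup G" and LG: "L \<subseteq> G" and GM: "G \<subseteq> M"
    using add_subgroup_coprime_part[OF CHAR_cases] L_coprime_part[OF CHAR_cases] by (auto simp: G_def coprime_part_def)
  have "bij_betw (zero_extend G) (chars M) (chars G :: (_ \<Rightarrow> 'e) set)"
    unfolding bij_betw_def
  proof (intro conjI)
    show "inj_on (zero_extend G) (chars M :: (_ \<Rightarrow> 'e) set)"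
    proof (rule inj_onI)
      fix \<chi> \<chi>' :: "_ \<Rightarrow> 'e" assume c: "\<chi> \<in> chars M" "\<chi>' \<in> chars M" "zero_extend G \<chi> = zero_extend G \<chi>'"
      have ch: "char_on M \<chi>" "char_on M \<chi>'" using c by (auto simp: chars_def)
      have eq: "\<chi> x = \<chi>' x" if "x \<in> G" for x using fun_cong[OF c(3), of x] that by (simp add: zero_extend_def)
      show "\<chi> = \<chi>'"
      proof (rule chars_eqI[OF c(1,2)])
        fix x assume x: "x \<in> M"
        show "\<chi> x = \<chi>' x"
        proof (cases "CHAR('e) = 0")
          case True
          then have "x \<in> G" using x N_pos M_torsion[OF x] by (auto simp: G_def coprime_part_def intro!: exI[of _ N])
          then show ?thesis by (rule eq)
        next
          case False
          then have p: "prime CHAR('e)" using CHAR_cases[where ?'e = 'e] by simp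
          obtain n where n: "N = CHAR('e) ^ multiplicity CHAR('e) N * n" "\<not> CHAR('e) dvd n"
            using multiplicity_decompose'[of N "CHAR('e)"] N_pos p by (metis not_prime_unit not_gr_zero)
          \<comment> \<open>The p-part of \<open>N\<close>: after multiplication by it, the cofactor
            \<open>n\<close> prime to p suffices to reach \<open>L\<close>.\<close>
          define q where "q = CHAR('e) ^ multiplicity CHAR('e) N"
          have "frag_cmul (int n) (frag_cmul (int q) x) \<in> L"
            using M_torsion[OF x] n(1) by (simp add: q_def mult.commute flip: of_nat_mult of_nat_power)
          then have "frag_cmul (int q) x \<in> G"
            using n(2) add_subgroup_cmul[OF add_subgroup_M x] by (auto simp: G_def coprime_part_def)
          then have "\<chi> x ^ q = \<chi>' x ^ q"
            using eq char_on_cmul_nat[OF add_subgroup_M ch(1) x, of q] char_on_cmul_nat[OF add_subgroup_M ch(2) x, of q] by simp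
          then show ?thesis using char_power_inj[OF _ char_onD(2)[OF ch(2) x] p] by (simp add: q_def)
        qed
      qed
    qed
    show "zero_extend G ` chars M = (chars G :: (_ \<Rightarrow> 'e) set)"
    proof (intro equalityI subsetI)
      fix z :: "_ \<Rightarrow> 'e" assume "z \<in> zero_extend G ` chars M"
      then obtain \<chi> where "\<chi> \<in> chars M" "z = zero_extend G \<chi>" by blast
      then show "z \<in> chars G" using zero_extend_chars[OF subG LG char_on_subset[OF _ GM], of \<chi>] by (auto simp: chars_def)
    next
      fix \<chi> :: "_ \<Rightarrow> 'e" assume c: "\<chi> \<in> chars G"
      then obtain \<chi>' where \<chi>': "character \<chi>'" "\<forall>a\<in>G. \<chi>' a = \<chi> a"
        using character_extension[OF subG, of \<chi> s] GM M_carrier by (auto simp: chars_def)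
      have "zero_extend M \<chi>' \<in> chars M"
        using \<chi>' c LG by (intro zero_extend_chars add_subgroup_M L_subset_M) (auto simp: chars_def char_on_def characterD)
      moreover have "zero_extend G (zero_extend M \<chi>') = \<chi>"
      proof
        fix x show "zero_extend G (zero_extend M \<chi>') x = \<chi> x" using \<chi>'(2) GM c by (auto simp: zero_extend_def chars_def)
      qed
      ultimately show "\<chi> \<in> zero_extend G ` chars M" by (metis image_eqI)
    qed
  qed
  then show ?thesis using card_chars_coprime_part[where ?'e = 'e] bij_betw_finite bij_betw_same_card unfolding G_def by metis
qed

end

section \<open>Associated primes\<close>

lemma (in coeff_hom) poly_map_poly_linear_factor:
  "poly (map_poly h ([:- z, 1:] * q)) x = (x - h z) * poly (map_poly h q) x"
proof -
  have minus: "h (a - b) = h a - h b" for a b using hom_add[of "a - b" b] by simp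
  have split: "[:- z, 1:] * q = pCons 0 q - Polynomial.smult z q" by simp
  have "map_poly h ([:- z, 1:] * q) = pCons 0 (map_poly h q) - Polynomial.smult (h z) (map_poly h q)"
    unfolding split
    by (rule poly_eqI) (simp add: coeff_map_poly hom_zero hom_mult minus coeff_pCons split: nat.splits)
  then show ?thesis by (simp only:) (simp add: left_diff_distrib)
qed

text \<open>The closure is a separate type even if K is already closed. A polynomial over K that
  kills \<open>y\<close> splits into linear factors over K, so \<open>y\<close> is one of their
  roots.\<close>

lemma to_ac_surj:
  assumes "field_alg_closed TYPE('k::field)"
  shows "y \<in> range (to_ac :: 'k \<Rightarrow> 'k alg_closure)"
proof -
  interpret coeff_hom "to_ac :: 'k \<Rightarrow> 'k alg_closure" by (rule coeff_hom_to_ac)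
  obtain p :: "'k poly" where "p \<noteq> 0" "poly (map_poly to_ac p) y = 0"
    by (rule alg_closure_algebraic)
  then show ?thesis
  proof (induction "Polynomial.degree p" arbitrary: p)
    case 0
    then obtain a where "p = [:a:]" by (metis degree_0_id)
    then show ?case using 0 by (simp add: map_poly_pCons)
  next
    case (Suc n)
    then obtain x where x: "poly p x = 0" using assms unfolding field_alg_closed_def by (metis zero_less_Suc)
    then obtain q where q: "p = [:- x, 1:] * q" by (auto simp: poly_eq_0_iff_dvd)
    have q0: "q \<noteq> 0" using q Suc.prems by auto
    have "Polynomial.degree p = Suc (Polynomial.degree q)"
      unfolding q using q0 by (subst degree_mult_eq) auto
    then have n: "n = Polynomial.degree q" using Suc.hyps(2) by simp
    have "(y - to_ac x) * poly (map_poly to_ac q) y = 0"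
      using Suc.prems(2) unfolding q poly_map_poly_linear_factor .
    then show ?case using Suc.hyps(1)[OF n q0] by auto
  qed
qed

lemma coeff_hom_single: "coeff_hom (single 0 :: 'e::comm_ring_1 \<Rightarrow> 'a::comm_monoid_add \<Rightarrow>\<^sub>0 'e)"
  by unfold_locales (simp_all add: single_add mult_single)

lemma single_power: "single (a :: nat \<Rightarrow>\<^sub>0 int) (1 :: 'e::comm_ring_1) ^ n = single (frag_cmul (int n) a) 1"
  by (induction n) (simp_all add: mult_single frag_cmul_distrib)

text \<open>Monomials become invertible here, so that multiplication by any exponent in
  \<open>M\<close> is available; passing to classes modulo \<open>L\<close> is a separate linear
  map.\<close>

definition laurent :: "'k::field mpoly \<Rightarrow> ((nat \<Rightarrow>\<^sub>0 int) \<Rightarrow>\<^sub>0 'k alg_closure)" where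
  "laurent = push to_ac emb (\<lambda>_. 1)"

lemma laurent_mult: "laurent (f * g) = laurent f * laurent g"
  unfolding laurent_def by (rule coeff_hom.push_mult[OF coeff_hom_to_ac]) simp_all

lemma mpoly_push_laurent: "mpoly_push \<pi> \<chi> f = push (\<lambda>x. x) \<pi> \<chi> (laurent f)"
  unfolding laurent_def mpoly_push_def push_push[OF coeff_hom_to_ac coeff_hom_id]
  by (simp add: comp_def)

lemma keys_laurent: "x \<in> keys (laurent f) \<Longrightarrow> \<exists>m\<in>keys f. x = emb m"
  using keys_sum[of "\<lambda>m. single (emb m) (to_ac (lookup f m) * 1)" "keys f"]
  by (auto simp: laurent_def push_def split: if_splits)

lemma ex_max_image:
  assumes "finite A" "A \<noteq> {}"
  shows "\<exists>x\<in>A. \<forall>y\<in>A. (f y :: 'b::linorder) \<le> f x"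
proof -
  have "Max (f ` A) \<in> f ` A" using assms by (intro Max_in) auto
  then obtain x where "x \<in> A" "Max (f ` A) = f x" by blast
  then show ?thesis using Max_ge[of "f ` A"] assms(1) by (intro bexI[of _ x]) auto
qed

text \<open>A common monomial factor clears the negative exponents. It makes an eigenvector into a
  polynomial, and it places representatives of all torsion classes in the positive orthant.\<close>

lemma ex_nonneg_shift:
  fixes R :: "(nat \<Rightarrow>\<^sub>0 int) set"
  assumes "finite R" and R: "\<And>\<tau>. \<tau> \<in> R \<Longrightarrow> keys \<tau> \<subseteq> {..<s}"
  shows "\<exists>D e. \<forall>\<tau>\<in>R. keys (e \<tau>) \<subseteq> {..<s} \<and> emb (e \<tau>) = emb D + \<tau>"
proof -
  define D where "D = (\<Sum>\<tau>\<in>R. neg_part \<tau>)"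
  define e where "e \<tau> = pos_part (emb D + \<tau>)" for \<tau>
  have Dk: "keys D \<subseteq> {..<s}"
  proof
    fix j assume "j \<in> keys D"
    then have "lookup D j \<noteq> 0" by (simp only: in_keys_iff not_False_eq_True)
    then obtain \<tau> where "\<tau> \<in> R" "lookup (neg_part \<tau>) j \<noteq> 0"
      unfolding D_def lookup_sum by (meson sum.neutral)
    then show "j \<in> {..<s}" using keys_neg_part[of \<tau>] R by (metis in_keys_iff subsetD)
  qed
  have "emb (e \<tau>) = emb D + \<tau>" if "\<tau> \<in> R" for \<tau>
  proof (rule poly_mapping_eqI)
    fix j
    have "lookup (neg_part \<tau>) j \<le> lookup D j"
      unfolding D_def lookup_sum using that assms(1) by (intro member_le_sum) auto
    then show "lookup (emb (e \<tau>)) j = lookup (emb D + \<tau>) j"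
      by (simp add: e_def lookup_pos_part lookup_neg_part lookup_add)
  qed
  moreover have "keys (e \<tau>) \<subseteq> {..<s}" if "\<tau> \<in> R" for \<tau>
    using Poly_Mapping.keys_add[of "emb D" \<tau>] Dk R[OF that] keys_pos_part[of "emb D + \<tau>"]
    unfolding e_def keys_emb by blast
  ultimately show ?thesis by blast
qed

section \<open>Eigenvectors modulo the lattice and their annihilators\<close>

context adapted_basis
begin

text \<open>The image in the group algebra of \<open>\<int>\<^sup>s/L\<close>.\<close>

definition lsum :: "((nat \<Rightarrow>\<^sub>0 int) \<Rightarrow>\<^sub>0 'e::field) \<Rightarrow> ((nat \<Rightarrow>\<^sub>0 int) set \<Rightarrow>\<^sub>0 'e)" where
  "lsum = push (\<lambda>x. x) lat_class (\<lambda>_. 1)"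

lemma lsum_zero [simp]: "lsum 0 = 0"
  unfolding lsum_def by (rule coeff_hom.push_zero[OF coeff_hom_id])

lemma lsum_add: "lsum (f + g) = lsum f + lsum g"
  unfolding lsum_def by (rule coeff_hom.push_add[OF coeff_hom_id])

lemma lsum_diff: "lsum (f - g) = lsum f - lsum g"
  unfolding lsum_def by (rule coeff_hom.push_diff[OF coeff_hom_id])

lemma lsum_sum: "lsum (sum f A) = (\<Sum>x\<in>A. lsum (f x))"
  unfolding lsum_def by (rule coeff_hom.push_sum[OF coeff_hom_id])

lemma lsum_single: "lsum (single a k) = single (lat_class a) k"
  unfolding lsum_def by (simp add: coeff_hom.push_single[OF coeff_hom_id])

lemma lsum_laurent: "lsum (laurent f) = lat_push f"
  by (simp add: lsum_def mpoly_push_laurent)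

lemma lookup_lsum_mult:
  "lookup (lsum (single v a * F)) (lat_class w) = a * lookup (lsum F) (lat_class (w - v))"
proof -
  have "lat_class (v + x) = lat_class w \<longleftrightarrow> lat_class x = lat_class (w - v)" for x
    by (simp add: lat_class_eq_iff algebra_simps)
  then show ?thesis
    unfolding lsum_def coeff_hom.push_single_mult[OF coeff_hom_id] coeff_hom.lookup_push[OF coeff_hom_id]
    by (simp add: sum_distrib_left mult.commute)
qed

lemma lookup_lsum_not_class: "(\<And>x. x \<in> keys F \<Longrightarrow> C \<noteq> lat_class x) \<Longrightarrow> lookup (lsum F) C = 0"
  unfolding lsum_def coeff_hom.lookup_push[OF coeff_hom_id] by (rule sum.neutral) auto

lemma lsum_eq_0_iff: "lsum F = 0 \<longleftrightarrow> (\<forall>w. lookup (lsum F) (lat_class w) = 0)"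
proof
  assume w: "\<forall>w. lookup (lsum F) (lat_class w) = 0"
  show "lsum F = 0"
  proof (rule poly_mapping_eqI)
    fix C
    show "lookup (lsum F) C = lookup 0 C"
      using w lookup_lsum_not_class[of F C] by (cases "\<exists>x. C = lat_class x") auto
  qed
qed simp

lemma lsum_single_mult_zero: "lsum F = 0 \<Longrightarrow> lsum (single v a * F) = 0"
  by (subst lsum_eq_0_iff) (simp add: lookup_lsum_mult)

lemma lsum_mult_zero:
  assumes "lsum F = 0"
  shows "lsum (G * F) = 0"
proof -
  have "lsum (G * F) = lsum (\<Sum>v\<in>keys G. single v (lookup G v) * F)"
    by (simp only: sum_keys_single flip: sum_distrib_right)
  then show ?thesis by (simp add: lsum_sum lsum_single_mult_zero[OF assms])
qed

lemma lsum_mult_zero': "lsum F = 0 \<Longrightarrow> lsum (F * G) = 0"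
  using lsum_mult_zero[of F G] by (simp add: mult.commute)

text \<open>The exponents of \<open>G\<close> lie in distinct classes modulo \<open>M\<close>, so for the order of \<open>\<int>\<^sup>s/M\<close> the product
  of the leading term of \<open>G\<close> and the leading part of \<open>F\<close> does not cancel.\<close>

lemma lsum_mult_nonzero:
  assumes G: "G \<noteq> 0" and inj: "inj_on (proj r) (keys G)" and F: "lsum F \<noteq> 0"
  shows "lsum (G * F) \<noteq> 0"
proof
  assume zero: "lsum (G * F) = 0"
  let ?K = "keys G"
  \<comment> \<open>Exponents whose class survives in \<open>lsum F\<close>; terms that cancel
    modulo \<open>L\<close> must not compete for the maximum.\<close>
  let ?W = "{x \<in> keys F. lookup (lsum F) (lat_class x) \<noteq> 0}"
  have W: "?W \<noteq> {}"
  proof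
    assume empty: "?W = {}"
    have "lookup (lsum F) C = 0" for C
      using empty lookup_lsum_not_class[of F C] by blast
    then show False using F by (auto simp: poly_mapping_eq_iff fun_eq_iff)
  qed
  obtain v0 where v0: "v0 \<in> ?K" "\<And>v. v \<in> ?K \<Longrightarrow> proj r v \<le> proj r v0"
    using ex_max_image[of ?K "proj r"] G by auto
  obtain b0 where b0: "b0 \<in> ?W" "\<And>x. x \<in> ?W \<Longrightarrow> proj r x \<le> proj r b0"
    using ex_max_image[OF _ W, of "proj r"] by auto
  \<comment> \<open>Any other \<open>v\<close> lies strictly below \<open>v0\<close>, so a nonzero
    contribution would come from an exponent in \<open>?W\<close> strictly above
    \<open>b0\<close>.\<close>
  have vanish: "lookup (lsum F) (lat_class (v0 + b0 - v)) = 0" if v: "v \<in> ?K" "v \<noteq> v0" for v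
  proof (rule ccontr)
    assume nz: "lookup (lsum F) (lat_class (v0 + b0 - v)) \<noteq> 0"
    then obtain x where x: "x \<in> keys F" "lat_class (v0 + b0 - v) = lat_class x"
      using lookup_lsum_not_class by metis
    then have "x \<in> ?W" using nz by simp
    then have le: "proj r x \<le> proj r b0" by (rule b0(2))
    have "proj r x = proj r (v0 + b0 - v)"
    proof -
      have "(v0 + b0 - v) - x \<in> L" using x(2) by (simp only: lat_class_eq_iff)
      then have "c l (v0 + b0 - v) = c l x" if "r \<le> l" "l < s" for l
        using c_L[OF _ that] by (metis c_diff eq_iff_diff_eq_0)
      then show ?thesis by (auto simp: proj_eq_iff)
    qed
    then have "proj r x + proj r v = proj r ((v0 + b0 - v) + v)" by (simp only: proj_add)
    then have "proj r x + proj r v = proj r b0 + proj r v0" by (simp add: proj_add add.commute)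
    moreover have "proj r v < proj r v0" using v v0 inj by (auto simp: inj_on_def less_le)
    ultimately show False using add_le_less_mono[OF le, of "proj r v" "proj r v0"] by simp
  qed
  have "lsum (G * F) = lsum (\<Sum>v\<in>?K. single v (lookup G v) * F)"
    by (simp only: sum_keys_single flip: sum_distrib_right)
  then have "lookup (lsum (G * F)) (lat_class (v0 + b0)) =
     (\<Sum>v\<in>?K. lookup G v * lookup (lsum F) (lat_class (v0 + b0 - v)))"
    by (simp add: lsum_sum lookup_sum lookup_lsum_mult)
  also have "\<dots> = (\<Sum>v\<in>{v0}. lookup G v * lookup (lsum F) (lat_class (v0 + b0 - v)))"
    using v0(1) vanish by (intro sum.mono_neutral_right) auto
  also have "\<dots> = lookup G v0 * lookup (lsum F) (lat_class b0)" by simp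
  finally show False using zero v0(1) b0(1) by (simp add: in_keys_iff)
qed

definition eigen :: "((nat \<Rightarrow>\<^sub>0 int) \<Rightarrow> 'e::field) \<Rightarrow> ((nat \<Rightarrow>\<^sub>0 int) \<Rightarrow>\<^sub>0 'e) \<Rightarrow> bool" where
  "eigen \<chi> F \<longleftrightarrow> (\<forall>a\<in>M. lsum ((single a 1 - single 0 (\<chi> a)) * F) = 0)"

text \<open>Against an eigenvector, each exponent of \<open>G\<close> can be moved to a
  representative of its class modulo \<open>M\<close> at the cost of a scalar. The resulting
  \<open>G'\<close> has exponents in distinct classes, so it annihilates the class of
  \<open>F\<close> only if it is 0.\<close>

lemma eigen_annihilator:
  fixes F G :: "(nat \<Rightarrow>\<^sub>0 int) \<Rightarrow>\<^sub>0 'e::field"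
  assumes "eigen \<chi> F" "lsum F \<noteq> 0" and \<chi>: "character \<chi>"
    and G: "\<And>x. x \<in> keys G \<Longrightarrow> keys x \<subseteq> {..<s}"
  shows "lsum (G * F) = 0 \<longleftrightarrow> push (\<lambda>x. x) (proj r) \<chi> G = 0"
proof -
  let ?K = "keys G"
  define \<sigma> where "\<sigma> x = (SOME y. y \<in> ?K \<and> proj r y = proj r x)" for x
  have \<sigma>: "\<sigma> x \<in> ?K \<and> proj r (\<sigma> x) = proj r x" if "x \<in> ?K" for x
    unfolding \<sigma>_def by (rule someI[of _ x]) (use that in simp)
  have \<sigma>_cong: "proj r x = proj r y \<Longrightarrow> \<sigma> x = \<sigma> y" for x y by (simp add: \<sigma>_def)
  note nz = characterD(2)[OF \<chi>]
  \<comment> \<open>The value \<chi>(x - \<sigma> x), by which the monomials of x and \<sigma> x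
    differ in their action on \<open>F\<close>.\<close>
  define \<theta> where "\<theta> x = \<chi> x / \<chi> (\<sigma> x)" for x
  define G' where "G' = push (\<lambda>x. x) \<sigma> \<theta> G"
  have keysG': "keys G' \<subseteq> \<sigma> ` ?K"
    unfolding G'_def push_def by (rule order.trans[OF keys_sum]) auto
  have inj: "inj_on (proj r) (keys G')"
    by (rule inj_on_subset[OF _ keysG']) (auto simp: inj_on_def \<sigma> intro!: \<sigma>_cong)
  have "lsum (G * F - G' * F) = 0"
  proof -
    have "G * F - G' * F = (\<Sum>x\<in>?K. single (\<sigma> x) (lookup G x) * ((single (x - \<sigma> x) 1 - single 0 (\<chi> (x - \<sigma> x))) * F))"
    proof -
      have "G - G' = (\<Sum>x\<in>?K. single x (lookup G x)) - G'" by (simp only: sum_keys_single)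
      also have "\<dots> = (\<Sum>x\<in>?K. single (\<sigma> x) (lookup G x) * (single (x - \<sigma> x) 1 - single 0 (\<chi> (x - \<sigma> x))))"
        unfolding G'_def push_def sum_subtractf[symmetric]
        by (rule sum.cong[OF refl]) (simp add: right_diff_distrib mult_single \<theta>_def character_diff[OF \<chi>])
      finally show ?thesis by (simp add: left_diff_distrib[symmetric] sum_distrib_right mult.assoc)
    qed
    moreover have "lsum (single (\<sigma> x) (lookup G x) * ((single (x - \<sigma> x) 1 - single 0 (\<chi> (x - \<sigma> x))) * F)) = 0"
      if x: "x \<in> ?K" for x
    proof (rule lsum_mult_zero)
      have "c l x = c l (\<sigma> x)" if "r \<le> l" "l < s" for l
        using \<sigma>[OF x] that by (metis proj_eq_iff)
      then have "x - \<sigma> x \<in> M" using keys_diff_sub[OF G[OF x] G[of "\<sigma> x"]] \<sigma>[OF x] by (simp add: M_def c_diff)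
      then show "lsum ((single (x - \<sigma> x) 1 - single 0 (\<chi> (x - \<sigma> x))) * F) = 0"
        using assms(1) by (simp add: eigen_def)
    qed
    ultimately show ?thesis by (simp add: lsum_sum)
  qed
  then have "lsum (G * F) = 0 \<longleftrightarrow> lsum (G' * F) = 0" by (simp add: lsum_diff)
  also have "\<dots> \<longleftrightarrow> G' = 0" using lsum_mult_nonzero[OF _ inj assms(2)] by auto
  also have "\<dots> \<longleftrightarrow> push (\<lambda>x. x) (proj r) \<chi> G = 0"
  proof
    assume "G' = 0"
    then have ker: "push (\<lambda>x. x) \<sigma> \<theta> G = 0" by (simp add: G'_def)
    show "push (\<lambda>x. x) (proj r) \<chi> G = 0"
    proof (rule push_coarsen[OF coeff_hom_id ker])
      show "\<theta> x \<noteq> 0" for x using nz by (simp add: \<theta>_def)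
      fix x y assume "x \<in> ?K" "y \<in> ?K" "\<sigma> x = \<sigma> y"
      then show "proj r x = proj r y \<and> \<chi> x * \<theta> y = \<chi> y * \<theta> x" using \<sigma> by (metis \<theta>_def mult.commute times_divide_eq_right)
    qed
  next
    assume ker: "push (\<lambda>x. x) (proj r) \<chi> G = 0"
    have "push (\<lambda>x. x) \<sigma> \<theta> G = 0"
    proof (rule push_coarsen[OF coeff_hom_id ker nz])
      fix x y assume "proj r x = proj r y"
      then show "\<sigma> x = \<sigma> y \<and> \<theta> x * \<chi> y = \<theta> y * \<chi> x" using \<sigma>_cong[of x y] by (simp add: \<theta>_def)
    qed
    then show "G' = 0" by (simp add: G'_def)
  qed
  finally show ?thesis .
qed

text \<open>Apply the linear factors of \<open>q\<close> to \<open>F\<close> one after the other, until the result vanishes.\<close>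

lemma eigenvalue_from_polynomial:
  fixes F :: "(nat \<Rightarrow>\<^sub>0 int) \<Rightarrow>\<^sub>0 'e::alg_closed_field"
  assumes "q \<noteq> 0" "lsum F \<noteq> 0" "lsum (poly (map_poly (single 0) q) (single a 1) * F) = 0"
  shows "\<exists>H \<zeta>. lsum (H * F) \<noteq> 0 \<and> lsum ((single a 1 - single 0 \<zeta>) * (H * F)) = 0"
  using assms
proof (induction "Polynomial.degree q" arbitrary: q)
  case 0
  then obtain k where k: "q = [:k:]" by (metis degree_0_id)
  then have "lsum (single 0 k * F) = 0" using 0 by (simp add: map_poly_pCons)
  then have "lsum (single 0 (inverse k) * (single 0 k * F)) = 0" by (rule lsum_mult_zero)
  then show ?case using 0 k by (simp add: mult.assoc[symmetric] mult_single)
next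
  case (Suc n)
  interpret coeff_hom "single 0 :: 'e \<Rightarrow> (nat \<Rightarrow>\<^sub>0 int) \<Rightarrow>\<^sub>0 'e" by (rule coeff_hom_single)
  obtain z where "poly q z = 0" using alg_closed_imp_poly_has_root[of q] Suc by auto
  then obtain q' where q': "q = [:- z, 1:] * q'" by (auto simp: poly_eq_0_iff_dvd)
  have q0: "q' \<noteq> 0" using q' Suc.prems by auto
  have "Polynomial.degree q = Suc (Polynomial.degree q')"
    unfolding q' using q0 by (subst degree_mult_eq) auto
  then have n: "n = Polynomial.degree q'" using Suc.hyps(2) by simp
  let ?E = "poly (map_poly (single 0) q') (single a 1)"
  have zero: "lsum ((single a 1 - single 0 z) * (?E * F)) = 0"
    using Suc.prems(3) unfolding q' poly_map_poly_linear_factor by (simp add: mult.assoc)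
  show ?case
  proof (cases "lsum (?E * F) = 0")
    case True
    then show ?thesis using Suc.hyps(1)[OF n q0 Suc.prems(2)] by blast
  next
    case False
    then show ?thesis using zero by blast
  qed
qed

text \<open>Modulo \<open>L\<close> the monomial with exponent \<open>a\<close> has N-th power 1, so
  X^N - 1 annihilates its action.\<close>

lemma ex_eigenvalue:
  fixes F :: "(nat \<Rightarrow>\<^sub>0 int) \<Rightarrow>\<^sub>0 'e::alg_closed_field"
  assumes "lsum F \<noteq> 0" "a \<in> M"
  shows "\<exists>H \<zeta>. lsum (H * F) \<noteq> 0 \<and> lsum ((single a 1 - single 0 \<zeta>) * (H * F)) = 0"
proof (rule eigenvalue_from_polynomial[OF _ assms(1)])
  let ?q = "Polynomial.monom 1 N - 1 :: 'e poly"
  have "poly ?q 0 \<noteq> 0" using N_pos by (simp add: poly_monom zero_power)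
  then show "?q \<noteq> 0" by auto
  have "map_poly (single 0) ?q = (Polynomial.monom 1 N - 1 :: ((nat \<Rightarrow>\<^sub>0 int) \<Rightarrow>\<^sub>0 'e) poly)"
    by (rule poly_eqI) (simp add: coeff_map_poly single_diff coeff_1)
  then have "poly (map_poly (single 0) ?q) (single a 1) = single (frag_cmul (int N) a) 1 - single 0 1"
    by (simp add: poly_monom single_power)
  moreover have "lat_class (frag_cmul (int N) a) = lat_class 0" using M_torsion[OF assms(2)] by (simp add: lat_class_eq_iff)
  then have "lsum (single (frag_cmul (int N) a) 1 - single 0 1 :: (nat \<Rightarrow>\<^sub>0 int) \<Rightarrow>\<^sub>0 'e) = 0"
    unfolding lsum_diff lsum_single by simp
  ultimately show "lsum (poly (map_poly (single 0) ?q) (single a 1) * F) = 0"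
    using lsum_mult_zero' by metis
qed

text \<open>The ring is commutative, so eigenvalues found earlier persist when the vector is
  multiplied again.\<close>

lemma ex_common_eigenvalues:
  fixes F :: "(nat \<Rightarrow>\<^sub>0 int) \<Rightarrow>\<^sub>0 'e::alg_closed_field"
  assumes "finite A" "A \<subseteq> M" "lsum F \<noteq> 0"
  shows "\<exists>H. lsum (H * F) \<noteq> 0 \<and> (\<forall>a\<in>A. \<exists>\<zeta>. lsum ((single a 1 - single 0 \<zeta>) * (H * F)) = 0)"
  using assms(1,2)
proof (induction A)
  case empty
  show ?case using assms(3) by (intro exI[of _ 1]) simp
next
  case (insert a A)
  then obtain H where H: "lsum (H * F) \<noteq> 0" "\<forall>a\<in>A. \<exists>\<zeta>. lsum ((single a 1 - single 0 \<zeta>) * (H * F)) = 0" by blast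
  obtain H' \<zeta> where H': "lsum (H' * (H * F)) \<noteq> 0" "lsum ((single a 1 - single 0 \<zeta>) * (H' * (H * F))) = 0"
    using ex_eigenvalue[OF H(1), of a] insert.prems by auto
  have "lsum ((single x 1 - single 0 \<xi>) * (H' * (H * F))) = 0"
    if "lsum ((single x 1 - single 0 \<xi>) * (H * F)) = 0" for x \<xi>
    using lsum_mult_zero[OF that, of H'] by (simp only: ac_simps)
  then have "\<forall>a\<in>A. \<exists>\<zeta>. lsum ((single a 1 - single 0 \<zeta>) * (H' * (H * F))) = 0"
    using H(2) by blast
  then show ?case using H' by (intro exI[of _ "H' * H"]) (simp only: mult.assoc ball_simps, blast)
qed

text \<open>Representatives of the finitely many torsion classes suffice, since the action depends
  only on the class. The eigenvalues are unique because the eigenvector is nonzero, and this makes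
  them multiplicative and trivial on \<open>L\<close>.\<close>

lemma ex_eigen_chars:
  fixes F :: "(nat \<Rightarrow>\<^sub>0 int) \<Rightarrow>\<^sub>0 'e::alg_closed_field"
  assumes "lsum F \<noteq> 0"
  shows "\<exists>H \<chi>. lsum (H * F) \<noteq> 0 \<and> \<chi> \<in> chars M \<and> eigen \<chi> (H * F)"
proof -
  obtain R where R: "finite R" "R \<subseteq> M" "lat_class ` R = lat_class ` M"
    using ex_class_reps[OF subset_refl] by blast
  obtain H where H: "lsum (H * F) \<noteq> 0" "\<forall>a\<in>R. \<exists>\<zeta>. lsum ((single a 1 - single 0 \<zeta>) * (H * F)) = 0"
    using ex_common_eigenvalues[OF R(1,2) assms] by blast
  define E where "E = H * F"
  have lsE: "lsum (single x 1 * E) = lsum (single y 1 * E)" if "lat_class x = lat_class y" for x y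
  proof -
    have "lsum (single x 1 - single y 1 :: (nat \<Rightarrow>\<^sub>0 int) \<Rightarrow>\<^sub>0 'e) = 0"
      using that by (simp add: lsum_diff lsum_single)
    from lsum_mult_zero'[OF this, of E] show ?thesis by (simp add: left_diff_distrib lsum_diff)
  qed
  have ex: "\<exists>\<zeta>. lsum (single a 1 * E) = lsum (single 0 \<zeta> * E)" if "a \<in> M" for a
  proof -
    obtain y where y: "y \<in> R" "lat_class a = lat_class y" using R(3) \<open>a \<in> M\<close> by (metis image_iff)
    obtain \<zeta> where "lsum ((single y 1 - single 0 \<zeta>) * E) = 0" using H(2) y(1) by (auto simp: E_def)
    then show ?thesis using lsE[OF y(2)] by (auto simp: left_diff_distrib lsum_diff)
  qed
  have E0: "lsum E \<noteq> 0" using H(1) by (simp add: E_def)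
  have scal: "lsum (single 0 \<zeta> * E) = pm_scale \<zeta> (lsum E)" for \<zeta>
    unfolding lsum_def coeff_hom.push_single_mult[OF coeff_hom_id]
    by (rule poly_mapping_eqI) (simp add: coeff_hom.lookup_push[OF coeff_hom_id] sum_distrib_left mult.commute)
  interpret V: vector_space "pm_scale :: 'e \<Rightarrow> ((nat \<Rightarrow>\<^sub>0 int) set \<Rightarrow>\<^sub>0 'e) \<Rightarrow> _" by (rule vector_space_pm_scale)
  obtain \<zeta> where \<zeta>: "\<And>a. a \<in> M \<Longrightarrow> lsum (single a 1 * E) = lsum (single 0 (\<zeta> a) * E)"
    using ex by metis
  have zeta_eqI: "\<zeta> a = k" if "a \<in> M" "lsum (single a 1 * E) = lsum (single 0 k * E)" for a k
    using \<zeta>[OF that(1)] that(2) E0 unfolding scal by simp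
  have one: "\<zeta> x = 1" if "x \<in> L" for x
  proof (rule zeta_eqI)
    show "lsum (single x 1 * E) = lsum (single 0 1 * E)"
      by (rule lsE) (use that in \<open>simp add: lat_class_eq_iff\<close>)
  qed (use that L_subset_M in blast)
  have mult: "\<zeta> (x + y) = \<zeta> x * \<zeta> y" if "x \<in> M" "y \<in> M" for x y
  proof (rule zeta_eqI[OF M_add[OF that]])
    have z: "lsum (single a 1 * E - single 0 (\<zeta> a) * E) = 0" if "a \<in> M" for a
      using \<zeta>[OF that] by (simp add: lsum_diff)
    \<comment> \<open>With x and y read as monomials: xy - \<zeta>(x) \<zeta>(y) = x (y -
      \<zeta>(y)) + \<zeta>(y) (x - \<zeta>(x)).\<close>
    have "lsum (single x 1 * (single y 1 * E - single 0 (\<zeta> y) * E)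
         + single 0 (\<zeta> y) * (single x 1 * E - single 0 (\<zeta> x) * E)) = 0"
      unfolding lsum_add lsum_mult_zero[OF z[OF that(1)]] lsum_mult_zero[OF z[OF that(2)]] by simp
    also have "single x 1 * (single y 1 * E - single 0 (\<zeta> y) * E)
         + single 0 (\<zeta> y) * (single x 1 * E - single 0 (\<zeta> x) * E)
       = single (x + y) 1 * E - single 0 (\<zeta> x * \<zeta> y) * E"
    proof -
      have "u * (v * E - w * E) + w * (u * E - z * E) = (u * v) * E - (z * w) * E" for u v w z
        by (simp add: algebra_simps)
      from this[of "single x 1" "single y 1" "single 0 (\<zeta> y)" "single 0 (\<zeta> x)"]
      show ?thesis by (simp add: mult_single)
    qed
    finally show "lsum (single (x + y) 1 * E) = lsum (single 0 (\<zeta> x * \<zeta> y) * E)"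
      by (simp add: lsum_diff)
  qed
  have nz: "\<zeta> x \<noteq> 0" if "x \<in> M" for x
    using mult[OF that M_uminus[OF that]] one[of 0] by auto
  have "zero_extend M \<zeta> \<in> chars M"
    by (rule zero_extend_chars[OF add_subgroup_M L_subset_M]) (auto simp: char_on_def mult nz one)
  moreover have "eigen (zero_extend M \<zeta>) E"
    using \<zeta> by (simp add: eigen_def zero_extend_def left_diff_distrib lsum_diff)
  ultimately show ?thesis using E0 unfolding E_def by blast
qed

text \<open>\<open>Qp\<close> takes a character of all exponents; fixing one extension for each
  character of \<open>M\<close> lets the primes be indexed by \<open>chars M\<close>.\<close>

definition char_extension :: "((nat \<Rightarrow>\<^sub>0 int) \<Rightarrow> 'e::alg_closed_field) \<Rightarrow> (nat \<Rightarrow>\<^sub>0 int) \<Rightarrow> 'e" where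
  "char_extension \<chi> = (SOME \<chi>'. character \<chi>' \<and> (\<forall>a\<in>M. \<chi>' a = \<chi> a))"

lemma char_extension:
  assumes "\<chi> \<in> chars M"
  shows "character (char_extension \<chi>)" "a \<in> M \<Longrightarrow> char_extension \<chi> a = \<chi> a" "x \<in> L \<Longrightarrow> char_extension \<chi> x = 1"
proof -
  have "\<exists>\<chi>'. character \<chi>' \<and> (\<forall>a\<in>M. \<chi>' a = \<chi> a)"
    using character_extension[OF add_subgroup_M, of \<chi> s] assms M_carrier by (auto simp: chars_def)
  then have "character (char_extension \<chi>) \<and> (\<forall>a\<in>M. char_extension \<chi> a = \<chi> a)" unfolding char_extension_def by (rule someI_ex)
  then show "character (char_extension \<chi>)" and *: "\<And>a. a \<in> M \<Longrightarrow> char_extension \<chi> a = \<chi> a" by auto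
  show "x \<in> L \<Longrightarrow> char_extension \<chi> x = 1" using * L_subset_M assms by (auto simp: chars_def)
qed

lemma eigen_char_extension: "\<chi> \<in> chars M \<Longrightarrow> eigen \<chi> F \<Longrightarrow> eigen (char_extension \<chi>) F"
  by (simp add: eigen_def char_extension(2))

lemma eigen_annihilator_Qp:
  assumes "\<chi> \<in> chars M" "eigen \<chi> F" "lsum F \<noteq> 0" "g \<in> pcarrier s"
  shows "lsum (laurent g * F) = 0 \<longleftrightarrow> g \<in> Qp r (char_extension \<chi>)"
proof -
  have "keys x \<subseteq> {..<s}" if "x \<in> keys (laurent g)" for x
    using keys_laurent[OF that] assms(4) by (fastforce simp: pcarrier_iff)
  then have "lsum (laurent g * F) = 0 \<longleftrightarrow> push (\<lambda>x. x) (proj r) (char_extension \<chi>) (laurent g) = 0"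
    by (rule eigen_annihilator[OF eigen_char_extension[OF assms(1,2)] assms(3) char_extension(1)[OF assms(1)]])
  then show ?thesis using assms(4) by (simp add: Qp_def push_kernel_def mpoly_push_laurent)
qed

text \<open>Multiplying by \<open>H\<close> can only enlarge the annihilator, so the eigenvector
  yields just an inclusion of \<open>P\<close> in some Q(\<chi>). It is an equality because no prime
  over the lattice ideal lies properly below Q(\<chi>).\<close>

lemma associated_prime_is_Qp:
  assumes "P \<in> associated_primes (mpoly_ring s) (lattice_ideal s L :: 'k::field mpoly set)"
  shows "\<exists>\<chi>\<in>chars M. P = Qp r (char_extension \<chi>)"
proof -
  obtain f where P: "primeideal P (mpoly_ring s)" and f: "f \<in> pcarrier s"
    "P = {g \<in> pcarrier s. g * f \<in> lattice_ideal s L}"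
    using assms by (auto simp: associated_primes_def mpoly_ring_simps(2))
  have "1 \<notin> P" by (rule primeideal_mpolyD(2)[OF P])
  then have "f \<notin> lattice_ideal s L" using f(2) cring_closed(4)[of s, where ?'k = 'k] by simp
  then have "lsum (laurent f) \<noteq> 0" using f(1) by (simp add: lattice_ideal_iff lsum_laurent)
  then obtain H \<chi> where H: "lsum (H * laurent f) \<noteq> 0" "\<chi> \<in> chars M" "eigen \<chi> (H * laurent f)"
    using ex_eigen_chars by blast
  have "P \<subseteq> Qp r (char_extension \<chi>)"
  proof
    fix g assume g: "g \<in> P"
    then have gf: "g \<in> pcarrier s" "g * f \<in> lattice_ideal s L" using f(2) by auto
    then have "lsum (laurent g * laurent f) = 0" by (simp add: lattice_ideal_iff lsum_laurent flip: laurent_mult)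
    then have "lsum (H * (laurent g * laurent f)) = 0" by (rule lsum_mult_zero)
    then have "lsum (laurent g * (H * laurent f)) = 0" by (simp add: ac_simps)
    then show "g \<in> Qp r (char_extension \<chi>)" using eigen_annihilator_Qp[OF H(2,3,1) gf(1)] by simp
  qed
  moreover have "lattice_ideal s L \<subseteq> P"
  proof
    fix g :: "'k mpoly" assume g: "g \<in> lattice_ideal s L"
    then have "g \<in> pcarrier s" by (simp add: lattice_ideal_iff)
    moreover have "f * g \<in> lattice_ideal s L" by (rule ideal_mpolyD(4)[OF ideal_lattice_ideal g f(1)])
    ultimately show "g \<in> P" using f(2) by (simp add: mult.commute)
  qed
  ultimately have "P = Qp r (char_extension \<chi>)" using Qp_incomparable[OF char_extension(1)[OF H(2)] P] by blast
  then show ?thesis using H(2) by blast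
qed

text \<open>Adding \<open>a\<close> permutes the representatives modulo \<open>L\<close>, and the
  inverse values of \<chi> turn this permutation into the scalar \<chi>(a). The sum is not divided
  by |T|, which may vanish in K.\<close>

lemma Qp_associated:
  assumes ac: "field_alg_closed TYPE('k::field)" and \<chi>: "\<chi> \<in> chars M"
  shows "Qp r (char_extension \<chi>) \<in> associated_primes (mpoly_ring s) (lattice_ideal s L :: 'k mpoly set)"
proof -
  obtain R where R: "finite R" "R \<subseteq> M" "inj_on lat_class R" "lat_class ` R = lat_class ` M"
    using ex_class_reps[OF subset_refl] by blast
  obtain D e where e_carrier: "\<And>\<tau>. \<tau> \<in> R \<Longrightarrow> keys (e \<tau>) \<subseteq> {..<s}"
    and emb_e: "\<And>\<tau>. \<tau> \<in> R \<Longrightarrow> emb (e \<tau>) = emb D + \<tau>"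
    using ex_nonneg_shift[OF R(1), of s] R(2) M_carrier by blast
  \<comment> \<open>The shift by \<open>D\<close> makes the exponents nonnegative, and closedness of
    K brings the coefficients back from the closure.\<close>
  define f where "f = (\<Sum>\<tau>\<in>R. single (e \<tau>) (of_ac (inverse (\<chi> \<tau>))) :: 'k mpoly)"
  have f_carrier: "f \<in> pcarrier s"
    unfolding f_def using e_carrier by (intro pcarrier_sum pcarrier_single) auto
  have laurent_f: "laurent f = (\<Sum>\<tau>\<in>R. single (emb D + \<tau>) (inverse (\<chi> \<tau>)))"
    unfolding f_def laurent_def
    by (simp add: coeff_hom.push_sum[OF coeff_hom_to_ac] coeff_hom.push_single[OF coeff_hom_to_ac]
        emb_e to_ac_of_ac[OF to_ac_surj[OF ac]])
  have ch: "char_on M \<chi>" and one: "\<And>x. x \<in> L \<Longrightarrow> \<chi> x = 1" using \<chi> by (auto simp: chars_def)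
  have \<chi>_class: "\<chi> x = \<chi> y" if "lat_class x = lat_class y" "x \<in> M" "y \<in> M" for x y
    using char_on_diff[OF add_subgroup_M ch that(2,3)] one[of "x - y"] that char_onD(2)[OF ch that(3)]
    by (simp add: lat_class_eq_iff)
  have "eigen \<chi> (laurent f)"
    unfolding eigen_def
  proof
    fix a assume a: "a \<in> M"
    have "\<exists>\<sigma>. \<forall>\<tau>\<in>R. \<sigma> \<tau> \<in> R \<and> lat_class (\<sigma> \<tau>) = lat_class (a + \<tau>)"
    proof (rule bchoice, rule ballI)
      fix \<tau> assume "\<tau> \<in> R"
      then have "a + \<tau> \<in> M" using a R(2) M_add by blast
      then show "\<exists>y. y \<in> R \<and> lat_class y = lat_class (a + \<tau>)" using R(4) by (metis image_iff)
    qed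
    then obtain \<sigma> where \<sigma>: "\<And>\<tau>. \<tau> \<in> R \<Longrightarrow> \<sigma> \<tau> \<in> R" "\<And>\<tau>. \<tau> \<in> R \<Longrightarrow> lat_class (\<sigma> \<tau>) = lat_class (a + \<tau>)" by blast
    have "inj_on \<sigma> R"
    proof (rule inj_onI)
      fix \<tau> \<tau>' assume t: "\<tau> \<in> R" "\<tau>' \<in> R" "\<sigma> \<tau> = \<sigma> \<tau>'"
      then have "lat_class (a + \<tau>) = lat_class (a + \<tau>')" using \<sigma>(2)[of \<tau>] \<sigma>(2)[of \<tau>'] by simp
      then have "lat_class \<tau> = lat_class \<tau>'" by (simp add: lat_class_eq_iff)
      then show "\<tau> = \<tau>'" using R(3) t by (auto simp: inj_on_def)
    qed
    then have bij: "bij_betw \<sigma> R R" using R(1) \<sigma>(1) endo_inj_surj[of R \<sigma>] by (auto simp: bij_betw_def)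
    have "lsum (single a 1 * laurent f) = (\<Sum>\<tau>\<in>R. single (lat_class (emb D + \<sigma> \<tau>)) (\<chi> a * inverse (\<chi> (\<sigma> \<tau>))))"
      unfolding laurent_f sum_distrib_left lsum_sum
    proof (rule sum.cong[OF refl])
      fix \<tau> assume t: "\<tau> \<in> R"
      then have tM: "\<tau> \<in> M" "\<sigma> \<tau> \<in> M" using R(2) \<sigma>(1) by auto
      have "\<chi> (\<sigma> \<tau>) = \<chi> a * \<chi> \<tau>"
        using \<chi>_class[OF \<sigma>(2)[OF t] tM(2) M_add[OF a tM(1)]] char_onD(1)[OF ch a tM(1)] by simp
      then have "inverse (\<chi> \<tau>) = \<chi> a * inverse (\<chi> (\<sigma> \<tau>))"
        using char_onD(2)[OF ch a] by simp
      moreover have "lat_class (a + (emb D + \<tau>)) = lat_class (emb D + \<sigma> \<tau>)"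
        using lat_class_add[OF \<sigma>(2)[OF t], of "emb D"] by (simp add: ac_simps)
      ultimately show "lsum (single a 1 * single (emb D + \<tau>) (inverse (\<chi> \<tau>))) =
        single (lat_class (emb D + \<sigma> \<tau>)) (\<chi> a * inverse (\<chi> (\<sigma> \<tau>)))"
        by (simp add: mult_single lsum_single)
    qed
    also have "\<dots> = (\<Sum>\<tau>\<in>R. single (lat_class (emb D + \<tau>)) (\<chi> a * inverse (\<chi> \<tau>)))"
      by (rule sum.reindex_bij_betw[OF bij])
    also have "\<dots> = lsum (single 0 (\<chi> a) * laurent f)"
      unfolding laurent_f sum_distrib_left lsum_sum by (simp add: mult_single lsum_single)
    finally show "lsum ((single a 1 - single 0 (\<chi> a)) * laurent f) = 0"
      by (simp add: left_diff_distrib lsum_diff)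
  qed
  moreover have "lsum (laurent f) \<noteq> 0"
  proof
    assume z: "lsum (laurent f) = 0"
    \<comment> \<open>The shifted representatives lie in distinct classes, so the coefficient at any
      one of them is a single nonzero value.\<close>
    obtain \<tau>0 where t0: "\<tau>0 \<in> R" using imageI[OF M_zero, of lat_class] unfolding R(4)[symmetric] by blast
    have "lookup (lsum (laurent f)) (lat_class (emb D + \<tau>0)) = (\<Sum>\<tau>\<in>R. if \<tau> = \<tau>0 then inverse (\<chi> \<tau>) else 0)"
      unfolding laurent_f lsum_sum lookup_sum lsum_single
    proof (rule sum.cong[OF refl])
      fix \<tau> assume "\<tau> \<in> R"
      then have "lat_class (emb D + \<tau>) = lat_class (emb D + \<tau>0) \<longleftrightarrow> \<tau> = \<tau>0"
        using R(3) t0 by (auto simp: lat_class_eq_iff inj_on_def)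
      then show "lookup (single (lat_class (emb D + \<tau>)) (inverse (\<chi> \<tau>))) (lat_class (emb D + \<tau>0)) = (if \<tau> = \<tau>0 then inverse (\<chi> \<tau>) else 0)"
        by (auto simp: lookup_single when_def)
    qed
    also have "\<dots> = inverse (\<chi> \<tau>0)" using t0 R(1) by simp
    finally show False using z char_onD(2)[OF ch, of \<tau>0] t0 R(2) by auto
  qed
  ultimately have ann: "lsum (laurent g * laurent f) = 0 \<longleftrightarrow> g \<in> Qp r (char_extension \<chi>)" if "g \<in> pcarrier s" for g
    using eigen_annihilator_Qp[OF \<chi> _ _ that] by blast
  have "Qp r (char_extension \<chi>) = {g \<in> pcarrier s. g * f \<in> lattice_ideal s L}"
  proof (intro equalityI subsetI)
    fix g assume g: "g \<in> Qp r (char_extension \<chi>)"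
    then have gc: "g \<in> pcarrier s" by (simp add: Qp_def push_kernel_def)
    then show "g \<in> {g \<in> pcarrier s. g * f \<in> lattice_ideal s L}"
      using ann[OF gc] g f_carrier by (simp add: lattice_ideal_iff cring_closed flip: lsum_laurent laurent_mult)
  next
    fix g assume "g \<in> {g \<in> pcarrier s. g * f \<in> lattice_ideal s L}"
    then show "g \<in> Qp r (char_extension \<chi>)" using ann[of g] by (simp add: lattice_ideal_iff flip: lsum_laurent laurent_mult)
  qed
  then show ?thesis
    using primeideal_Qp[OF char_extension(1)[OF \<chi>]] f_carrier unfolding associated_primes_def mpoly_ring_simps(2) by blast
qed

text \<open>For \<open>a\<close> in \<open>M\<close> the binomial with coefficient \<chi>(a) lies in
  the prime of \<chi>' exactly when \<chi>'(a) = \<chi>(a). Closedness of K provides that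
  coefficient in K.\<close>

lemma Qp_char_extension_inj:
  assumes ac: "field_alg_closed TYPE('k::field)" and \<chi>: "\<chi> \<in> chars M" "\<chi>' \<in> chars M"
    and eq: "Qp r (char_extension \<chi>) = (Qp r (char_extension \<chi>') :: 'k mpoly set)"
  shows "\<chi> = \<chi>'"
proof (rule chars_eqI[OF \<chi>])
  fix a assume a: "a \<in> M"
  obtain k :: 'k where k: "to_ac k = \<chi> a" using to_ac_surj[OF ac, of "\<chi> a"] by auto
  define g where "g = (mon (pos_part a) - single (neg_part a) k :: 'k mpoly)"
  have split: "emb (pos_part a) = a + emb (neg_part a)" using emb_pos_neg[of a] by (simp add: algebra_simps)
  have pr: "proj r (a + x) = proj r x" for x using a by (simp add: proj_add M_iff_proj)
  have push: "mpoly_push (proj r) (char_extension \<xi>) g = single (proj r (emb (neg_part a))) ((\<xi> a - \<chi> a) * char_extension \<xi> (emb (neg_part a)))"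
    if "\<xi> \<in> chars M" for \<xi>
    by (simp add: g_def mpoly_push_diff mpoly_push_single k split pr characterD(1)[OF char_extension(1)[OF that]] char_extension(2)[OF that a]
        left_diff_distrib flip: single_diff)
  have "g \<in> pcarrier s" unfolding g_def using keys_pos_part[of a] keys_neg_part[of a] M_carrier[OF a]
    by (intro pcarrier_diff pcarrier_single) auto
  then have "g \<in> Qp r (char_extension \<chi>)" using push[OF \<chi>(1)] by (simp add: Qp_def push_kernel_def)
  then have "g \<in> Qp r (char_extension \<chi>')" by (simp only: eq)
  then have "mpoly_push (proj r) (char_extension \<chi>') g = 0" by (simp add: Qp_def push_kernel_def)
  then have "(\<chi>' a - \<chi> a) * char_extension \<chi>' (emb (neg_part a)) = 0"
    unfolding push[OF \<chi>(2)] by (metis lookup_single_eq lookup_zero)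
  then show "\<chi> a = \<chi>' a" using characterD(2)[OF char_extension(1)[OF \<chi>(2)]] by simp
qed

text \<open>Over a general field the characters only cover the associated primes, possibly with
  repetitions; over a closed field the correspondence is bijective.\<close>

lemma associated_primes_lattice_ideal:
  defines "As \<equiv> associated_primes (mpoly_ring s) (lattice_ideal s L :: 'k::field mpoly set)"
  shows "finite As" "card As \<le> card (lat_class ` coprime_part CHAR('k))"
    "field_alg_closed TYPE('k) \<Longrightarrow> card As = card (lat_class ` coprime_part CHAR('k))"
    "P \<in> As \<Longrightarrow> prime_height (mpoly_ring s) P = enat r"
proof -
  let ?X = "chars M :: (_ \<Rightarrow> 'k alg_closure) set"
  let ?Q = "\<lambda>\<chi>. Qp r (char_extension \<chi>) :: 'k mpoly set"
  have X: "finite ?X" "card ?X = card (lat_class ` coprime_part CHAR('k))"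
    using card_chars_M[where ?'e = "'k alg_closure"] by auto
  have sub: "As \<subseteq> ?Q ` ?X" using associated_prime_is_Qp unfolding As_def by blast
  then show "finite As" using X(1) finite_subset by blast
  show "card As \<le> card (lat_class ` coprime_part CHAR('k))"
    using card_mono[OF finite_imageI[OF X(1)] sub] card_image_le[OF X(1), of ?Q] X(2) by linarith
  show "P \<in> As \<Longrightarrow> prime_height (mpoly_ring s) P = enat r"
    using sub prime_height_Qp char_extension by blast
  assume ac: "field_alg_closed TYPE('k)"
  have "As = ?Q ` ?X" using sub Qp_associated[OF ac] unfolding As_def by blast
  moreover have "inj_on ?Q ?X" using Qp_char_extension_inj[OF ac] by (auto simp: inj_on_def)
  ultimately show "card As = card (lat_class ` coprime_part CHAR('k))" using card_image X(2) by metis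
qed

end

section \<open>Stanley decompositions\<close>

text \<open>Coordinates are treated in turn by passing to monotone subsequences; a decreasing
  sequence of naturals becomes constant, hence increasing.\<close>

lemma dickson_subsequence:
  fixes f :: "nat \<Rightarrow> (nat \<Rightarrow>\<^sub>0 nat)"
  shows "\<exists>\<phi>. strict_mono \<phi> \<and> (\<forall>j<n. incseq (\<lambda>i. lookup (f (\<phi> i)) j))"
proof (induction n)
  case 0
  show ?case by (intro exI[of _ "\<lambda>x. x"]) (simp add: strict_mono_def)
next
  case (Suc n)
  then obtain \<phi> where \<phi>: "strict_mono \<phi>" "\<forall>j<n. incseq (\<lambda>i. lookup (f (\<phi> i)) j)" by blast
  obtain \<psi> where \<psi>: "strict_mono \<psi>" "monoseq (\<lambda>i. lookup (f (\<phi> (\<psi> i))) n)"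
    using seq_monosub[of "\<lambda>i. lookup (f (\<phi> i)) n"] by blast
  have sub: "incseq (\<lambda>i. lookup (f (\<phi> (\<psi> (\<theta> i)))) j)" if "strict_mono \<theta>" "j < n" for \<theta> j
    using \<phi>(2) that \<psi>(1) by (auto simp: incseq_def strict_mono_less_eq)
  show ?case
  proof (cases "incseq (\<lambda>i. lookup (f (\<phi> (\<psi> i))) n)")
    case True
    then show ?thesis
      using sub[of "\<lambda>x. x"] \<phi>(1) \<psi>(1)
      by (intro exI[of _ "\<lambda>i. \<phi> (\<psi> i)"]) (auto simp: less_Suc_eq strict_mono_def)
  next
    case False
    then have dec: "decseq (\<lambda>i. lookup (f (\<phi> (\<psi> i))) n)" using \<psi>(2) by (auto simp: monoseq_iff)
    define v where "v = (LEAST v. \<exists>i. lookup (f (\<phi> (\<psi> i))) n = v)"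
    have "\<exists>i. lookup (f (\<phi> (\<psi> i))) n = v" unfolding v_def by (rule LeastI_ex) blast
    then obtain i0 where i0: "lookup (f (\<phi> (\<psi> i0))) n = v" by blast
    have const: "lookup (f (\<phi> (\<psi> (i + i0)))) n = v" for i
    proof (rule antisym)
      show "lookup (f (\<phi> (\<psi> (i + i0)))) n \<le> v" using decseqD[OF dec, of i0 "i + i0"] i0 by simp
      show "v \<le> lookup (f (\<phi> (\<psi> (i + i0)))) n" unfolding v_def by (rule Least_le) blast
    qed
    have shift: "strict_mono (\<lambda>i. i + i0)" by (simp add: strict_mono_def)
    show ?thesis
      using sub[OF shift] const \<phi>(1) \<psi>(1)
      by (intro exI[of _ "\<lambda>i. \<phi> (\<psi> (i + i0))"]) (auto simp: less_Suc_eq incseq_const strict_mono_def)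
  qed
qed

definition down_closed :: "('a \<Rightarrow>\<^sub>0 nat) set \<Rightarrow> bool" where
  "down_closed D \<longleftrightarrow> (\<forall>m d. m + d \<in> D \<longrightarrow> m \<in> D)"

text \<open>Otherwise choose elements that leave the sets one after another. By Dickson's lemma an
  earlier one divides a later one, and down-closure puts it back into a set that it had
  left.\<close>

lemma down_closed_chain_stabilizes:
  fixes D :: "nat \<Rightarrow> (nat \<Rightarrow>\<^sub>0 nat) set"
  assumes "\<And>t. down_closed (D t)" "\<And>t m. m \<in> D t \<Longrightarrow> keys m \<subseteq> {..<n}" "decseq D"
  shows "\<exists>t0. \<forall>t\<ge>t0. D t = D t0"
proof (rule ccontr)
  assume "\<not> ?thesis"
  then have "\<forall>t0. \<exists>t\<ge>t0. D t \<noteq> D t0" by blast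
  then have "\<forall>t0. \<exists>t>t0. D t \<subset> D t0"
    using assms(3) by (metis decseqD le_neq_implies_less psubsetI)
  then have "\<forall>t0. \<exists>t m. t > t0 \<and> m \<in> D t0 \<and> m \<notin> D t" by blast
  then obtain g h where gh: "\<And>t0. g t0 > t0" "\<And>t0. h t0 \<in> D t0" "\<And>t0. h t0 \<notin> D (g t0)" by metis
  define a where "a i = (g ^^ i) 0" for i
  have a_Suc: "a (Suc i) = g (a i)" for i by (simp add: a_def)
  have a_mono: "strict_mono a" unfolding strict_mono_Suc_iff using gh(1) by (simp add: a_Suc)
  obtain \<phi> where \<phi>: "strict_mono \<phi>" "\<forall>j<n. incseq (\<lambda>i. lookup (h (a (\<phi> i))) j)"
    using dickson_subsequence[of n "\<lambda>i. h (a i)"] by blast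
  define x where "x = h (a (\<phi> 0))"
  define y where "y = h (a (\<phi> 1))"
  have "lookup x j \<le> lookup y j" for j
  proof (cases "j < n")
    case True
    then show ?thesis using \<phi>(2) by (auto simp: x_def y_def incseq_def)
  next
    case False
    then have "lookup x j = 0" using assms(2)[OF gh(2)[of "a (\<phi> 0)"]] by (auto simp: x_def in_keys_iff)
    then show ?thesis by simp
  qed
  then have xy: "y = x + (y - x)" by (intro poly_mapping_eqI) (simp add: lookup_add lookup_minus)
  have "\<phi> 0 < \<phi> 1" using \<phi>(1) by (simp add: strict_mono_def)
  then have "a (Suc (\<phi> 0)) \<le> a (\<phi> 1)" using a_mono by (simp add: strict_mono_less_eq)
  then have "D (a (\<phi> 1)) \<subseteq> D (g (a (\<phi> 0)))" using decseqD[OF assms(3)] a_Suc by metis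
  then have "y \<in> D (g (a (\<phi> 0)))" using gh(2) by (auto simp: y_def)
  then have "x \<in> D (g (a (\<phi> 0)))" using assms(1) xy unfolding down_closed_def by metis
  then show False using gh(3) by (simp add: x_def)
qed

definition orthant :: "(nat \<Rightarrow>\<^sub>0 nat) \<Rightarrow> nat set \<Rightarrow> (nat \<Rightarrow>\<^sub>0 nat) set" where
  "orthant x J = {x + m | m. keys m \<subseteq> J}"

text \<open>Finite disjoint unions of orthants (Stanley decompositions).\<close>

inductive stanley :: "(nat \<Rightarrow>\<^sub>0 nat) set \<Rightarrow> bool" where
  stanley_empty: "stanley {}"
| stanley_insert: "stanley D \<Longrightarrow> finite J \<Longrightarrow> D \<inter> orthant x J = {} \<Longrightarrow> stanley (D \<union> orthant x J)"

lemma stanley_orthant: "finite J \<Longrightarrow> stanley (orthant x J)"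
  using stanley_insert[OF stanley_empty, of J x] by simp

lemma stanley_Un:
  assumes "stanley B" "stanley A" "A \<inter> B = {}"
  shows "stanley (A \<union> B)"
  using assms
proof (induction rule: stanley.induct)
  case (stanley_insert D J x)
  then have "stanley ((A \<union> D) \<union> orthant x J)" by (intro stanley.stanley_insert) auto
  then show ?case by (simp add: Un_assoc)
qed simp

lemma stanley_UN_lessThan:
  assumes "\<And>t. t < n \<Longrightarrow> stanley (A t)" "\<And>t u. t < u \<Longrightarrow> u < n \<Longrightarrow> A t \<inter> A u = {}"
  shows "stanley (\<Union>t<(n::nat). A t)"
  using assms
proof (induction n)
  case 0
  show ?case by (simp add: stanley_empty)
next
  case (Suc n)
  have "stanley ((\<Union>t<n. A t) \<union> A n)"
    using Suc by (intro stanley_Un) auto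
  then show ?case by (simp add: lessThan_Suc Un_commute)
qed

lemma stanley_translate:
  assumes "stanley D"
  shows "stanley ((+) a ` D)"
  using assms
proof (induction rule: stanley.induct)
  case (stanley_insert D J x)
  have "(+) a ` orthant x J = orthant (a + x) J" by (auto simp: orthant_def image_iff add.assoc)
  moreover have "(+) a ` D \<inter> (+) a ` orthant x J = {}" using stanley_insert(3) by auto
  ultimately show ?case using stanley_insert by (auto simp: image_Un intro: stanley.stanley_insert)
qed (simp add: stanley_empty)

definition cylinder :: "nat \<Rightarrow> nat \<Rightarrow> (nat \<Rightarrow>\<^sub>0 nat) set \<Rightarrow> (nat \<Rightarrow>\<^sub>0 nat) set" where
  "cylinder n t0 D = {single n t + a | t a. t0 \<le> t \<and> a \<in> D}"

lemma add_single_unique: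
  assumes "n \<notin> keys a" "n \<notin> keys a'" "single n t + a = single n t' + (a' :: nat \<Rightarrow>\<^sub>0 nat)"
  shows "t = t' \<and> a = a'"
proof -
  have "t = t'" using arg_cong[OF assms(3), of "\<lambda>v. lookup v n"] assms(1,2) by (simp add: lookup_add in_keys_iff)
  then show ?thesis using assms(3) by simp
qed

lemma split_single:
  fixes m :: "nat \<Rightarrow>\<^sub>0 nat"
  assumes "keys m \<subseteq> insert n J"
  shows "\<exists>t a. m = single n t + a \<and> n \<notin> keys a \<and> keys a \<subseteq> J"
proof -
  define a where "a = Poly_Mapping.update n 0 m"
  have lookup_a: "lookup a j = (if j = n then 0 else lookup m j)" for j
    by (simp add: a_def lookup_update)
  have "m = single n (lookup m n) + a"
    by (rule poly_mapping_eqI) (simp add: lookup_add lookup_a lookup_single when_def)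
  moreover have "n \<notin> keys a" by (simp add: in_keys_iff lookup_a)
  moreover have "keys a \<subseteq> J"
    using assms by (auto simp: in_keys_iff lookup_a subset_iff split: if_splits)
  ultimately show ?thesis by blast
qed

text \<open>Each orthant of \<open>D\<close> becomes an orthant with \<open>n\<close> as one more
  free direction.\<close>

lemma stanley_cylinder:
  assumes "stanley D" "\<And>a. a \<in> D \<Longrightarrow> n \<notin> keys a"
  shows "stanley (cylinder n t0 D)"
  using assms
proof (induction rule: stanley.induct)
  case stanley_empty
  show ?case by (simp add: cylinder_def stanley.stanley_empty)
next
  case (stanley_insert D J x)
  have x: "n \<notin> keys (x + m)" if "keys m \<subseteq> J" for m
    using stanley_insert.prems that by (auto simp: orthant_def)
  have eq: "cylinder n t0 (orthant x J) = orthant (single n t0 + x) (insert n J)"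
  proof (intro equalityI subsetI)
    fix z assume "z \<in> cylinder n t0 (orthant x J)"
    then obtain t m where z: "t0 \<le> t" "keys m \<subseteq> J" "z = single n t + (x + m)"
      by (auto simp: cylinder_def orthant_def)
    have "z = (single n t0 + x) + (single n (t - t0) + m)"
      using z(1) by (simp add: z(3) add_ac) (simp add: single_add[symmetric] flip: add.assoc)
    moreover have "keys (single n (t - t0) + m) \<subseteq> insert n J"
      using Poly_Mapping.keys_add[of "single n (t - t0)" m] z(2) by (auto split: if_splits)
    ultimately show "z \<in> orthant (single n t0 + x) (insert n J)" unfolding orthant_def by blast
  next
    fix z assume "z \<in> orthant (single n t0 + x) (insert n J)"
    then obtain m where m: "keys m \<subseteq> insert n J" "z = (single n t0 + x) + m" by (auto simp: orthant_def)
    obtain t a where t: "m = single n t + a" "keys a \<subseteq> J" using split_single[OF m(1)] by blast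
    have "z = single n (t0 + t) + (x + a)" by (simp add: m(2) t(1) single_add add_ac)
    then show "z \<in> cylinder n t0 (orthant x J)" using t(2) unfolding cylinder_def orthant_def by (auto intro!: exI[of _ "t0 + t"])
  qed
  have un: "cylinder n t0 (D \<union> orthant x J) = cylinder n t0 D \<union> cylinder n t0 (orthant x J)"
    by (auto simp: cylinder_def)
  have "cylinder n t0 D \<inter> cylinder n t0 (orthant x J) = {}"
  proof (rule ccontr)
    assume "\<not> ?thesis"
    then obtain t a t' a' where h: "a \<in> D" "a' \<in> orthant x J" "single n t + a = single n t' + a'"
      by (auto simp: cylinder_def)
    then have "a = a'" using add_single_unique stanley_insert.prems by (metis UnCI)
    then show False using h stanley_insert.hyps(3) by blast
  qed
  then show ?case using stanley_insert unfolding un eq by (intro stanley.stanley_insert) auto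
qed

text \<open>The slices by the exponent of the last variable form a decreasing sequence of
  down-closed sets. It is constant from some \<open>t0\<close> on, which leaves finitely many
  translated slices and one cylinder.\<close>

lemma stanley_down_closed:
  assumes "down_closed D" "\<And>m. m \<in> D \<Longrightarrow> keys m \<subseteq> {..<n}"
  shows "stanley D"
  using assms
proof (induction n arbitrary: D)
  case 0
  then have "D \<subseteq> {0}" by auto
  moreover have "{0} = orthant 0 {}" by (auto simp: orthant_def)
  ultimately show ?case using stanley_empty stanley_orthant[of "{}" 0] by (metis finite.emptyI subset_singleton_iff)
next
  case (Suc n)
  define S where "S t = {a. keys a \<subseteq> {..<n} \<and> single n t + a \<in> D}" for t
  have down: "down_closed (S t)" for t
    unfolding down_closed_def
  proof (intro allI impI)
    fix m d assume md: "m + d \<in> S t"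
    then have "single n t + m \<in> D"
      using Suc.prems(1) unfolding S_def down_closed_def by (metis (mono_tags, lifting) add.assoc mem_Collect_eq)
    moreover have "keys m \<subseteq> keys (m + d)" by (auto simp: in_keys_iff lookup_add)
    ultimately show "m \<in> S t" using md by (auto simp: S_def)
  qed
  have keys: "keys m \<subseteq> {..<n}" if "m \<in> S t" for m t using that by (simp add: S_def)
  have dec: "decseq S"
  proof (rule decseq_SucI, rule subsetI)
    fix t m assume "m \<in> S (Suc t)"
    moreover have "single n (Suc t) + m = (single n t + m) + single n 1"
      using single_add[of n t 1] by (simp add: add_ac)
    ultimately show "m \<in> S t" using Suc.prems(1) unfolding S_def down_closed_def by auto
  qed
  obtain t0 where t0: "\<And>t. t \<ge> t0 \<Longrightarrow> S t = S t0" using down_closed_chain_stabilizes[of S n, OF down _ dec] keys by blast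
  have st: "stanley (S t)" for t by (rule Suc.IH[OF down keys])
  have nk: "n \<notin> keys a" if "a \<in> S t" for a t using keys[OF that] by auto
  have D: "D = (\<Union>t<t0. (+) (single n t) ` S t) \<union> cylinder n t0 (S t0)"
  proof (intro equalityI subsetI)
    fix m assume m: "m \<in> D"
    have "keys m \<subseteq> insert n {..<n}" using Suc.prems(2)[OF m] by (auto simp: less_Suc_eq)
    then obtain t a where t: "m = single n t + a" "keys a \<subseteq> {..<n}" using split_single by metis
    then have "a \<in> S t" using m by (simp add: S_def)
    show "m \<in> (\<Union>t<t0. (+) (single n t) ` S t) \<union> cylinder n t0 (S t0)"
    proof (cases "t < t0")
      case True
      then show ?thesis using \<open>a \<in> S t\<close> t(1) by blast
    next
      case False
      then have "a \<in> S t0" "t0 \<le> t" using t0[of t] \<open>a \<in> S t\<close> by auto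
      then show ?thesis using t(1) by (auto simp: cylinder_def)
    qed
  next
    fix m assume "m \<in> (\<Union>t<t0. (+) (single n t) ` S t) \<union> cylinder n t0 (S t0)"
    then consider t a where "a \<in> S t" "m = single n t + a"
      | t a where "t0 \<le> t" "a \<in> S t0" "m = single n t + a" by (auto simp: cylinder_def)
    then show "m \<in> D" by cases (use t0 in \<open>auto simp: S_def\<close>)
  qed
  have "stanley (\<Union>t<t0. (+) (single n t) ` S t)"
  proof (rule stanley_UN_lessThan)
    show "stanley ((+) (single n t) ` S t)" for t by (rule stanley_translate[OF st])
    fix t u :: nat assume "t < u"
    then show "(+) (single n t) ` S t \<inter> (+) (single n u) ` S u = {}"
    proof (intro equals0I)
      fix z assume "z \<in> (+) (single n t) ` S t \<inter> (+) (single n u) ` S u"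
      then obtain a a' where h: "a \<in> S t" "a' \<in> S u" "single n t + a = single n u + a'" by blast
      show False using add_single_unique[OF nk[OF h(1)] nk[OF h(2)] h(3)] \<open>t < u\<close> by simp
    qed
  qed
  moreover have "stanley (cylinder n t0 (S t0))" by (rule stanley_cylinder[OF st nk])
  moreover have "(\<Union>t<t0. (+) (single n t) ` S t) \<inter> cylinder n t0 (S t0) = {}"
  proof (rule ccontr)
    assume "\<not> ?thesis"
    then obtain t a t' a' where h: "t < t0" "a \<in> S t" "t0 \<le> t'" "a' \<in> S t0" "single n t + a = single n t' + a'"
      by (auto simp: cylinder_def)
    then have "t = t'" using add_single_unique nk by metis
    then show False using h by simp
  qed
  ultimately show ?case unfolding D by (intro stanley_Un)
qed

section \<open>Growth of the number of points in orthants\<close>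

lemma binomial_limit:
  "(\<lambda>i. real ((i - d + j) choose j) / real i ^ j) \<longlonglongrightarrow> 1 / fact j"
proof (induction j)
  case 0
  show ?case by simp
next
  case (Suc j)
  have "(\<lambda>i. 1 + (real j + 1 - real d) * (1 / real i)) \<longlonglongrightarrow> 1 + (real j + 1 - real d) * 0"
    by (intro tendsto_intros lim_1_over_n)
  then have "(\<lambda>i. (real ((i - d + j) choose j) / real i ^ j) * (1 + (real j + 1 - real d) * (1 / real i)) * (1 / real (Suc j)))
     \<longlonglongrightarrow> 1 / fact j * (1 + (real j + 1 - real d) * 0) * (1 / real (Suc j))"
    by (intro tendsto_mult Suc tendsto_const)
  moreover have "1 / fact j * (1 + (real j + 1 - real d) * 0) * (1 / real (Suc j)) = 1 / fact (Suc j)"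
    by (simp add: mult.commute)
  moreover have "\<forall>\<^sub>F i in sequentially. (real ((i - d + j) choose j) / real i ^ j) * (1 + (real j + 1 - real d) * (1 / real i)) * (1 / real (Suc j))
      = real ((i - d + Suc j) choose Suc j) / real i ^ Suc j"
  \<comment> \<open>Beyond \<open>d\<close> the truncated subtraction is exact and \<open>i\<close>
    is nonzero.\<close>
  proof (rule eventually_sequentiallyI[of "Suc d"])
    fix i assume i: "Suc d \<le> i"
    have "real (Suc j) * real ((i - d + Suc j) choose Suc j) = (real i - real d + real j + 1) * real ((i - d + j) choose j)"
      using arg_cong[OF binomial_Suc_add[of j "i - d"], of real] i by (simp only: of_nat_mult of_nat_add of_nat_Suc of_nat_diff) (simp add: of_nat_diff)
    then have eq: "real ((i - d + Suc j) choose Suc j) = (real i - real d + real j + 1) * real ((i - d + j) choose j) / real (Suc j)"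
      by (simp add: field_simps)
    have swap: "u / v * (w / x) * (1 / y) = w * u / y / (x * v)" for u v w x y :: real
      by (simp add: ac_simps)
    have "1 + (real j + 1 - real d) * (1 / real i) = (real i - real d + real j + 1) / real i"
      using i by (simp add: field_simps)
    then show "(real ((i - d + j) choose j) / real i ^ j) * (1 + (real j + 1 - real d) * (1 / real i)) * (1 / real (Suc j))
      = real ((i - d + Suc j) choose Suc j) / real i ^ Suc j"
      unfolding eq power_Suc by (simp only: swap)
  qed
  ultimately show ?case by (simp only: Lim_transform_eventually)
qed

lemma binomial_limit_less:
  assumes "j < k"
  shows "(\<lambda>i. real ((i - d + j) choose j) / real i ^ k) \<longlonglongrightarrow> 0"
proof -
  have "(\<lambda>i. (real ((i - d + j) choose j) / real i ^ j) * (1 / real i) ^ (k - j)) \<longlonglongrightarrow> 1 / fact j * 0 ^ (k - j)"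
    by (intro tendsto_mult binomial_limit tendsto_power lim_1_over_n)
  moreover have "(real ((i - d + j) choose j) / real i ^ j) * (1 / real i) ^ (k - j) = real ((i - d + j) choose j) / real i ^ k" for i
    using assms by (simp add: power_one_over flip: power_add)
  ultimately show ?thesis using assms by (simp add: zero_power)
qed

lemma orthant_upto:
  "orthant x J \<inter> {m. mdeg m \<le> i} = (if mdeg x \<le> i then (+) x ` monomials J (i - mdeg x) else {})"
  by (auto simp: orthant_def monomials_def mdeg_add image_iff)

lemma finite_stanley_upto: "stanley D \<Longrightarrow> finite (D \<inter> {m. mdeg m \<le> i})"
proof (induction rule: stanley.induct)
  case (stanley_insert D J x)
  then show ?case using finite_monomials[OF stanley_insert(2)] by (simp add: Int_Un_distrib2 orthant_upto)
qed simp

text \<open>The bound on the whole count bounds the count of each orthant, so none has more than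
  \<open>k\<close> free directions and each contributes a convergent term.\<close>

lemma stanley_convergent:
  assumes "stanley D" "\<And>i. card (D \<inter> {m. mdeg m \<le> i}) \<le> A * (i + 1) ^ k"
  shows "convergent (\<lambda>i. real (card (D \<inter> {m. mdeg m \<le> i})) / real i ^ k)"
  using assms
proof (induction rule: stanley.induct)
  case stanley_empty
  show ?case by (simp add: convergent_const)
next
  case (stanley_insert D J x)
  let ?c = "\<lambda>D i. card (D \<inter> {m. mdeg m \<le> i})"
  let ?j = "card J" and ?d = "mdeg x"
  have cO: "?c (orthant x J) i = (if ?d \<le> i then (i - ?d + ?j) choose ?j else 0)" for i
    unfolding orthant_upto using card_monomials[OF stanley_insert(2)] by (simp add: card_image inj_on_def)
  have split: "?c (D \<union> orthant x J) i = ?c D i + ?c (orthant x J) i" for i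
    unfolding Int_Un_distrib2
    using finite_stanley_upto[OF stanley_insert(1)] finite_stanley_upto[OF stanley_orthant[OF stanley_insert(2)]] stanley_insert(3)
    by (intro card_Un_disjoint) auto
  have bound: "?c D i + ?c (orthant x J) i \<le> A * (i + 1) ^ k" for i
    using stanley_insert.prems[of i] unfolding split .
  have convD: "convergent (\<lambda>i. real (?c D i) / real i ^ k)"
    by (rule stanley_insert.IH) (use bound in \<open>meson add_leE\<close>)
  have "(m + ?j) choose ?j \<le> (A * (?d + 1) ^ k) * (1 * m + 1) ^ k" for m
  proof -
    have "(m + ?j) choose ?j = ?c (orthant x J) (m + ?d)" unfolding cO by simp
    also have "\<dots> \<le> A * (m + ?d + 1) ^ k" using bound[of "m + ?d"] by linarith
    also have "\<dots> \<le> A * ((?d + 1) * (1 * m + 1)) ^ k" by (intro mult_left_mono power_mono) (auto simp: algebra_simps)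
    finally show ?thesis by (simp only: power_mult_distrib mult.assoc)
  qed
  then have "?j \<le> k" by (rule binomial_growth_exponent)
  then have "convergent (\<lambda>i. real ((i - ?d + ?j) choose ?j) / real i ^ k)"
    using binomial_limit[of ?d ?j] binomial_limit_less[of ?j k ?d] by (cases "?j = k") (auto simp: convergent_def)
  then obtain l where l: "(\<lambda>i. real ((i - ?d + ?j) choose ?j) / real i ^ k) \<longlonglongrightarrow> l" by (auto simp: convergent_def)
  have "(\<lambda>i. real (?c (orthant x J) i) / real i ^ k) \<longlonglongrightarrow> l"
  proof (rule Lim_transform_eventually[OF l])
    show "\<forall>\<^sub>F i in sequentially. real ((i - ?d + ?j) choose ?j) / real i ^ k = real (?c (orthant x J) i) / real i ^ k"
      by (rule eventually_sequentiallyI[of ?d]) (simp only: cO if_True)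
  qed
  then have "convergent (\<lambda>i. real (?c D i) / real i ^ k + real (?c (orthant x J) i) / real i ^ k)"
    using convD by (intro convergent_add) (auto simp: convergent_def)
  then show ?case unfolding split by (simp add: add_divide_distrib)
qed

section \<open>Degree\<close>

lemma ex1_implies_eq: "\<exists>!x. Q x \<Longrightarrow> Q a \<Longrightarrow> Q b \<Longrightarrow> a = b"
  by blast

lemma mon_inject: "(mon x :: 'a::zero \<Rightarrow>\<^sub>0 'k::zero_neq_one) = mon y \<longleftrightarrow> x = y"
proof
  assume "(mon x :: 'a \<Rightarrow>\<^sub>0 'k) = mon y"
  then have "keys (mon x :: 'a \<Rightarrow>\<^sub>0 'k) = keys (mon y :: 'a \<Rightarrow>\<^sub>0 'k)" by simp
  then show "x = y" by simp
qed simp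

lemma push_cong:
  "(\<And>m. m \<in> keys f \<Longrightarrow> \<pi> m = \<pi>' m) \<Longrightarrow> push h \<pi> \<chi> f = push h \<pi>' \<chi> f"
  unfolding push_def by (rule sum.cong) auto

lemma push_mpoly_scale: "push (\<lambda>x. x) \<pi> (\<lambda>_. 1) (mpoly_scale a f) = pm_scale a (push (\<lambda>x. x) \<pi> (\<lambda>_. 1) f)"
  unfolding mpoly_scale_def coeff_hom.push_single_mult[OF coeff_hom_id]
  by (rule poly_mapping_eqI) (simp add: coeff_hom.lookup_push[OF coeff_hom_id] sum_distrib_left ac_simps)

lemma mpoly_upto_degree_closed:
  "f \<in> mpoly_upto_degree s i \<Longrightarrow> g \<in> mpoly_upto_degree s i \<Longrightarrow> f + g \<in> mpoly_upto_degree s i"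
  "f \<in> mpoly_upto_degree s i \<Longrightarrow> - f \<in> mpoly_upto_degree s i"
  "f \<in> mpoly_upto_degree s i \<Longrightarrow> g \<in> mpoly_upto_degree s i \<Longrightarrow> f - g \<in> mpoly_upto_degree s i"
  "0 \<in> mpoly_upto_degree s i"
  "f \<in> mpoly_upto_degree s i \<Longrightarrow> mpoly_scale a f \<in> mpoly_upto_degree s i"
proof -
  show *: "f \<in> mpoly_upto_degree s i \<Longrightarrow> g \<in> mpoly_upto_degree s i \<Longrightarrow> f + g \<in> mpoly_upto_degree s i" for f g
    using Poly_Mapping.keys_add[of f g] by (auto simp: mpoly_upto_degree_iff)
  show **: "f \<in> mpoly_upto_degree s i \<Longrightarrow> - f \<in> mpoly_upto_degree s i" for f
    by (simp add: mpoly_upto_degree_iff keys.rep_eq)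
  show "f \<in> mpoly_upto_degree s i \<Longrightarrow> g \<in> mpoly_upto_degree s i \<Longrightarrow> f - g \<in> mpoly_upto_degree s i"
    using *[of f "- g"] **[of g] by simp
  show "0 \<in> mpoly_upto_degree s i" by (simp add: mpoly_upto_degree_iff)
  show "f \<in> mpoly_upto_degree s i \<Longrightarrow> mpoly_scale a f \<in> mpoly_upto_degree s i"
    unfolding mpoly_scale_eq_pm_scale mpoly_upto_degree_iff by (auto simp: in_keys_iff subset_iff)
qed

lemma mpoly_upto_degree_sum: "(\<And>x. x \<in> A \<Longrightarrow> f x \<in> mpoly_upto_degree s i) \<Longrightarrow> sum f A \<in> mpoly_upto_degree s i"
  by (induction A rule: infinite_finite_induct) (auto intro: mpoly_upto_degree_closed)

text \<open>Degree comes first so that the least monomial of a class also has the least degree in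
  it. Standard monomials of degree at most i then represent exactly the classes met in degree at
  most i.\<close>

definition deglex_le :: "(nat \<Rightarrow>\<^sub>0 nat) \<Rightarrow> (nat \<Rightarrow>\<^sub>0 nat) \<Rightarrow> bool" where
  "deglex_le m n \<longleftrightarrow> mdeg m < mdeg n \<or> mdeg m = mdeg n \<and> m \<le> n"

lemma deglex_le_add_cancel: "deglex_le (m + d) (n + d) \<longleftrightarrow> deglex_le m n"
  by (simp add: deglex_le_def mdeg_add)

lemma deglex_antisym: "deglex_le m n \<Longrightarrow> deglex_le n m \<Longrightarrow> m = n"
  by (auto simp: deglex_le_def)

section \<open>Standard monomials, the Hilbert function and the Krull dimension\<close>

context adapted_basis
begin

text \<open>The standard monomials of the lattice ideal with respect to \<open>deglex_le\<close>.\<close>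

definition standard :: "(nat \<Rightarrow>\<^sub>0 nat) set" where
  "standard = {m. keys m \<subseteq> {..<s} \<and>
     (\<forall>n. keys n \<subseteq> {..<s} \<longrightarrow> lat_class (emb n) = lat_class (emb m) \<longrightarrow> deglex_le m n)}"

lemma standard_unique: "m \<in> standard \<Longrightarrow> n \<in> standard \<Longrightarrow> lat_class (emb m) = lat_class (emb n) \<Longrightarrow> m = n"
  unfolding standard_def by (rule deglex_antisym) simp_all

lemma standard_exists:
  assumes "keys m \<subseteq> {..<s}"
  shows "\<exists>n\<in>standard. lat_class (emb n) = lat_class (emb m) \<and> mdeg n \<le> mdeg m"
proof -
  define A where "A = {n \<in> monomials {..<s} (mdeg m). lat_class (emb n) = lat_class (emb m)}"
  have "A \<subseteq> monomials {..<s} (mdeg m)" by (auto simp: A_def)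
  then have A: "finite A" "m \<in> A"
    using assms finite_subset[OF _ finite_monomials[of "{..<s}"]] by (auto simp: A_def monomials_def)
  \<comment> \<open>The degree is minimised first and the order of the type second, both over finite
    sets.\<close>
  define d where "d = Min (mdeg ` A)"
  have d: "d \<in> mdeg ` A" "\<And>n. n \<in> A \<Longrightarrow> d \<le> mdeg n"
    unfolding d_def using A by (auto intro: Min_in)
  define B where "B = {n \<in> A. mdeg n = d}"
  have B: "finite B" "B \<noteq> {}" using A d by (auto simp: B_def)
  define n0 where "n0 = Min B"
  have n0: "n0 \<in> B" "\<And>n. n \<in> B \<Longrightarrow> n0 \<le> n" using B by (auto simp: n0_def)
  have n0A: "n0 \<in> A" "mdeg n0 = d" using n0 by (auto simp: B_def)
  have "deglex_le n0 n" if n: "keys n \<subseteq> {..<s}" "lat_class (emb n) = lat_class (emb n0)" for n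
  proof (cases "mdeg n \<le> mdeg m")
    case True
    then have nA: "n \<in> A" using n n0A(1) by (auto simp: A_def monomials_def)
    show ?thesis using d(2)[OF nA] n0(2)[of n] nA n0A(2) by (auto simp: deglex_le_def B_def)
  next
    case False
    then show ?thesis using n0A(1) by (auto simp: deglex_le_def A_def monomials_def)
  qed
  then have "n0 \<in> standard" using n0A(1) by (auto simp: standard_def A_def monomials_def)
  then show ?thesis using n0A(1) by (auto simp: A_def monomials_def)
qed

text \<open>Adding \<open>d\<close> preserves the class relation and the order, so a smaller
  competitor of \<open>m\<close> would give one of \<open>m + d\<close>.\<close>

lemma down_closed_standard: "down_closed standard"
  unfolding down_closed_def
proof (intro allI impI)
  fix m d assume md: "m + d \<in> standard"
  have keys: "keys m \<subseteq> keys (m + d)" "keys d \<subseteq> keys (m + d)"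
    by (auto simp: in_keys_iff lookup_add)
  then have keys_s: "keys m \<subseteq> {..<s}" "keys d \<subseteq> {..<s}" using md by (auto simp: standard_def)
  have "deglex_le m n" if n: "keys n \<subseteq> {..<s}" "lat_class (emb n) = lat_class (emb m)" for n
  proof -
    have "keys (n + d) \<subseteq> {..<s}" using Poly_Mapping.keys_add[of n d] n(1) keys_s(2) by blast
    moreover have "lat_class (emb (n + d)) = lat_class (emb (m + d))"
      using lat_class_add[OF n(2), of "emb d"] by (simp add: add.commute)
    ultimately have "deglex_le (m + d) (n + d)" using md by (simp add: standard_def)
    then show ?thesis by (simp add: deglex_le_add_cancel)
  qed
  then show "m \<in> standard" using keys_s by (simp add: standard_def)
qed

definition std_upto :: "nat \<Rightarrow> (nat \<Rightarrow>\<^sub>0 nat) set" where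
  "std_upto i = standard \<inter> {m. mdeg m \<le> i}"

lemma std_upto_monomials: "std_upto i \<subseteq> monomials {..<s} i"
  by (auto simp: std_upto_def standard_def monomials_def)

lemma finite_std_upto: "finite (std_upto i)"
  using std_upto_monomials finite_monomials[of "{..<s}" i] finite_subset by blast

lemma inj_class_std: "inj_on (\<lambda>m. lat_class (emb m)) (std_upto i)"
  by (rule inj_onI, rule standard_unique) (auto simp: std_upto_def)

lemma class_std_upto: "(\<lambda>m. lat_class (emb m)) ` std_upto i = (\<lambda>m. lat_class (emb m)) ` monomials {..<s} i"
proof (intro equalityI subsetI)
  fix C assume "C \<in> (\<lambda>m. lat_class (emb m)) ` monomials {..<s} i"
  then obtain m where m: "keys m \<subseteq> {..<s}" "mdeg m \<le> i" "C = lat_class (emb m)" by (auto simp: monomials_def)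
  obtain n where "n \<in> standard" "lat_class (emb n) = lat_class (emb m)" "mdeg n \<le> mdeg m"
    using standard_exists[OF m(1)] by blast
  then show "C \<in> (\<lambda>m. lat_class (emb m)) ` std_upto i" using m by (auto simp: std_upto_def intro!: image_eqI[of _ _ n])
qed (use std_upto_monomials in auto)

lemma class_count_eq: "class_count i = card (std_upto i)"
  unfolding class_count_def class_std_upto[symmetric] by (rule card_image[OF inj_class_std])

text \<open>Without convergence the \<open>lim\<close> in the definition of the degree would carry
  no information.\<close>

lemma class_count_convergent: "convergent (\<lambda>i. real (class_count i) / real i ^ (s - r))"
proof -
  obtain A where A: "\<And>i. class_count i \<le> A * (i + 1) ^ (s - r)" using class_count_le by blast
  have "stanley standard"
    by (rule stanley_down_closed[OF down_closed_standard, of s]) (simp add: standard_def)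
  then show ?thesis
    using stanley_convergent[of standard A "s - r"] A by (simp add: class_count_eq std_upto_def)
qed

text \<open>Each torsion class, shifted by a fixed monomial into the positive orthant, is combined
  with all monomials in the free variables, and the classes so obtained are distinct.
  \<open>d\<close> absorbs the degrees of the shifted representatives.\<close>

lemma class_count_lower: "\<exists>d. \<forall>i\<ge>d. card (lat_class ` M) * ((i - d + (s - r)) choose (s - r)) \<le> class_count i"
proof -
  obtain R where R: "finite R" "R \<subseteq> M" "inj_on lat_class R" "lat_class ` R = lat_class ` M"
    using ex_class_reps[OF subset_refl] by blast
  obtain D e where e_carrier: "\<And>\<tau>. \<tau> \<in> R \<Longrightarrow> keys (e \<tau>) \<subseteq> {..<s}"
    and emb_e: "\<And>\<tau>. \<tau> \<in> R \<Longrightarrow> emb (e \<tau>) = emb D + \<tau>"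
    using ex_nonneg_shift[OF R(1), of s] R(2) M_carrier by blast
  define d where "d = Max (insert 0 (mdeg ` e ` R))"
  have d: "mdeg (e \<tau>) \<le> d" if "\<tau> \<in> R" for \<tau> unfolding d_def using R(1) that by (intro Max_ge) auto
  have "card (lat_class ` M) * ((i - d + (s - r)) choose (s - r)) \<le> class_count i" if i: "i \<ge> d" for i
  proof -
    let ?F = "\<lambda>(\<tau>, m). lat_class (emb (e \<tau> + m))"
    have "finite free_vars" by (simp add: free_vars_def)
    then have card: "card (R \<times> monomials free_vars (i - d)) = card (lat_class ` M) * ((i - d + (s - r)) choose (s - r))"
      using R(3,4) by (simp add: card_cartesian_product card_monomials card_free_vars card_image[symmetric])
    have inj: "inj_on ?F (R \<times> monomials free_vars (i - d))"
    proof (rule inj_onI, clarify)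
      fix \<tau> m \<tau>' m' assume h: "\<tau> \<in> R" "m \<in> monomials free_vars (i - d)" "\<tau>' \<in> R" "m' \<in> monomials free_vars (i - d)"
        "lat_class (emb (e \<tau> + m)) = lat_class (emb (e \<tau>' + m'))"
      have L: "(\<tau> - \<tau>') + (emb m - emb m') \<in> L"
        using h(5) by (simp add: lat_class_eq_iff emb_e[OF h(1)] emb_e[OF h(3)] algebra_simps)
      have "m = m'"
      proof (rule free_vars_eqI)
        fix l assume l: "r \<le> l" "l < s"
        have "c l \<tau> = 0" "c l \<tau>' = 0" using h R(2) l by (auto simp: M_def)
        then show "c l (emb m) = c l (emb m')" using c_L[OF L l] by (simp add: c_add c_diff)
      qed (use h in \<open>auto simp: monomials_def\<close>)
      then have "lat_class \<tau> = lat_class \<tau>'" using L by (simp add: lat_class_eq_iff)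
      then show "\<tau> = \<tau>' \<and> m = m'" using R(3) h \<open>m = m'\<close> by (auto simp: inj_on_def)
    qed
    have "?F ` (R \<times> monomials free_vars (i - d)) \<subseteq> (\<lambda>m. lat_class (emb m)) ` monomials {..<s} i"
    proof (clarify)
      fix \<tau> m assume h: "\<tau> \<in> R" "m \<in> monomials free_vars (i - d)"
      have "keys (e \<tau> + m) \<subseteq> {..<s}"
        using Poly_Mapping.keys_add[of "e \<tau>" m] e_carrier[OF h(1)] h(2) free_vars_sub by (auto simp: monomials_def)
      moreover have "mdeg (e \<tau> + m) \<le> i" using d[OF h(1)] h(2) i by (auto simp: mdeg_add monomials_def)
      ultimately show "lat_class (emb (e \<tau> + m)) \<in> (\<lambda>m. lat_class (emb m)) ` monomials {..<s} i"
        by (intro imageI) (simp add: monomials_def)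
    qed
    then have "card (?F ` (R \<times> monomials free_vars (i - d))) \<le> class_count i"
      unfolding class_count_def using finite_monomials[of "{..<s}" i] by (intro card_mono) auto
    then show ?thesis using card card_image[OF inj] by simp
  qed
  then show ?thesis by blast
qed

lemma class_count_limit_ge: "fact (s - r) * lim (\<lambda>i. real (class_count i) / real i ^ (s - r)) \<ge> real (card (lat_class ` M))"
proof -
  let ?k = "s - r" and ?t = "card (lat_class ` M)"
  obtain d where d: "\<And>i. i \<ge> d \<Longrightarrow> ?t * ((i - d + ?k) choose ?k) \<le> class_count i" using class_count_lower by blast
  have "(\<lambda>i. real (class_count i) / real i ^ ?k) \<longlonglongrightarrow> lim (\<lambda>i. real (class_count i) / real i ^ ?k)"
    using class_count_convergent by (simp add: convergent_LIMSEQ_iff)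
  moreover have "(\<lambda>i. real ?t * (real ((i - d + ?k) choose ?k) / real i ^ ?k)) \<longlonglongrightarrow> real ?t * (1 / fact ?k)"
    by (intro tendsto_mult tendsto_const binomial_limit)
  moreover have "\<exists>n. \<forall>i\<ge>n. real ?t * (real ((i - d + ?k) choose ?k) / real i ^ ?k) \<le> real (class_count i) / real i ^ ?k"
  proof (intro exI[of _ d] allI impI)
    fix i assume "d \<le> i"
    then have "real ?t * real ((i - d + ?k) choose ?k) \<le> real (class_count i)"
      using d[of i] by (simp only: of_nat_mult[symmetric] of_nat_le_iff)
    then show "real ?t * (real ((i - d + ?k) choose ?k) / real i ^ ?k) \<le> real (class_count i) / real i ^ ?k"
      by (simp add: divide_right_mono)
  qed
  ultimately have "real ?t * (1 / fact ?k) \<le> lim (\<lambda>i. real (class_count i) / real i ^ ?k)"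
    by (intro LIMSEQ_le)
  then show ?thesis by (simp add: field_simps)
qed

text \<open>Summing coefficients over classes identifies the quotient with the span of the classes
  met in degree at most \<open>i\<close>. As \<open>quotient_dim\<close> is a definite description,
  one basis of standard monomials is not enough: every basis has to have this size.\<close>

lemma affine_hilbert_function_lattice_ideal:
  "affine_hilbert_function s (lattice_ideal s L :: 'k::field mpoly set) i = class_count i"
proof -
  let ?I = "lattice_ideal s L :: 'k mpoly set"
  let ?V = "mpoly_upto_degree s i :: 'k mpoly set"
  let ?W = "?I \<inter> ?V"
  let ?\<phi> = "push (\<lambda>x. x) (\<lambda>m. lat_class (emb m)) (\<lambda>_. 1) :: 'k mpoly \<Rightarrow> _"
  interpret H: coeff_hom "\<lambda>x::'k. x" by (rule coeff_hom_id)
  interpret V: vector_space "pm_scale :: 'k \<Rightarrow> ((nat \<Rightarrow>\<^sub>0 int) set \<Rightarrow>\<^sub>0 'k) \<Rightarrow> _" by (rule vector_space_pm_scale)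
  have W_iff: "f \<in> ?W \<longleftrightarrow> f \<in> ?V \<and> ?\<phi> f = 0" for f
    using mpoly_upto_degree_carrier[of f s i] by (auto simp: lattice_ideal_iff mpoly_push_def push_to_ac_eq_0_iff)
  have I_zero: "?\<phi> f = 0" if "f \<in> ?I" for f
    using that by (simp add: lattice_ideal_iff mpoly_push_def push_to_ac_eq_0_iff)
  have phi_lin: "?\<phi> (\<Sum>b\<in>B. mpoly_scale (a b) b) = (\<Sum>b\<in>B. pm_scale (a b) (?\<phi> b))" for a B
    by (simp add: H.push_sum push_mpoly_scale)
  have inj_mon: "inj_on (\<lambda>m. mon m :: 'k mpoly) K" for K
    by (simp add: inj_on_def mon_inject)
  let ?B = "(\<lambda>m. mon m :: 'k mpoly) ` std_upto i"
  have B_sum: "(\<Sum>b\<in>?B. mpoly_scale (a b) b) = (\<Sum>m\<in>std_upto i. single m (a (mon m)))" for a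
    by (subst sum.reindex[OF inj_mon]) (simp add: mpoly_scale_def mult_single)
  have phi_single: "?\<phi> (single m k) = single (lat_class (emb m)) k" for m k
    by (simp add: H.push_single)
  have basis: "quotient_basis mpoly_scale ?V ?W ?B"
    unfolding quotient_basis_def
  proof (intro conjI ballI)
    show "finite ?B" using finite_std_upto by simp
    show "?B \<subseteq> ?V" using subsetD[OF std_upto_monomials[of i]] by (auto simp: mpoly_upto_degree_iff)
    fix v assume v: "v \<in> ?V"
    define \<rho> where "\<rho> m = (SOME n. n \<in> standard \<and> lat_class (emb n) = lat_class (emb m) \<and> mdeg n \<le> mdeg m)" for m
    have \<rho>: "\<rho> m \<in> std_upto i" "lat_class (emb (\<rho> m)) = lat_class (emb m)" if "m \<in> keys v" for m
    proof -
      have m: "keys m \<subseteq> {..<s}" "mdeg m \<le> i" using v that by (auto simp: mpoly_upto_degree_iff monomials_def)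
      have "\<exists>n. n \<in> standard \<and> lat_class (emb n) = lat_class (emb m) \<and> mdeg n \<le> mdeg m"
        using standard_exists[OF m(1)] by blast
      then have "\<rho> m \<in> standard \<and> lat_class (emb (\<rho> m)) = lat_class (emb m) \<and> mdeg (\<rho> m) \<le> mdeg m"
        unfolding \<rho>_def by (rule someI_ex)
      then show "\<rho> m \<in> std_upto i" "lat_class (emb (\<rho> m)) = lat_class (emb m)" using m by (auto simp: std_upto_def)
    qed
    \<comment> \<open>The normal form of \<open>v\<close>; replacing a monomial by the standard one
      of its class does not raise the degree.\<close>
    define w where "w = push (\<lambda>x. x) \<rho> (\<lambda>_. 1) v"
    have keys_w: "keys w \<subseteq> std_upto i"
      unfolding w_def push_def using \<rho>(1) by (intro order.trans[OF keys_sum]) (auto split: if_splits)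
    have wV: "w \<in> ?V" using keys_w std_upto_monomials by (auto simp: mpoly_upto_degree_iff)
    have "?\<phi> w = push (\<lambda>x. x) (\<lambda>m. lat_class (emb (\<rho> m))) (\<lambda>_. 1) v"
      unfolding w_def push_push[OF coeff_hom_id coeff_hom_id] by (simp add: comp_def)
    also have "\<dots> = ?\<phi> v" by (rule push_cong) (rule \<rho>(2))
    finally have vw: "v - w \<in> ?W" unfolding W_iff using v wV mpoly_upto_degree_closed(3) by (simp add: H.push_diff)
    define c0 where "c0 b = (if b \<in> ?B then lookup w (the_inv_into (std_upto i) (\<lambda>m. mon m :: 'k mpoly) b) else 0)" for b
    have c0: "c0 (mon m) = lookup w m" if "m \<in> std_upto i" for m
      using that by (simp add: c0_def the_inv_into_f_f[OF inj_mon])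
    have "(\<Sum>m\<in>std_upto i. single m (c0 (mon m))) = (\<Sum>m\<in>std_upto i. single m (lookup w m))"
      by (rule sum.cong) (simp_all add: c0)
    also have "\<dots> = (\<Sum>m\<in>keys w. single m (lookup w m))"
      using keys_w finite_std_upto by (intro sum.mono_neutral_right) (auto simp: in_keys_iff)
    also have "\<dots> = w" by (rule sum_keys_single)
    finally have sum_c0: "(\<Sum>b\<in>?B. mpoly_scale (c0 b) b) = w" unfolding B_sum .
    show "\<exists>!c. (\<forall>b. b \<notin> ?B \<longrightarrow> c b = 0) \<and> v - (\<Sum>b\<in>?B. mpoly_scale (c b) b) \<in> ?W"
    proof (rule ex1I[of _ c0])
      show "(\<forall>b. b \<notin> ?B \<longrightarrow> c0 b = 0) \<and> v - (\<Sum>b\<in>?B. mpoly_scale (c0 b) b) \<in> ?W"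
        using vw unfolding sum_c0 by (simp add: c0_def)
      fix c1 assume c1: "(\<forall>b. b \<notin> ?B \<longrightarrow> c1 b = 0) \<and> v - (\<Sum>b\<in>?B. mpoly_scale (c1 b) b) \<in> ?W"
      have eq: "?\<phi> (\<Sum>b\<in>?B. mpoly_scale (c1 b) b) = ?\<phi> (\<Sum>b\<in>?B. mpoly_scale (c0 b) b)"
        using c1 vw unfolding sum_c0 W_iff by (simp add: H.push_diff)
      have val: "lookup (?\<phi> (\<Sum>b\<in>?B. mpoly_scale (a b) b)) (lat_class (emb m)) = a (mon m)" if m: "m \<in> std_upto i" for a m
      proof -
        have "lookup (?\<phi> (\<Sum>b\<in>?B. mpoly_scale (a b) b)) (lat_class (emb m)) = (\<Sum>n\<in>std_upto i. if n = m then a (mon n) else 0)"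
          unfolding B_sum H.push_sum phi_single lookup_sum
        proof (rule sum.cong[OF refl])
          fix n assume n: "n \<in> std_upto i"
          have "lat_class (emb n) = lat_class (emb m) \<longleftrightarrow> n = m" using inj_class_std n m by (auto simp: inj_on_def)
          then show "lookup (single (lat_class (emb n)) (a (mon n))) (lat_class (emb m)) = (if n = m then a (mon n) else 0)"
            by (auto simp: lookup_single when_def)
        qed
        then show ?thesis using m finite_std_upto by simp
      qed
      show "c1 = c0"
      proof
        fix b show "c1 b = c0 b"
        proof (cases "b \<in> ?B")
          case True
          then obtain m where m: "m \<in> std_upto i" "b = mon m" by blast
          show ?thesis using val[OF m(1), of c1] val[OF m(1), of c0] eq by (simp add: m(2))
        qed (use c1 in \<open>auto simp: c0_def\<close>)
      qed
    qed
  qed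
  have card_B: "card ?B = class_count i" by (simp add: card_image[OF inj_mon] class_count_eq)
  have unique: "card B = class_count i" if B: "quotient_basis mpoly_scale ?V ?W B" for B
  proof (rule antisym)
    have finB: "finite B" and BV: "B \<subseteq> ?V"
      and ex1: "\<And>v. v \<in> ?V \<Longrightarrow> \<exists>!c. (\<forall>b. b \<notin> B \<longrightarrow> c b = 0) \<and> v - (\<Sum>b\<in>B. mpoly_scale (c b) b) \<in> ?W"
      using B by (auto simp: quotient_basis_def)
    \<comment> \<open>The given representation of 0 is compared with the trivial one by the
      uniqueness clause for a basis.\<close>
    have ind: "a b = 0" if a: "\<And>b. b \<notin> B \<Longrightarrow> a b = 0" "?\<phi> (\<Sum>b\<in>B. mpoly_scale (a b) b) = 0" for a b
    proof -
      have "(\<Sum>b\<in>B. mpoly_scale (a b) b) \<in> ?V" using BV by (intro mpoly_upto_degree_sum mpoly_upto_degree_closed(5)) auto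
      then have "0 - (\<Sum>b\<in>B. mpoly_scale (a b) b) \<in> ?W"
        using a(2) mpoly_upto_degree_closed(2) unfolding W_iff by (simp add: H.push_uminus)
      moreover have "0 - (\<Sum>b\<in>B. mpoly_scale ((\<lambda>_. 0) b) b) \<in> ?W"
        unfolding W_iff by (simp add: mpoly_scale_def H.push_zero mpoly_upto_degree_closed(4))
      ultimately have "a = (\<lambda>_. 0)"
        using ex1_implies_eq[OF ex1[OF mpoly_upto_degree_closed(4)], of a "\<lambda>_. 0"] a(1) by blast
      then show ?thesis by simp
    qed
    obtain g where g: "bij_betw g {0..<card B} B" using ex_bij_betw_nat_finite[OF finB] by blast
    then have g: "bij_betw g {..<card B} B" by (simp add: atLeast0LessThan)
    have "dim_ge s ?I i (card B)"
    proof (rule dim_geI)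
      show "g l \<in> ?V" if "l < card B" for l using g BV that by (auto simp: bij_betw_def)
      show "indep_mod ?I (card B) g"
        unfolding indep_mod_def
      proof (intro allI impI)
        fix a l assume a: "(\<Sum>l<card B. mpoly_scale (a l) (g l)) \<in> ?I" and l: "l < card B"
        define a' where "a' b = (if b \<in> B then a (the_inv_into {..<card B} g b) else 0)" for b
        have inv: "a' (g l) = a l" if "l < card B" for l
          using that g by (auto simp: a'_def bij_betw_def the_inv_into_f_f)
        have "(\<Sum>b\<in>B. mpoly_scale (a' b) b) = (\<Sum>l<card B. mpoly_scale (a' (g l)) (g l))"
          by (rule sum.reindex_bij_betw[OF g, symmetric])
        also have "\<dots> = (\<Sum>l<card B. mpoly_scale (a l) (g l))" by (rule sum.cong) (simp_all add: inv)
        finally have eq: "(\<Sum>b\<in>B. mpoly_scale (a' b) b) = (\<Sum>l<card B. mpoly_scale (a l) (g l))" .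
        have "(\<Sum>b\<in>B. mpoly_scale (a' b) b) \<in> ?I" unfolding eq by (rule a)
        then have "?\<phi> (\<Sum>b\<in>B. mpoly_scale (a' b) b) = 0" by (rule I_zero)
        then have "a' (g l) = 0" by (rule ind[rotated]) (simp only: a'_def if_False)
        then show "a l = 0" using inv[OF l] by simp
      qed
    qed
    then show "card B \<le> class_count i"
      unfolding class_count_def by (rule dim_ge_bound) (rule push_class_imp_lattice_ideal)
    \<comment> \<open>For the opposite inequality, the images of \<open>B\<close> span the unit
      vectors of all classes met in degree at most \<open>i\<close>.\<close>
    let ?E = "(\<lambda>C. single C (1::'k)) ` (\<lambda>m. lat_class (emb m)) ` std_upto i"
    have inj_E: "inj_on (\<lambda>C. single C (1::'k)) K" for K :: "(nat \<Rightarrow>\<^sub>0 int) set set"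
    proof (rule inj_onI)
      fix C C' assume "single C (1::'k) = single C' 1"
      then have "keys (single C (1::'k)) = keys (single C' (1::'k))" by simp
      then show "C = C'" by simp
    qed
    have "V.independent ?E"
    proof (rule V.independent_if_scalars_zero)
      fix f x assume z: "(\<Sum>x\<in>?E. pm_scale (f x) x) = 0" and x: "x \<in> ?E"
      then obtain C where C: "C \<in> (\<lambda>m. lat_class (emb m)) ` std_upto i" "x = single C 1" by blast
      have "(\<Sum>x\<in>?E. pm_scale (f x) x) = (\<Sum>C\<in>(\<lambda>m. lat_class (emb m)) ` std_upto i. single C (f (single C 1)))"
        by (subst sum.reindex[OF inj_E]) (simp add: pm_scale_single)
      then have "lookup (\<Sum>C\<in>(\<lambda>m. lat_class (emb m)) ` std_upto i. single C (f (single C 1))) C = 0"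
        using z by simp
      then show "f x = 0" using C finite_std_upto by (simp add: lookup_sum lookup_single when_def)
    qed (use finite_std_upto in auto)
    moreover have "?E \<subseteq> V.span (?\<phi> ` B)"
    proof
      fix x assume "x \<in> ?E"
      then obtain m where m: "m \<in> std_upto i" "x = ?\<phi> (mon m)" by (auto simp: phi_single)
      have "mon m \<in> ?V" using m(1) std_upto_monomials by (auto simp: mpoly_upto_degree_iff)
      then obtain c where "mon m - (\<Sum>b\<in>B. mpoly_scale (c b) b) \<in> ?W" using ex1 by blast
      then have "x = ?\<phi> (\<Sum>b\<in>B. mpoly_scale (c b) b)" unfolding W_iff m(2) by (simp add: H.push_diff)
      also have "\<dots> \<in> V.span (?\<phi> ` B)" unfolding phi_lin by (intro V.span_sum V.span_scale V.span_base) auto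
      finally show "x \<in> V.span (?\<phi> ` B)" .
    qed
    ultimately have "card ?E \<le> card (?\<phi> ` B)"
      using V.independent_span_bound[OF finite_imageI[OF finB]] by blast
    also have "\<dots> \<le> card B" by (rule card_image_le[OF finB])
    finally show "class_count i \<le> card B" by (simp add: card_image[OF inj_E] card_image[OF inj_class_std] class_count_eq)
  qed
  have "quotient_dim mpoly_scale ?V ?W = class_count i"
    unfolding quotient_dim_def using basis card_B unique by (intro the_equality) blast+
  then show ?thesis by (simp add: affine_hilbert_function_def)
qed

text \<open>Primes of the quotient correspond to primes over the lattice ideal. The flag above
  \<open>Qp r\<close> for the trivial character attains the length \<open>s - r\<close>, and
  preimages of an arbitrary chain obey the growth bound.\<close>

lemma krull_dim_quotient:
  "krull_dim (mpoly_ring s Quot (lattice_ideal s L :: 'k::field mpoly set)) = enat (s - r)"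
proof -
  let ?R = "mpoly_ring s :: 'k mpoly ring"
  let ?I = "lattice_ideal s L :: 'k mpoly set"
  interpret cring ?R by (rule cring_mpoly_ring)
  interpret I: ideal ?I ?R by (rule ideal_lattice_ideal)
  interpret h: ring_hom_ring ?R "?R Quot ?I" "(+>\<^bsub>?R\<^esub>) ?I" by (rule I.rcos_ring_hom_ring)
  have Qcring: "cring (?R Quot ?I)" by (rule I.quotient_is_cring[OF cring_mpoly_ring])
  let ?\<pi> = "\<lambda>P. (+>\<^bsub>?R\<^esub>) ?I ` P"
  have mem: "?I +>\<^bsub>?R\<^esub> f \<in> ?\<pi> P \<longleftrightarrow> f \<in> P" if P: "ideal P ?R" "?I \<subseteq> P" and f: "f \<in> pcarrier s" for P f
  proof
    assume "?I +>\<^bsub>?R\<^esub> f \<in> ?\<pi> P"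
    then have "f \<in> \<Union> (?\<pi> P)"
      using canonical_proj_vimage_mem_iff[OF ideal_lattice_ideal
          additive_subgroup.a_subset[OF ideal.axioms(1)[OF ring_ideal_imp_quot_ideal[OF ideal_lattice_ideal P(1)]]] f]
      by simp
    then show "f \<in> P" using ideal_incl_iff[OF ideal_lattice_ideal P(1)] P(2) by auto
  qed auto
  have quot_surj: "\<exists>f\<in>pcarrier s. a = ?I +>\<^bsub>?R\<^esub> f" if "a \<in> carrier (?R Quot ?I)" for a
    using that unfolding FactRing_def A_RCOSETS_def' by simp
  have prime_image: "primeideal (?\<pi> P) (?R Quot ?I)" if P: "primeideal P ?R" "?I \<subseteq> P" for P
  proof (rule primeidealI)
    note idP = primeideal_mpolyD(1)[OF P(1)]
    show "ideal (?\<pi> P) (?R Quot ?I)" by (rule ring_ideal_imp_quot_ideal[OF ideal_lattice_ideal idP])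
    show "cring (?R Quot ?I)" by (rule Qcring)
    have "?I +>\<^bsub>?R\<^esub> 1 \<in> carrier (?R Quot ?I)" by (rule h.hom_closed[OF cring_closed(4)])
    moreover have "?I +>\<^bsub>?R\<^esub> 1 \<notin> ?\<pi> P" using mem[OF idP P(2) cring_closed(4)] primeideal_mpolyD(2)[OF P(1)] by simp
    ultimately show "carrier (?R Quot ?I) \<noteq> ?\<pi> P" by blast
    fix a b assume ab: "a \<in> carrier (?R Quot ?I)" "b \<in> carrier (?R Quot ?I)" "a \<otimes>\<^bsub>?R Quot ?I\<^esub> b \<in> ?\<pi> P"
    then obtain f g where fg: "f \<in> pcarrier s" "g \<in> pcarrier s" "a = ?I +>\<^bsub>?R\<^esub> f" "b = ?I +>\<^bsub>?R\<^esub> g"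
      using quot_surj[OF ab(1)] quot_surj[OF ab(2)] by blast
    have "?I +>\<^bsub>?R\<^esub> (f * g) \<in> ?\<pi> P"
      using ab(3) h.hom_mult[OF fg(1,2)] by (simp add: fg(3,4) mpoly_ring_simps(2))
    then have "f * g \<in> P" using mem[OF idP P(2) cring_closed(2)[OF fg(1,2)]] by simp
    then have "f \<in> P \<or> g \<in> P" by (rule primeideal_mpolyD(3)[OF P(1) fg(1,2)])
    then show "a \<in> ?\<pi> P \<or> b \<in> ?\<pi> P" using fg by blast
  qed
  show ?thesis
    unfolding krull_dim_def
  proof (rule antisym)
    let ?Q = "\<lambda>i. Qp (r + i) (\<lambda>_. 1) :: 'k mpoly set"
    have chain: "prime_chain ?R (s - r) ?Q"
      by (rule prime_chain_Qp[OF character_one]) (use r_le in auto)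
    have IQ: "?I \<subseteq> ?Q i" for i by (rule lattice_ideal_subset_Qp[OF character_one]) auto
    have "prime_chain (?R Quot ?I) (s - r) (\<lambda>i. ?\<pi> (?Q i))"
      unfolding prime_chain_def
    proof (intro conjI allI impI)
      show "primeideal (?\<pi> (?Q i)) (?R Quot ?I)" if "i \<le> s - r" for i
        using prime_image[OF _ IQ] chain that by (auto simp: prime_chain_def)
      fix i assume "i < s - r"
      then have lt: "?Q i \<subset> ?Q (Suc i)" using chain by (auto simp: prime_chain_def)
      then obtain f where f: "f \<in> ?Q (Suc i)" "f \<notin> ?Q i" by blast
      have id: "ideal (?Q j) ?R" for j using primeideal_mpolyD(1)[OF primeideal_Qp[OF character_one]] .
      have "f \<in> pcarrier s" using f(1) ideal_mpolyD(1)[OF id] by blast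
      then have "?I +>\<^bsub>?R\<^esub> f \<notin> ?\<pi> (?Q i)" using mem[OF id IQ] f(2) by blast
      then show "?\<pi> (?Q i) \<subset> ?\<pi> (?Q (Suc i))" using lt f(1) by blast
    qed
    then show "enat (s - r) \<le> Sup {enat n |n. \<exists>Q. prime_chain (?R Quot ?I) n Q}"
      by (intro Sup_upper) blast
    show "Sup {enat n |n. \<exists>Q. prime_chain (?R Quot ?I) n Q} \<le> enat (s - r)"
    proof (rule Sup_least)
      fix x assume "x \<in> {enat n |n. \<exists>Q. prime_chain (?R Quot ?I) n Q}"
      then obtain n Q where x: "x = enat n" and Q: "prime_chain (?R Quot ?I) n Q" by blast
      let ?P = "\<lambda>i. {f \<in> pcarrier s. ?I +>\<^bsub>?R\<^esub> f \<in> Q i}"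
      have primeP: "primeideal (?P i) ?R" if "i \<le> n" for i
        using h.primeideal_vimage[OF cring_mpoly_ring] Q that by (auto simp: prime_chain_def)
      have "prime_chain ?R n ?P"
        unfolding prime_chain_def
      proof (intro conjI allI impI)
        fix i assume i: "i < n"
        then have lt: "Q i \<subset> Q (Suc i)" and pr: "primeideal (Q (Suc i)) (?R Quot ?I)" using Q by (auto simp: prime_chain_def)
        then obtain a where a: "a \<in> Q (Suc i)" "a \<notin> Q i" by blast
        then have "a \<in> carrier (?R Quot ?I)"
          using additive_subgroup.a_subset[OF ideal.axioms(1)[OF primeideal.axioms(1)[OF pr]]] by blast
        then obtain f where "f \<in> pcarrier s" "a = ?I +>\<^bsub>?R\<^esub> f" using quot_surj by blast
        then show "?P i \<subset> ?P (Suc i)" using lt a by blast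
      qed (rule primeP)
      moreover have "?I \<subseteq> ?P 0"
      proof
        fix f assume f: "f \<in> ?I"
        then have fc: "f \<in> pcarrier s" using I.a_subset by blast
        have "?I +>\<^bsub>?R\<^esub> f = ?I" by (rule I.a_rcos_const[OF f])
        also have "\<dots> = \<zero>\<^bsub>?R Quot ?I\<^esub>" unfolding FactRing_def by (simp only: ring.simps)
        also have "\<dots> \<in> Q 0"
        proof -
          have "primeideal (Q 0) (?R Quot ?I)" using Q by (simp add: prime_chain_def)
          then show ?thesis by (rule additive_subgroup.zero_closed[OF ideal.axioms(1)[OF primeideal.axioms(1)]])
        qed
        finally show "f \<in> ?P 0" using fc by simp
      qed
      \<comment> \<open>The largest prime is arbitrary, so only growth exponent 0 is at hand for
        it.\<close>
      moreover have "dim_ge s (?P n) m ((m + 0) choose 0)" for m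
        using dim_ge_prime[OF primeP[of n]] by simp
      ultimately have "0 + n \<le> s - r" by (rule prime_chain_bound_lattice_ideal)
      then show "x \<le> enat (s - r)" using x by simp
    qed
  qed
qed

lemma quotient_degree_lattice_ideal:
  "quotient_degree s (lattice_ideal s L :: 'k::field mpoly set) \<ge> real (card (lat_class ` M))"
  using class_count_limit_ge
  by (simp add: quotient_degree_def krull_dim_quotient affine_hilbert_function_lattice_ideal Let_def)

section \<open>The torsion subgroup of the quotient by the lattice\<close>

abbreviation tors :: "(nat \<Rightarrow>\<^sub>0 int) set monoid" where
  "tors \<equiv> torsion_group (free_Abelian_group {..<s} Mod L)"

lemma coset_eq_lat_class: "L #>\<^bsub>free_Abelian_group {..<s}\<^esub> x = lat_class x"
proof (intro equalityI subsetI)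
  fix y assume "y \<in> lat_class x"
  then show "y \<in> L #>\<^bsub>free_Abelian_group {..<s}\<^esub> x"
    unfolding r_coset_def lat_class_def by (auto intro!: bexI[of _ "y - x"])
qed (auto simp: r_coset_def lat_class_def)

lemma tors_mult:
  assumes "keys x \<subseteq> {..<s}" "keys y \<subseteq> {..<s}"
  shows "lat_class x \<otimes>\<^bsub>tors\<^esub> lat_class y = lat_class (x + y)"
proof -
  interpret comm_group "free_Abelian_group {..<s}" by (rule abelian_free_Abelian_group)
  have "L \<lhd> free_Abelian_group {..<s}" using subgroup_L by (simp add: normal_iff_subgroup)
  then show ?thesis
    using normal.rcos_sum[of L "free_Abelian_group {..<s}" x y] assms
    by (simp add: coset_eq_lat_class torsion_group_def FactGroup_def)
qed

lemma tors_one: "\<one>\<^bsub>tors\<^esub> = lat_class 0"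
proof -
  have "\<one>\<^bsub>tors\<^esub> = L" by (simp add: torsion_group_def FactGroup_def)
  also have "L = lat_class 0" by (simp add: lat_class_def)
  finally show ?thesis .
qed

lemma tors_pow:
  assumes "keys x \<subseteq> {..<s}"
  shows "lat_class x [^]\<^bsub>tors\<^esub> (n::nat) = lat_class (frag_cmul (int n) x)"
proof (induction n)
  case 0
  show ?case using tors_one by (simp add: nat_pow_def)
next
  case (Suc n)
  have "lat_class x [^]\<^bsub>tors\<^esub> Suc n = lat_class x [^]\<^bsub>tors\<^esub> n \<otimes>\<^bsub>tors\<^esub> lat_class x" by (simp add: nat_pow_def)
  also have "\<dots> = lat_class (frag_cmul (int n) x + x)"
    unfolding Suc using assms keys_cmul[of "int n" x] by (intro tors_mult) auto
  finally show ?case by (simp add: frag_cmul_distrib add.commute)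
qed

lemma tors_pow_Mod: "x [^]\<^bsub>free_Abelian_group {..<s} Mod L\<^esub> (n::nat) = x [^]\<^bsub>tors\<^esub> n"
  by (simp add: nat_pow_def torsion_group_def)

lemma carrier_tors: "carrier tors = lat_class ` M"
proof -
  have tors: "(\<exists>n::nat. n > 0 \<and> lat_class x [^]\<^bsub>tors\<^esub> n = \<one>\<^bsub>tors\<^esub>) \<longleftrightarrow> x \<in> M" if x: "keys x \<subseteq> {..<s}" for x
  proof -
    have "(\<exists>n::nat. n > 0 \<and> lat_class x [^]\<^bsub>tors\<^esub> n = \<one>\<^bsub>tors\<^esub>) \<longleftrightarrow> (\<exists>n::nat. n > 0 \<and> frag_cmul (int n) x \<in> L)"
      by (simp add: tors_pow[OF x] tors_one lat_class_eq_iff)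
    also have "\<dots> \<longleftrightarrow> x \<in> M" using torsion_imp_M[OF x] M_torsion N_pos by (metis of_nat_0_less_iff less_irrefl)
    finally show ?thesis .
  qed
  have "carrier tors = {C \<in> lat_class ` {x. keys x \<subseteq> {..<s}}. \<exists>n::nat. n > 0 \<and> C [^]\<^bsub>tors\<^esub> n = \<one>\<^bsub>tors\<^esub>}"
  proof -
    have "carrier (free_Abelian_group {..<s} Mod L) = lat_class ` {x. keys x \<subseteq> {..<s}}"
      by (auto simp: FactGroup_def RCOSETS_def coset_eq_lat_class)
    moreover have "\<one>\<^bsub>free_Abelian_group {..<s} Mod L\<^esub> = \<one>\<^bsub>tors\<^esub>" by (simp add: torsion_group_def)
    moreover have "carrier tors = {C \<in> carrier (free_Abelian_group {..<s} Mod L).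
        \<exists>n::nat. n > 0 \<and> C [^]\<^bsub>free_Abelian_group {..<s} Mod L\<^esub> n = \<one>\<^bsub>free_Abelian_group {..<s} Mod L\<^esub>}"
      by (simp add: torsion_group_def)
    ultimately show ?thesis by (simp only: tors_pow_Mod)
  qed
  also have "\<dots> = lat_class ` M" using tors M_carrier by auto
  finally show ?thesis .
qed

lemma group_tors: "group tors"
proof (rule groupI)
  fix C D assume "C \<in> carrier tors" "D \<in> carrier tors"
  then show "C \<otimes>\<^bsub>tors\<^esub> D \<in> carrier tors" unfolding carrier_tors by (auto simp: tors_mult M_carrier intro!: imageI M_add)
next
  fix C D E assume "C \<in> carrier tors" "D \<in> carrier tors" "E \<in> carrier tors"
  then show "C \<otimes>\<^bsub>tors\<^esub> D \<otimes>\<^bsub>tors\<^esub> E = C \<otimes>\<^bsub>tors\<^esub> (D \<otimes>\<^bsub>tors\<^esub> E)"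
    unfolding carrier_tors by (auto simp: tors_mult M_carrier keys_add_sub add.assoc)
next
  fix C assume "C \<in> carrier tors"
  then obtain x where x: "x \<in> M" "C = lat_class x" unfolding carrier_tors by blast
  then show "\<one>\<^bsub>tors\<^esub> \<otimes>\<^bsub>tors\<^esub> C = C" by (simp add: tors_one tors_mult M_carrier)
  show "\<exists>D\<in>carrier tors. D \<otimes>\<^bsub>tors\<^esub> C = \<one>\<^bsub>tors\<^esub>"
    using x M_uminus unfolding carrier_tors by (intro bexI[of _ "lat_class (- x)"]) (auto simp: tors_one tors_mult M_carrier)
qed (auto simp: tors_one carrier_tors)

text \<open>By Lagrange every element of a subgroup of order prime to p is killed by that order,
  hence lies in the coprime part; the assumption on cardinality makes the coprime part itself such a
  subgroup.\<close>

lemma largest_coprime_subgroup_tors: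
  assumes "prime p" "\<not> p dvd card (lat_class ` coprime_part p)"
  shows "largest_coprime_subgroup p tors H \<longleftrightarrow> H = lat_class ` coprime_part p"
proof -
  let ?G = "lat_class ` coprime_part p"
  have sub: "add_subgroup (coprime_part p)" using assms(1) by (intro add_subgroup_coprime_part) simp
  have GM: "coprime_part p \<subseteq> M" by (auto simp: coprime_part_def)
  have "subgroup ?G tors"
  proof (rule group.subgroupI[OF group_tors])
    show "?G \<subseteq> carrier tors" using GM by (auto simp: carrier_tors)
    show "?G \<noteq> {}" using add_subgroupD(1)[OF sub] by blast
    fix C assume "C \<in> ?G"
    then obtain x where x: "x \<in> coprime_part p" "C = lat_class x" by blast
    have xM: "x \<in> M" using x GM by blast
    have "lat_class (- x) \<otimes>\<^bsub>tors\<^esub> lat_class x = \<one>\<^bsub>tors\<^esub>"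
      using M_carrier[OF xM] M_carrier[OF M_uminus[OF xM]] by (simp add: tors_mult tors_one)
    then have "inv\<^bsub>tors\<^esub> C = lat_class (- x)"
      using group.inv_equality[OF group_tors] xM M_uminus[OF xM] by (simp add: x(2) carrier_tors)
    then show "inv\<^bsub>tors\<^esub> C \<in> ?G" using add_subgroupD(3)[OF sub x(1)] by simp
    fix D assume "D \<in> ?G"
    then obtain y where y: "y \<in> coprime_part p" "D = lat_class y" by blast
    have "C \<otimes>\<^bsub>tors\<^esub> D = lat_class (x + y)"
      unfolding x(2) y(2) using x y GM M_carrier by (intro tors_mult) blast+
    then show "C \<otimes>\<^bsub>tors\<^esub> D \<in> ?G" using add_subgroupD(4)[OF sub x(1) y(1)] by simp
  qed
  moreover have "coprime (card ?G) p"
    using assms by (metis coprime_commute prime_imp_coprime)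
  moreover have "K \<subseteq> ?G" if K: "subgroup K tors" "coprime (card K) p" for K
  proof
    fix C assume C: "C \<in> K"
    then have "C \<in> carrier tors" using subgroup.subset[OF K(1)] by blast
    then obtain x where x: "x \<in> M" "C = lat_class x" unfolding carrier_tors by blast
    interpret K: group "tors\<lparr>carrier := K\<rparr>" by (rule group.subgroup_imp_group[OF group_tors K(1)])
    have "C [^]\<^bsub>tors\<lparr>carrier := K\<rparr>\<^esub> card K = \<one>\<^bsub>tors\<lparr>carrier := K\<rparr>\<^esub>"
      using K.pow_order_eq_1[of C] C by (simp add: Coset.order_def)
    then have "C [^]\<^bsub>tors\<^esub> card K = \<one>\<^bsub>tors\<^esub>" by (simp add: nat_pow_def)
    then have "frag_cmul (int (card K)) x \<in> L"
      by (simp add: x(2) tors_pow[OF M_carrier[OF x(1)]] tors_one lat_class_eq_iff)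
    moreover have "\<not> p dvd card K"
      using K(2) assms(1) by (metis coprime_absorb_right not_prime_unit)
    ultimately show "C \<in> ?G" using x by (auto simp: coprime_part_def)
  qed
  ultimately show ?thesis unfolding largest_coprime_subgroup_def by blast
qed

lemma coprime_part_0: "coprime_part 0 = M"
  using M_torsion N_pos by (auto simp: coprime_part_def)

lemma card_coprime_part_le: "card (lat_class ` coprime_part p) \<le> card (lat_class ` M)"
  using finite_class_M by (intro card_mono image_mono) (auto simp: coprime_part_def)

end

theorem theorem3p2:
  fixes s p c :: nat
    and L :: "(nat \<Rightarrow>\<^sub>0 int) set"
    and I :: "'k::field mpoly set"
    and T :: "(nat \<Rightarrow>\<^sub>0 int) set monoid"
  assumes "p = CHAR('k)"
    and "subgroup L (free_Abelian_group {..<s})"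
    and "I = lattice_ideal s L"
    and "T = torsion_group (free_Abelian_group {..<s} Mod L)"
    and "c = card (associated_primes (mpoly_ring s) I)"
  shows
    "(finite (associated_primes (mpoly_ring s) I) \<and> finite (carrier T) \<and>
        (p > 0 \<longrightarrow> (\<exists>!G. largest_coprime_subgroup p T G))) \<and>
     \<comment> \<open>(a)\<close>
     (\<forall>P \<in> associated_primes (mpoly_ring s) I. prime_height (mpoly_ring s) P = lattice_rank L) \<and>
     \<comment> \<open>(b)\<close>
     (p = 0 \<longrightarrow>
        Coset.order T \<ge> c \<and> (field_alg_closed TYPE('k) \<longrightarrow> Coset.order T = c)) \<and>
     (p > 0 \<longrightarrow> (\<forall>G. largest_coprime_subgroup p T G \<longrightarrow>
        card G \<ge> c \<and> (field_alg_closed TYPE('k) \<longrightarrow> card G = c))) \<and>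
     \<comment> \<open>(c)\<close>
     (p = 0 \<longrightarrow> quotient_degree s I \<ge> real (Coset.order T)) \<and>
     (p > 0 \<longrightarrow> (\<forall>G. largest_coprime_subgroup p T G \<longrightarrow> quotient_degree s I \<ge> real (card G)))"
proof -
  obtain r b d N where "adapted_basis s L r b d N" using ex_adapted_basis[OF assms(2)] by blast
  then interpret adapted_basis s L r b d N .
  have order: "Coset.order T = card (lat_class ` M)" and fin: "finite (carrier T)"
    using finite_class_M by (simp_all add: assms(4) Coset.order_def carrier_tors)
  have deg: "quotient_degree s I \<ge> real (card (lat_class ` M))"
    unfolding assms(3) by (rule quotient_degree_lattice_ideal)
  note ass = associated_primes_lattice_ideal[where ?'k = 'k, folded assms(1) assms(3), folded assms(5)]
  have height: "prime_height (mpoly_ring s) P = lattice_rank L" if "P \<in> associated_primes (mpoly_ring s) I" for P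
    using ass(4)[OF that] rank by simp
  show ?thesis
  proof (cases "p = 0")
    case True
    then have "c \<le> Coset.order T" "field_alg_closed TYPE('k) \<Longrightarrow> Coset.order T = c"
      using ass(2,3) by (simp_all add: order coprime_part_0)
    then show ?thesis using True ass(1) fin height deg order by simp
  next
    case False
    then have p: "prime p" using CHAR_cases[where ?'e = 'k] assms(1) by simp
    \<comment> \<open>Counting characters showed that the number of classes is nonzero in the
      closure, hence not divisible by \<open>p\<close>.\<close>
    have "of_nat (card (lat_class ` coprime_part p)) \<noteq> (0 :: 'k alg_closure)"
      using card_chars_coprime_part[where ?'e = "'k alg_closure"] by (simp add: assms(1))
    then have "\<not> p dvd card (lat_class ` coprime_part p)"
      by (simp add: of_nat_eq_0_iff_char_dvd assms(1))
    then have G: "largest_coprime_subgroup p T G \<longleftrightarrow> G = lat_class ` coprime_part p" for G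
      unfolding assms(4) by (rule largest_coprime_subgroup_tors[OF p])
    have "real (card (lat_class ` coprime_part p)) \<le> quotient_degree s I"
      using deg card_coprime_part_le[of p] by linarith
    then show ?thesis using False ass fin height by (simp add: G)
  qed
qed

end
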